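(* Let $m\in\mathbb Z^+$ and $\mathcal D_{2m}=\{(z,w)\in\mathbb C^2:|z|^2+|w|^{2m}<1\}$. Then the Fefferman--Szegő kernel of $\mathcal D_{2m}$ is given by $$S_{\mathcal D_{2m}}(\zeta,\eta)=c_{\mathcal D_{2m}}\,\frac{(m+2)(1-z_1\overline{z}_2)^{\frac1m}+(1-m)w_1\overline{w}_2}{3m\,(1-z_1\overline{z}_2)^{\frac{4m-1}{3m}}\big((1-z_1\overline{z}_2)^{\frac1m}-w_1\overline{w}_2\big)^2}$$ for all $\zeta=(z_1,w_1)$, $\eta=(z_2,w_2)\in\mathcal D_{2m}$, where $c_{\mathcal D_{2m}}=m^{1/3}/(2\pi^2)$.
   Context: Powers of $1-z_1\overline z_2$ (which has positive real part) are taken with the principal branch. Put $\rho(z,w)=|z|^2+|w|^{2m}-1$ and let $\sigma_{\mathrm E}$ be the Euclidean surface measure on $\partial\mathcal D_{2m}$. The Fefferman surface area measure is $d\sigma_{\mathrm F}=\varpi_{\mathrm F}\,d\sigma_{\mathrm E}$ with $$\varpi_{\mathrm F}=\frac1{|d\rho|}\left|\det\begin{pmatrix}\rho&\partial_{\bar j}\rho\\ \partial_i\rho&\partial_i\partial_{\bar j}\rho\end{pmatrix}_{1\le i,j\le 2}\right|^{\frac13},\qquad |d\rho|=\big(|\partial_z\rho|^2+|\partial_w\rho|^2\big)^{1/2},$$ i.e. $\varpi_{\mathrm F}(z,w)=\dfrac{(m^2|w|^{2m-2})^{1/3}}{\sqrt{|z|^2+m^2|w|^{4m-2}}}$ on $\partial\mathcal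 D_{2m}$. For $\xi\in\partial\mathcal D_{2m}$ let $\nu_\xi$ be the outward unit normal and let $\delta_\xi(z)$ be the minimum of the Euclidean distances from $z$ to $\partial\mathcal D_{2m}$ and to the tangent plane of $\partial\mathcal D_{2m}$ at $\xi$. For $\alpha>0$ let $\Gamma_\alpha(\xi)=\{z\in\mathcal D_{2m}:|(\xi-z)\cdot\overline{\nu_\xi}|<(1+\alpha)\delta_\xi(z),\ |\xi-z|^2<\alpha\delta_\xi(z)\}$, where $\cdot$ is the complex bilinear dot product, and let $\mathcal N(f)(\xi)=\sup_{z\in\Gamma_\alpha(\xi)}|f(z)|$. The Fefferman--Hardy space $\mathrm H^2_{\mathrm F}(\partial\mathcal D_{2m})$ is the set of holomorphic $f$ on $\mathcal D_{2m}$ with $\mathcal N(f)\in L^2(\partial\mathcal D_{2m},\sigma_{\mathrm F})$. Each such $f$ has a non-tangential boundary value $f^*$ (limit within $\Gamma_\alpha(\xi)$ for all $\alpha>0$) $\sigma_{\mathrm F}$-a.e., and with the norm $\big(\int_{\partial\mathcal D_{2m}}|f^*|^2d\sigma_{\mathrm F}\big)^{1/2}$ the space is a reproducing kernel Hilbert space. Its reproducing kernel $S_{\mathcal D_{2m}}$, satisfying $f(\zeta)=\int_{\partial\mathcal D_{2m}}S_{\mathcal D_{2m}}(\zeta,\xi)f^*(\xi)\,d\sigma_{\mathrm F}(\xi)$ and equal to $\sum_j\phi_j(\zeta)\overline{\phi_j(\eta)}$ for any complete orthonormal basis $\{\phi_j\}$, is the Fefferman--Szegő kernel. *)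

theory Defs
  imports "HOL-Analysis.Analysis"
begin

type_synonym C2 = "complex \<times> complex"

definition cscale :: "complex \<Rightarrow> C2 \<Rightarrow> C2" where
  "cscale c p = (c * fst p, c * snd p)"

definition hermitian_dot :: "C2 \<Rightarrow> C2 \<Rightarrow> complex" where
  "hermitian_dot p q = fst p * cnj (fst q) + snd p * cnj (snd q)"

text \<open>Holomorphy in two variables: the total real derivative exists and is complex linear.\<close>

definition holomorphic2_on :: "(C2 \<Rightarrow> complex) \<Rightarrow> C2 set \<Rightarrow> bool" where
  "holomorphic2_on f D \<longleftrightarrow>
     (\<forall>p\<in>D. \<exists>a b. (f has_derivative (\<lambda>h. a * fst h + b * snd h)) (at p))"

text \<open>Wirtinger derivatives; the index is a coordinate vector, with \<^term>\<open>(1, 0)\<close> for \<open>z\<close> and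
  \<^term>\<open>(0, 1)\<close> for \<open>w\<close>.\<close>

definition wirtinger :: "C2 \<Rightarrow> (C2 \<Rightarrow> complex) \<Rightarrow> C2 \<Rightarrow> complex" where
  "wirtinger e f p =
     (frechet_derivative f (at p) e - \<i> * frechet_derivative f (at p) (cscale \<i> e)) / 2"

definition wirtinger_bar :: "C2 \<Rightarrow> (C2 \<Rightarrow> complex) \<Rightarrow> C2 \<Rightarrow> complex" where
  "wirtinger_bar e f p =
     (frechet_derivative f (at p) e + \<i> * frechet_derivative f (at p) (cscale \<i> e)) / 2"


text \<open>A regular \<open>C\<^sup>1\<close> local parametrization of the hypersurface \<open>M\<close>, with derivative \<open>\<phi>'\<close>.\<close>

definition local_parametrization ::
  "C2 set \<Rightarrow> (real^3) set \<Rightarrow> (real^3 \<Rightarrow> C2) \<Rightarrow> (real^3 \<Rightarrow> (real^3) \<Rightarrow>\<^sub>L C2) \<Rightarrow> bool" where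
  "local_parametrization M U \<phi> \<phi>' \<longleftrightarrow>
     open U \<and> openin (top_of_set M) (\<phi> ` U) \<and>
     (\<exists>\<psi>. homeomorphism U (\<phi> ` U) \<phi> \<psi>) \<and>
     (\<forall>x\<in>U. (\<phi> has_derivative blinfun_apply (\<phi>' x)) (at x)) \<and>
     continuous_on U \<phi>' \<and>
     (\<forall>x\<in>U. inj (blinfun_apply (\<phi>' x)))"

definition area_element :: "((real^3) \<Rightarrow>\<^sub>L C2) \<Rightarrow> real" where
  "area_element L =
     sqrt (det (\<chi> i j. blinfun_apply L (axis i 1) \<bullet> blinfun_apply L (axis j 1) :: real^3^3))"

definition is_surface_measure :: "C2 set \<Rightarrow> C2 measure \<Rightarrow> bool" where
  "is_surface_measure M \<mu> \<longleftrightarrow>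
     sets \<mu> = sets borel \<and> emeasure \<mu> (- M) = 0 \<and>
     (\<forall>U \<phi> \<phi>' A. local_parametrization M U \<phi> \<phi>' \<longrightarrow> A \<in> sets borel \<longrightarrow> A \<subseteq> U \<longrightarrow>
        emeasure \<mu> (\<phi> ` A) = (\<integral>\<^sup>+x\<in>A. ennreal (area_element (\<phi>' x)) \<partial>lborel))"

text \<open>The surface measure is regarded as a Borel measure on the ambient space, concentrated
  on \<open>M\<close>; it is unique as soon as \<open>M\<close> is covered by local parametrizations.\<close>

definition surface_measure :: "C2 set \<Rightarrow> C2 measure" where
  "surface_measure M = (THE \<mu>. is_surface_measure M \<mu>)"


definition egg :: "nat \<Rightarrow> C2 set" where
  "egg m = {(z, w). (cmod z)\<^sup>2 + cmod w ^ (2 * m) < 1}"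

definition rho :: "nat \<Rightarrow> C2 \<Rightarrow> real" where
  "rho m = (\<lambda>(z, w). (cmod z)\<^sup>2 + cmod w ^ (2 * m) - 1)"

abbreviation rhoc :: "nat \<Rightarrow> C2 \<Rightarrow> complex" where
  "rhoc m \<equiv> \<lambda>p. complex_of_real (rho m p)"

definition fefferman_matrix :: "nat \<Rightarrow> C2 \<Rightarrow> complex^3^3" where
  "fefferman_matrix m p =
    (let dz = wirtinger (1, 0); dw = wirtinger (0, 1);
         dzb = wirtinger_bar (1, 0); dwb = wirtinger_bar (0, 1); r = rhoc m
     in vector [vector [r p, dzb r p, dwb r p],
                vector [dz r p, dz (dzb r) p, dz (dwb r) p],
                vector [dw r p, dw (dzb r) p, dw (dwb r) p]])"

definition fefferman_density :: "nat \<Rightarrow> C2 \<Rightarrow> real" where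
  "fefferman_density m p =
     root 3 (cmod (det (fefferman_matrix m p))) /
     sqrt ((cmod (wirtinger (1, 0) (rhoc m) p))\<^sup>2 + (cmod (wirtinger (0, 1) (rhoc m) p))\<^sup>2)"

definition fefferman_measure :: "nat \<Rightarrow> C2 measure" where
  "fefferman_measure m =
     density (surface_measure (frontier (egg m))) (\<lambda>\<xi>. ennreal (fefferman_density m \<xi>))"


text \<open>The normalized real gradient of the defining function.\<close>

definition outward_normal :: "nat \<Rightarrow> C2 \<Rightarrow> C2" where
  "outward_normal m \<xi> = sgn (\<Sum>b\<in>Basis. frechet_derivative (rho m) (at \<xi>) b *\<^sub>R b)"

definition tangent_plane :: "nat \<Rightarrow> C2 \<Rightarrow> C2 set" where
  "tangent_plane m \<xi> = {x. (x - \<xi>) \<bullet> outward_normal m \<xi> = 0}"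

definition boundary_delta :: "nat \<Rightarrow> C2 \<Rightarrow> C2 \<Rightarrow> real" where
  "boundary_delta m \<xi> p = min (infdist p (frontier (egg m))) (infdist p (tangent_plane m \<xi>))"

definition approach_region :: "nat \<Rightarrow> real \<Rightarrow> C2 \<Rightarrow> C2 set" where
  "approach_region m \<alpha> \<xi> =
     {p \<in> egg m. cmod (hermitian_dot (\<xi> - p) (outward_normal m \<xi>)) < (1 + \<alpha>) * boundary_delta m \<xi> p \<and>
                 (norm (\<xi> - p))\<^sup>2 < \<alpha> * boundary_delta m \<xi> p}"

definition nt_maximal :: "nat \<Rightarrow> real \<Rightarrow> (C2 \<Rightarrow> complex) \<Rightarrow> C2 \<Rightarrow> ennreal" where
  "nt_maximal m \<alpha> f \<xi> = (SUP p\<in>approach_region m \<alpha> \<xi>. ennreal (cmod (f p)))"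

text \<open>Since \<open>\<sigma>\<^sub>F\<close> lives on the whole space, the maximal function is cut off to the boundary.\<close>

definition fefferman_hardy :: "nat \<Rightarrow> real \<Rightarrow> (C2 \<Rightarrow> complex) set" where
  "fefferman_hardy m \<alpha> =
     {f. holomorphic2_on f (egg m) \<and>
         (\<lambda>\<xi>. nt_maximal m \<alpha> f \<xi> * indicator (frontier (egg m)) \<xi>)
           \<in> borel_measurable (fefferman_measure m) \<and>
         (\<integral>\<^sup>+\<xi>\<in>frontier (egg m). (nt_maximal m \<alpha> f \<xi>)\<^sup>2 \<partial>fefferman_measure m) < \<infinity>}"

text \<open>\<open>f\<^sup>*\<close> is determined only almost everywhere, so it is rendered as a relation: \<open>g\<close> is a Borel
  representative of \<open>f\<^sup>*\<close>.\<close>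

definition nt_boundary_value :: "nat \<Rightarrow> (C2 \<Rightarrow> complex) \<Rightarrow> (C2 \<Rightarrow> complex) \<Rightarrow> bool" where
  "nt_boundary_value m f g \<longleftrightarrow>
     g \<in> borel_measurable (fefferman_measure m) \<and>
     (AE \<xi> in fefferman_measure m.
        \<forall>\<beta>>0. (f \<longlongrightarrow> g \<xi>) (at \<xi> within approach_region m \<beta> \<xi>))"

text \<open>Reproducing kernel: \<open>S(\<zeta>, \<cdot>)\<close> is the conjugate of an element of the space, and
  \<open>S(\<zeta>, \<xi>)\<close> for a boundary point \<open>\<xi>\<close> is its boundary value, called \<open>s\<close>.\<close>

definition is_fefferman_szego_kernel :: "nat \<Rightarrow> real \<Rightarrow> (C2 \<Rightarrow> C2 \<Rightarrow> complex) \<Rightarrow> bool" where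
  "is_fefferman_szego_kernel m \<alpha> S \<longleftrightarrow>
     (\<forall>\<zeta>\<in>egg m. (\<lambda>\<eta>. cnj (S \<zeta> \<eta>)) \<in> fefferman_hardy m \<alpha> \<and>
        (\<exists>s. nt_boundary_value m (S \<zeta>) s \<and>
          (\<forall>f\<in>fefferman_hardy m \<alpha>. \<forall>fs. nt_boundary_value m f fs \<longrightarrow>
             integrable (fefferman_measure m) (\<lambda>\<xi>. s \<xi> * fs \<xi>) \<and>
             f \<zeta> = (\<integral>\<xi>. s \<xi> * fs \<xi> \<partial>fefferman_measure m))))"

end

theory Submission
  imports Defs "HOL-Complex_Analysis.Complex_Analysis"
begin

text \<open>Up to a null set the boundary is parametrized by \<open>z = \<surd>t e\<^sup>i\<^sup>\<phi>\<close>, \<open>w = (1 - t)\<^sup>1\<^sup>/\<^sup>2\<^sup>m e\<^sup>i\<^sup>\<theta>\<close> with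
  \<open>0 < t < 1\<close>, and there \<open>\<sigma>\<^sub>F\<close> is a constant multiple of \<open>(1 - t)\<^sup>-\<^sup>\<kappa> dt d\<phi> d\<theta>\<close>, \<open>\<kappa> = 2(m - 1)/3m\<close>. Hence
  the monomials are orthogonal and their norms are Beta integrals, and expanding the kernel first in
  \<open>w\<^sub>1 cnj w\<^sub>2\<close> (a differentiated geometric series) and then in \<open>z\<^sub>1 cnj z\<^sub>2\<close> (a binomial series) shows that it
  reproduces them. If \<open>f\<close> is holomorphic in the egg, then \<open>\<xi> \<mapsto> f (r \<xi>)\<close> is a uniform limit of polynomials
  on the closed egg, by Cauchy's formula on tori, so that it is reproduced as well. Since \<open>r \<xi>\<close> tends to
  \<open>\<xi>\<close> inside the approach regions, uniformly in \<open>\<xi>\<close>, the maximal function dominates the limit \<open>r \<rightarrow> 1\<close>.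
  Uniqueness is the usual argument: two reproducing kernels are evaluated on each other.\<close>

text \<open>The surface measure is a definite description that constrains it on every
  \<open>C^1\<close> parametrization. Even computing it in one chart therefore requires that area is
  independent of the chart and that what the chart misses is null. In the polar chart the factor
  \<open>|d rho|\<close> of the density cancels against the area element. The squared norm of
  \<open>z^a w^b\<close> is then a constant times \<open>Beta (a + 1) \<beta>\<close> with
  \<open>\<beta> = b/m + 1 - \<kappa>\<close>, and its reciprocal is proportional to
  \<open>\<beta> (\<beta> + 1)_a / a!\<close>. Summing over \<open>a\<close> gives
  \<open>\<beta> (1 - z1 cnj z2)^(-\<beta> - 1)\<close>. As \<beta> is affine in \<open>b\<close>,
  the sum over \<open>b\<close> combines a geometric series with its derivative; this is the origin
  of the square in the denominator and of the two-term numerator. The constant of the kernel is the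
  reciprocal of the constant of the weight. The egg is not a polydisc, so no single torus serves
  Cauchy's formula on all of it: the torus varies with the point, while the Taylor coefficients turn
  out not to depend on it.\<close>

no_notation fps_nth (infixl \<open>$\<close> 75)

section \<open>Surface measures and change of parametrization\<close>

text \<open>Only continuity of \<open>T\<close> is assumed. Since \<open>F\<close> has the identity
  as derivative at \<open>T x\<close>, the increments of \<open>G\<close> and of \<open>T\<close>
  differ by a small multiple of the increment of \<open>T\<close>. Absorbing this multiple gives a
  Lipschitz estimate for \<open>T\<close> at \<open>x\<close>, and inserting the estimate makes the
  error small relative to \<open>norm (y - x)\<close>.\<close>

lemma has_derivative_left_inverse_comp:
  fixes F :: "'a::real_normed_vector \<Rightarrow> 'a" and G T :: "'b::real_normed_vector \<Rightarrow> 'a"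
  assumes F: "(F has_derivative (\<lambda>h. h)) (at (T x))"
    and G: "(G has_derivative G') (at x)"
    and T: "isCont T x"
    and eq: "eventually (\<lambda>y. F (T y) = G y) (nhds x)"
  shows "(T has_derivative G') (at x)"
proof -
  have bl: "bounded_linear G'"
    using G by (rule has_derivative_bounded_linear)
  obtain B where B: "B > 0" "\<And>h. norm (G' h) \<le> norm h * B"
    using bounded_linear.pos_bounded[OF bl] by blast
  have Fe: "\<exists>d>0. \<forall>y. norm (y - x) < d \<longrightarrow> norm (G y - G x - (T y - T x)) \<le> e * norm (T y - T x)"
    if e: "e > 0" for e
  proof -
    obtain d1 where d1: "d1 > 0" "\<And>b. norm (b - T x) < d1 \<Longrightarrow> norm (F b - F (T x) - (b - T x)) \<le> e * norm (b - T x)"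
      using F e unfolding has_derivative_at_alt by blast
    obtain d2 where d2: "d2 > 0" "\<And>y. dist y x < d2 \<Longrightarrow> dist (T y) (T x) < d1"
      using T d1(1) unfolding continuous_at_eps_delta by blast
    obtain d3 where d3: "d3 > 0" "\<And>y. dist y x < d3 \<Longrightarrow> F (T y) = G y"
      using eq unfolding eventually_nhds_metric by blast
    have "norm (G y - G x - (T y - T x)) \<le> e * norm (T y - T x)" if "norm (y - x) < min d2 d3" for y
    proof -
      have "norm (T y - T x) < d1" using d2(2)[of y] that by (simp add: dist_norm)
      then have "norm (F (T y) - F (T x) - (T y - T x)) \<le> e * norm (T y - T x)" using d1 by blast
      moreover have "F (T y) = G y" "F (T x) = G x" using d3 that by (simp_all add: dist_norm)
      ultimately show ?thesis by simp
    qed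
    then show ?thesis using d2(1) d3(1) by (intro exI[of _ "min d2 d3"]) auto
  qed
  show ?thesis unfolding has_derivative_at_alt
  proof (intro conjI bl allI impI)
    fix e :: real assume e: "e > 0"
    \<comment> \<open>The bound 1/2 lets the error be absorbed into \<open>norm ?D\<close>, which is
      then at most \<open>2 * (B + 1) * norm (y - x)\<close>; the other bound makes
      \<open>e1\<close> times this at most \<open>e / 2 * norm (y - x)\<close>.\<close>
    define e1 where "e1 = min (1/2) (e / (2 * (2 * (B + 1))))"
    have e1: "e1 > 0" "e1 \<le> 1/2" "e1 * (2 * (B + 1)) \<le> e / 2"
    proof -
      show "e1 > 0" using e B by (simp add: e1_def)
      show "e1 \<le> 1/2" unfolding e1_def by (rule min.cobounded1)
      have "e1 \<le> e / (2 * (2 * (B + 1)))" by (simp add: e1_def)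
      then show "e1 * (2 * (B + 1)) \<le> e / 2" using B by (simp add: field_simps)
    qed
    obtain d1 where d1: "d1 > 0" "\<And>y. norm (y - x) < d1 \<Longrightarrow> norm (G y - G x - (T y - T x)) \<le> e1 * norm (T y - T x)"
      using Fe[OF e1(1)] by blast
    define e2 where "e2 = min 1 (e / 2)"
    have "e2 > 0" using e by (simp add: e2_def)
    then obtain d2 where d2: "d2 > 0" "\<And>y. norm (y - x) < d2 \<Longrightarrow> norm (G y - G x - G' (y - x)) \<le> e2 * norm (y - x)"
      using G unfolding has_derivative_at_alt by blast
    show "\<exists>d>0. \<forall>y. norm (y - x) < d \<longrightarrow> norm (T y - T x - G' (y - x)) \<le> e * norm (y - x)"
    proof (intro exI[of _ "min d1 d2"] conjI allI impI)
      show "min d1 d2 > 0" using d1 d2 by simp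
      fix y assume y: "norm (y - x) < min d1 d2"
      let ?D = "T y - T x"
      have a1: "norm (G y - G x - ?D) \<le> e1 * norm ?D" using d1 y by simp
      have a2: "norm (G y - G x - G' (y - x)) \<le> e2 * norm (y - x)" using d2 y by simp
      have "norm (G y - G x) \<le> norm (G y - G x - G' (y - x)) + norm (G' (y - x))"
        using norm_triangle_ineq[of "G y - G x - G' (y - x)" "G' (y - x)"] by simp
      also have "\<dots> \<le> 1 * norm (y - x) + norm (y - x) * B"
        using a2 B(2)[of "y - x"] mult_right_mono[of e2 1 "norm (y - x)"] by (simp add: e2_def)
      finally have g: "norm (G y - G x) \<le> (B + 1) * norm (y - x)" by (simp add: algebra_simps)
      have "norm ?D \<le> norm (G y - G x) + norm (G y - G x - ?D)"
        using norm_triangle_ineq4[of "G y - G x" "G y - G x - ?D"] by simp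
      also have "\<dots> \<le> (B + 1) * norm (y - x) + 1/2 * norm ?D"
        using a1 g mult_right_mono[OF e1(2), of "norm ?D"] by simp
      finally have D: "norm ?D \<le> 2 * (B + 1) * norm (y - x)" unfolding mult.assoc by linarith
      have "?D - G' (y - x) = (G y - G x - G' (y - x)) - (G y - G x - ?D)" by (simp add: algebra_simps)
      then have "norm (?D - G' (y - x)) \<le> norm (G y - G x - ?D) + norm (G y - G x - G' (y - x))"
        using norm_triangle_ineq4[of "G y - G x - G' (y - x)" "G y - G x - ?D"] by (simp only: add.commute)
      also have "\<dots> \<le> e1 * (2 * (B + 1) * norm (y - x)) + e / 2 * norm (y - x)"
      proof (intro add_mono)
        show "norm (G y - G x - ?D) \<le> e1 * (2 * (B + 1) * norm (y - x))"
          using a1 mult_left_mono[OF D, of e1] e1 by linarith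
        show "norm (G y - G x - G' (y - x)) \<le> e / 2 * norm (y - x)"
          using order_trans[OF a2 mult_right_mono[OF min.cobounded2[of 1 "e / 2", folded e2_def] norm_ge_zero]] .
      qed
      also have "\<dots> \<le> e / 2 * norm (y - x) + e / 2 * norm (y - x)"
        using mult_right_mono[OF e1(3), of "norm (y - x)"] by (simp add: mult.assoc)
      finally show "norm (T y - T x - G' (y - x)) \<le> e * norm (y - x)" by simp
    qed
  qed
qed

text \<open>The Gram matrix of the composition is congruent to that of \<open>L2\<close> through
  \<open>matrix T\<close>, so its determinant gains the square of
  \<open>det (matrix T)\<close>.\<close>

lemma area_element_compose:
  assumes lin: "linear T" and eq: "\<And>h. blinfun_apply L1 h = blinfun_apply L2 (T h)"
  shows "area_element L1 = \<bar>det (matrix T)\<bar> * area_element L2"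
proof -
  define G where "G = (\<lambda>L :: (real^3) \<Rightarrow>\<^sub>L C2. \<chi> i j. blinfun_apply L (axis i 1) \<bullet> blinfun_apply L (axis j 1) :: real^3^3)"
  let ?A = "matrix T"
  have L1: "blinfun_apply L1 (axis i 1) = (\<Sum>k\<in>UNIV. (?A $ k $ i) *\<^sub>R blinfun_apply L2 (axis k 1))" for i
  proof -
    have "T (axis i 1) = (\<Sum>k\<in>UNIV. (?A $ k $ i) *\<^sub>R axis k 1)"
      using basis_expansion[of "T (axis i 1)"] by (simp add: matrix_def scalar_mult_eq_scaleR)
    then show ?thesis by (simp add: eq blinfun.sum_right blinfun.scaleR_right)
  qed
  have "G L1 = transpose ?A ** G L2 ** ?A"
    by (simp add: vec_eq_iff G_def L1 matrix_matrix_mult_def transpose_def inner_sum_left inner_sum_right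
        sum_distrib_left sum_distrib_right mult_ac)
  then have "det (G L1) = (det ?A)\<^sup>2 * det (G L2)"
    by (simp add: det_mul det_transpose power2_eq_square)
  moreover have "area_element L = sqrt (det (G L))" for L by (simp only: area_element_def G_def)
  ultimately show ?thesis by (simp add: real_sqrt_mult)
qed

text \<open>Links absolute integrability, in terms of which the change of variables is stated, with
  the nonnegative integral over \<open>lborel\<close> that defines surface measures.\<close>

lemma absolutely_integrable_iff_nn_integral:
  fixes f :: "'a::euclidean_space \<Rightarrow> real"
  assumes nonneg: "\<And>x. x \<in> S \<Longrightarrow> 0 \<le> f x"
    and m: "(\<lambda>x. indicator S x * f x) \<in> borel_measurable borel"
  shows "f absolutely_integrable_on S \<longleftrightarrow> (\<integral>\<^sup>+x\<in>S. ennreal (f x) \<partial>lborel) < \<infinity>"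
    and "f absolutely_integrable_on S \<Longrightarrow> (\<integral>\<^sup>+x\<in>S. ennreal (f x) \<partial>lborel) = ennreal (integral S f)"
proof -
  let ?g = "\<lambda>x. indicator S x *\<^sub>R f x"
  have eq: "(\<integral>\<^sup>+x\<in>S. ennreal (f x) \<partial>lborel) = (\<integral>\<^sup>+x. ennreal (?g x) \<partial>lebesgue)"
    unfolding nn_integral_completion by (intro nn_integral_cong) (auto split: split_indicator)
  have gn: "0 \<le> ?g x" for x using nonneg by (auto split: split_indicator)
  have gm: "?g \<in> borel_measurable lebesgue"
    using m by (intro measurable_completion) simp
  have "integrable lebesgue ?g \<longleftrightarrow> (\<integral>\<^sup>+x. ennreal (?g x) \<partial>lebesgue) < \<infinity>"
    unfolding integrable_iff_bounded using gm gn by (auto simp: ennreal_indicator)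
  then show "f absolutely_integrable_on S \<longleftrightarrow> (\<integral>\<^sup>+x\<in>S. ennreal (f x) \<partial>lborel) < \<infinity>"
    unfolding eq set_integrable_def .
  assume si: "f absolutely_integrable_on S"
  have "(\<integral>\<^sup>+x. ennreal (?g x) \<partial>lebesgue) = ennreal (integral\<^sup>L lebesgue ?g)"
    by (rule nn_integral_eq_integral) (use si gn in \<open>auto simp: set_integrable_def\<close>)
  also have "integral\<^sup>L lebesgue ?g = integral S f"
    using set_lebesgue_integral_eq_integral(2)[OF si] by (simp add: set_lebesgue_integral_def)
  finally show "(\<integral>\<^sup>+x\<in>S. ennreal (f x) \<partial>lborel) = ennreal (integral S f)" unfolding eq .
qed

text \<open>Infinite values are included: absolute integrability of one side is equivalent to that
  of the other, and where it fails both nonnegative integrals are infinite.\<close>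

lemma nn_integral_change_of_variables:
  fixes g :: "real^3 \<Rightarrow> real^3" and f :: "real^3 \<Rightarrow> real"
  assumes S: "S \<in> sets borel"
    and der: "\<And>x. x \<in> S \<Longrightarrow> (g has_derivative g' x) (at x within S)"
    and inj: "inj_on g S"
    and nonneg: "\<And>x. x \<in> g ` S \<Longrightarrow> 0 \<le> f x"
    and m1: "(\<lambda>x. indicator (g ` S) x * f x) \<in> borel_measurable borel"
    and m2: "(\<lambda>x. indicator S x * (\<bar>det (matrix (g' x))\<bar> * f (g x))) \<in> borel_measurable borel"
  shows "(\<integral>\<^sup>+x\<in>g ` S. ennreal (f x) \<partial>lborel) = (\<integral>\<^sup>+x\<in>S. ennreal (\<bar>det (matrix (g' x))\<bar> * f (g x)) \<partial>lborel)"
proof -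
  let ?h = "\<lambda>x. \<bar>det (matrix (g' x))\<bar> * f (g x)"
  have Sl: "S \<in> sets lebesgue"
    using S by (auto intro: sets_completionI_sets)
  \<comment> \<open>The change of variables concerns functions with values in some
    \<open>real^n\<close>, so the scalar function is viewed as one with values in
    \<open>real^1\<close>.\<close>
  have cov: "?h absolutely_integrable_on S \<and> integral S ?h = b \<longleftrightarrow>
      f absolutely_integrable_on (g ` S) \<and> integral (g ` S) f = b" for b
    using has_absolute_integral_change_of_variables[OF Sl der inj, of "\<lambda>x. vec (f x) :: real^1" "vec b"]
    by (simp add: absolutely_integrable_on_1_iff integral_on_1_eq)
  have hn: "0 \<le> ?h x" if "x \<in> S" for x using nonneg that by simp
  note 1 = absolutely_integrable_iff_nn_integral[OF nonneg m1]
    and 2 = absolutely_integrable_iff_nn_integral[OF hn m2]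
  show ?thesis
  proof (cases "f absolutely_integrable_on (g ` S)")
    case True
    then have "?h absolutely_integrable_on S" "integral S ?h = integral (g ` S) f"
      using cov by blast+
    then show ?thesis using 1(2) 2(2) True by simp
  next
    case False
    then have "\<not> ?h absolutely_integrable_on S" using cov by blast
    then have "\<not> (\<integral>\<^sup>+x\<in>S. ennreal (?h x) \<partial>lborel) < \<infinity>" using 2(1) by blast
    moreover have "\<not> (\<integral>\<^sup>+x\<in>g ` S. ennreal (f x) \<partial>lborel) < \<infinity>" using False 1(1) by blast
    ultimately show ?thesis unfolding infinity_ennreal_def less_top[symmetric] by (metis (no_types))
  qed
qed

section \<open>Continuity, injectivity and Borel images of charts\<close>

lemma local_parametrization_continuous:
  assumes "local_parametrization M U \<phi> \<phi>'"
  shows "continuous_on U \<phi>"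
  using assms unfolding local_parametrization_def
  by (meson continuous_on_eq_continuous_within has_derivative_continuous continuous_at_imp_continuous_at_within)

lemma local_parametrization_inj:
  assumes "local_parametrization M U \<phi> \<phi>'"
  shows "inj_on \<phi> U"
  using assms unfolding local_parametrization_def homeomorphism_def by (metis inj_onI)

lemma vimage_Int_borel:
  fixes f :: "'a::topological_space \<Rightarrow> 'b::topological_space"
  assumes "continuous_on A f" "A \<in> sets borel" "B \<in> sets borel"
  shows "A \<inter> f -` B \<in> sets borel"
proof -
  have "f \<in> borel_measurable (restrict_space borel A)"
    using assms(1) by (rule borel_measurable_continuous_on_restrict)
  then have "f -` B \<inter> space (restrict_space borel A) \<in> sets (restrict_space borel A)"
    using assms(3) by (rule measurable_sets)
  then show ?thesis
    using assms(2) by (simp add: sets_restrict_space_iff space_restrict_space Int_commute)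
qed

text \<open>A continuous image of a Borel set need not be Borel. The continuous inverse turns this
  image into a preimage inside the image of \<open>U\<close>, which is \<open>M\<close> cut with an
  open set.\<close>

lemma local_parametrization_image_borel:
  assumes P: "local_parametrization M U \<phi> \<phi>'" and M: "M \<in> sets borel"
    and A: "A \<in> sets borel" "A \<subseteq> U"
  shows "\<phi> ` A \<in> sets borel"
proof -
  obtain \<psi> where \<psi>: "homeomorphism U (\<phi> ` U) \<phi> \<psi>" using P unfolding local_parametrization_def by blast
  obtain W where W: "open W" "\<phi> ` U = M \<inter> W"
    using P unfolding local_parametrization_def openin_open by blast
  then have b: "\<phi> ` U \<in> sets borel" using M by simp
  have "\<phi> ` A = \<phi> ` U \<inter> \<psi> -` A"
    using \<psi> A unfolding homeomorphism_def by force
  also have "\<dots> \<in> sets borel"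
    using \<psi> b A by (intro vimage_Int_borel) (auto simp: homeomorphism_def)
  finally show ?thesis .
qed

lemma continuous_on_area_element:
  assumes "local_parametrization M U \<phi> \<phi>'"
  shows "continuous_on U (\<lambda>x. area_element (\<phi>' x))"
proof -
  have c: "continuous_on U \<phi>'" using assms unfolding local_parametrization_def by blast
  have c': "continuous_on U (\<lambda>x. blinfun_apply (\<phi>' x) v)" for v
    by (intro continuous_intros c)
  show ?thesis
    unfolding area_element_def det_3 by (auto intro!: continuous_intros c')
qed

text \<open>\<open>sqrt\<close> of a negative real is negative, so nonnegativity of
  \<open>area_element\<close> would rest on that of a Gram determinant. Truncation by
  \<open>max 0\<close> provides the nonnegativity that the change of variables asks for, and it
  disappears under \<open>ennreal\<close>.\<close>

lemma area_element_measurable: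
  assumes P: "local_parametrization M U \<phi> \<phi>'" and S: "S \<in> sets borel" "S \<subseteq> U"
  shows "(\<lambda>x. indicator S x * max 0 (area_element (\<phi>' x))) \<in> borel_measurable borel"
    and "(\<lambda>x. ennreal (area_element (\<phi>' x)) * indicator S x) \<in> borel_measurable borel"
proof -
  have [measurable]: "(\<lambda>x. indicator S x *\<^sub>R area_element (\<phi>' x)) \<in> borel_measurable borel"
    by (rule borel_measurable_continuous_on_indicator[OF S(1) continuous_on_subset[OF continuous_on_area_element[OF P] S(2)]])
  have "(\<lambda>x. max 0 (indicator S x *\<^sub>R area_element (\<phi>' x))) \<in> borel_measurable borel"
    and "(\<lambda>x. ennreal (indicator S x *\<^sub>R area_element (\<phi>' x))) \<in> borel_measurable borel" by measurable
  moreover have "(\<lambda>x. max 0 (indicator S x *\<^sub>R area_element (\<phi>' x))) = (\<lambda>x. indicator S x * max 0 (area_element (\<phi>' x)))"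
    and "(\<lambda>x. ennreal (indicator S x *\<^sub>R area_element (\<phi>' x))) = (\<lambda>x. ennreal (area_element (\<phi>' x)) * indicator S x)"
    by (auto simp: fun_eq_iff split: split_indicator)
  ultimately show "(\<lambda>x. indicator S x * max 0 (area_element (\<phi>' x))) \<in> borel_measurable borel"
    and "(\<lambda>x. ennreal (area_element (\<phi>' x)) * indicator S x) \<in> borel_measurable borel" by simp_all
qed

text \<open>No inverse function theorem is needed: a linear left inverse of the derivative of \<open>\<tau>\<close>, applied
  to \<open>\<tau> \<circ> T = \<phi>\<close>, exhibits \<open>T\<close> as a solution of an equation in the parameter space.\<close>

lemma parametrization_transition:
  assumes P: "local_parametrization M U \<phi> \<phi>'" and Q: "local_parametrization M V \<tau> \<tau>'"
    and \<psi>: "homeomorphism V (\<tau> ` V) \<tau> \<psi>"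
    and x: "x \<in> U" "\<phi> x \<in> \<tau> ` V"
  shows "\<exists>T'. ((\<lambda>y. \<psi> (\<phi> y)) has_derivative T') (at x) \<and>
     (\<forall>h. blinfun_apply (\<phi>' x) h = blinfun_apply (\<tau>' (\<psi> (\<phi> x))) (T' h))"
proof -
  let ?T = "\<lambda>y. \<psi> (\<phi> y)"
  have U: "open U" and der\<phi>: "(\<phi> has_derivative blinfun_apply (\<phi>' x)) (at x)"
    using P x unfolding local_parametrization_def by auto
  obtain W where W: "open W" "\<tau> ` V = M \<inter> W"
    using Q unfolding local_parametrization_def openin_open by blast
  have \<phi>M: "\<phi> ` U \<subseteq> M"
    using P unfolding local_parametrization_def by (meson openin_imp_subset)
  have cont: "continuous_on U \<phi>" by (rule local_parametrization_continuous[OF P])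
  define N where "N = U \<inter> \<phi> -` W"
  have N: "open N" "x \<in> N" "N \<subseteq> U"
    using continuous_open_preimage[OF cont U W(1)] x W by (auto simp: N_def)
  have N\<tau>: "\<phi> y \<in> \<tau> ` V" if "y \<in> N" for y
    using that \<phi>M unfolding W(2) N_def by blast
  have \<psi>': "\<tau> (\<psi> p) = p" "\<psi> p \<in> V" if "p \<in> \<tau> ` V" for p
    using \<psi> that unfolding homeomorphism_def by auto
  let ?L = "blinfun_apply (\<tau>' (?T x))"
  have TV: "?T x \<in> V" using \<psi>' x by blast
  have L: "(\<tau> has_derivative ?L) (at (?T x))" "inj ?L"
    using Q TV unfolding local_parametrization_def by auto
  have lin: "linear ?L" by (simp add: blinfun.bounded_linear_right linear_conv_bounded_linear)
  obtain R where R: "linear R" "R \<circ> ?L = id"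
    using linear_injective_left_inverse[OF lin L(2)] by blast
  have bR: "bounded_linear R" using R(1) by (simp add: linear_conv_bounded_linear)
  let ?F = "\<lambda>b. R (\<tau> b)" and ?G = "\<lambda>y. R (\<phi> y)"
  have F: "(?F has_derivative (\<lambda>h. h)) (at (?T x))"
    using bounded_linear.has_derivative[OF bR L(1)] R(2) by (simp add: o_def fun_eq_iff id_def)
  have G: "(?G has_derivative (\<lambda>h. R (blinfun_apply (\<phi>' x) h))) (at x)"
    by (rule bounded_linear.has_derivative[OF bR der\<phi>])
  have contT: "continuous_on N ?T"
  proof (rule continuous_on_compose2[of "\<tau> ` V" \<psi>])
    show "continuous_on (\<tau> ` V) \<psi>" using \<psi> unfolding homeomorphism_def by blast
    show "continuous_on N \<phi>" using cont N(3) continuous_on_subset by blast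
  qed (use N\<tau> in blast)
  then have T: "isCont ?T x" using N by (simp add: continuous_on_eq_continuous_at)
  have eq: "eventually (\<lambda>y. ?F (?T y) = ?G y) (nhds x)"
    using eventually_nhds_in_open[OF N(1,2)] by eventually_elim (use N\<tau> \<psi>' in simp)
  have dT: "(?T has_derivative (\<lambda>h. R (blinfun_apply (\<phi>' x) h))) (at x)"
    by (rule has_derivative_left_inverse_comp[OF F G T eq])
  \<comment> \<open>\<open>R\<close> is only a left inverse. That \<open>?L\<close> after
    \<open>R\<close> fixes the range of the derivative of \<phi> follows by differentiating
    \<open>\<tau> \<circ> T = \<phi>\<close> and comparing derivatives.\<close>
  have "((\<lambda>y. \<tau> (?T y)) has_derivative (\<lambda>h. ?L (R (blinfun_apply (\<phi>' x) h)))) (at x)"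
    by (rule has_derivative_compose[OF dT L(1)])
  then have "(\<phi> has_derivative (\<lambda>h. ?L (R (blinfun_apply (\<phi>' x) h)))) (at x)"
    by (rule has_derivative_transform_within_open[OF _ N(1,2)]) (use N\<tau> \<psi>' in simp)
  then have "(\<lambda>h. ?L (R (blinfun_apply (\<phi>' x) h))) = blinfun_apply (\<phi>' x)"
    using der\<phi> by (rule has_derivative_unique)
  then show ?thesis using dT by (intro exI[of _ "\<lambda>h. R (blinfun_apply (\<phi>' x) h)"]) (auto simp: fun_eq_iff)
qed

text \<open>Chart independence of area: the transition map is a differentiable injection between the
  two parameter sets, its Jacobian converts one area element into the other by
  \<open>area_element_compose\<close>, and the change of variables concludes.\<close>

lemma parametrization_area_overlap:
  assumes P: "local_parametrization M U \<phi> \<phi>'" and Q: "local_parametrization M V \<tau> \<tau>'"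
    and B: "B \<in> sets borel" "B \<subseteq> \<phi> ` U \<inter> \<tau> ` V"
  shows "(\<integral>\<^sup>+x\<in>U \<inter> \<phi> -` B. ennreal (area_element (\<phi>' x)) \<partial>lborel) =
         (\<integral>\<^sup>+x\<in>V \<inter> \<tau> -` B. ennreal (area_element (\<tau>' x)) \<partial>lborel)"
proof -
  obtain \<psi> where \<psi>: "homeomorphism V (\<tau> ` V) \<tau> \<psi>" using Q unfolding local_parametrization_def by blast
  have U: "open U" and V: "open V" using P Q unfolding local_parametrization_def by auto
  let ?T = "\<lambda>y. \<psi> (\<phi> y)"
  let ?S = "U \<inter> \<phi> -` B"
  have S: "?S \<in> sets borel"
    using U B by (intro vimage_Int_borel local_parametrization_continuous[OF P]) auto
  have S2: "V \<inter> \<tau> -` B \<in> sets borel"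
    using V B by (intro vimage_Int_borel local_parametrization_continuous[OF Q]) auto
  have \<psi>1: "\<tau> (\<psi> p) = p" "\<psi> p \<in> V" if "p \<in> \<tau> ` V" for p
    using \<psi> that unfolding homeomorphism_def by auto
  have \<psi>2: "\<psi> (\<tau> p) = p" if "p \<in> V" for p
    using \<psi> that unfolding homeomorphism_def by auto
  obtain T' where T': "\<And>x. x \<in> ?S \<Longrightarrow> (?T has_derivative T' x) (at x)"
      "\<And>x h. x \<in> ?S \<Longrightarrow> blinfun_apply (\<phi>' x) h = blinfun_apply (\<tau>' (?T x)) (T' x h)"
  proof -
    have "\<exists>T'. (?T has_derivative T') (at x) \<and>
        (\<forall>h. blinfun_apply (\<phi>' x) h = blinfun_apply (\<tau>' (?T x)) (T' h))" if "x \<in> ?S" for x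
      using parametrization_transition[OF P Q \<psi>, of x] that B by blast
    then show ?thesis using that by metis
  qed
  have TS: "?T ` ?S = V \<inter> \<tau> -` B"
  proof (intro equalityI subsetI)
    fix y assume "y \<in> V \<inter> \<tau> -` B"
    then have y: "y \<in> V" "\<tau> y \<in> B" by auto
    then obtain x where x: "x \<in> U" "\<phi> x = \<tau> y" using B by force
    then have "?T x = y" using \<psi>2 y by simp
    then show "y \<in> ?T ` ?S" using x y by force
  next
    fix y assume "y \<in> ?T ` ?S"
    then obtain x where x: "\<phi> x \<in> B" "y = \<psi> (\<phi> x)" by blast
    then have "\<phi> x \<in> \<tau> ` V" using B by blast
    then show "y \<in> V \<inter> \<tau> -` B" using \<psi>1[of "\<phi> x"] x by simp
  qed
  have inj: "inj_on ?T ?S"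
  proof (rule inj_onI)
    fix x y assume xy: "x \<in> ?S" "y \<in> ?S" "?T x = ?T y"
    then have "\<phi> x = \<phi> y" using \<psi>1(1) B(2) by (metis (no_types, lifting) IntE in_mono vimageD)
    then show "x = y" using local_parametrization_inj[OF P] xy by (auto dest: inj_onD)
  qed
  let ?f = "\<lambda>y. max 0 (area_element (\<tau>' y))"
  have e: "\<bar>det (matrix (T' x))\<bar> * ?f (?T x) = max 0 (area_element (\<phi>' x))" if "x \<in> ?S" for x
  proof -
    have "linear (T' x)" using T'(1)[OF that] by (simp add: has_derivative_linear)
    then have "area_element (\<phi>' x) = \<bar>det (matrix (T' x))\<bar> * area_element (\<tau>' (?T x))"
      using T'(2)[OF that] by (rule area_element_compose)
    then show ?thesis by (simp add: max_mult_distrib_left)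
  qed
  have ae: "ennreal (max 0 r) = ennreal r" for r :: real
    by (cases "r \<le> 0") (auto simp: ennreal_neg max_def)
  have "(\<integral>\<^sup>+x\<in>V \<inter> \<tau> -` B. ennreal (area_element (\<tau>' x)) \<partial>lborel) = (\<integral>\<^sup>+x\<in>?T ` ?S. ennreal (?f x) \<partial>lborel)"
    by (simp only: TS ae)
  also have "\<dots> = (\<integral>\<^sup>+x\<in>?S. ennreal (\<bar>det (matrix (T' x))\<bar> * ?f (?T x)) \<partial>lborel)"
  proof (rule nn_integral_change_of_variables[OF S _ inj])
    show "(?T has_derivative T' x) (at x within ?S)" if "x \<in> ?S" for x
      using T'(1)[OF that] by (rule has_derivative_at_withinI)
    show "(\<lambda>x. indicator (?T ` ?S) x * ?f x) \<in> borel_measurable borel"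
      using area_element_measurable(1)[OF Q S2] by (simp add: TS)
    have "(\<lambda>x. indicator ?S x * max 0 (area_element (\<phi>' x))) \<in> borel_measurable borel"
      by (rule area_element_measurable(1)[OF P S]) auto
    also have "(\<lambda>x. indicator ?S x * max 0 (area_element (\<phi>' x))) =
        (\<lambda>x. indicator ?S x * (\<bar>det (matrix (T' x))\<bar> * ?f (?T x)))"
      using e by (auto simp: fun_eq_iff split: split_indicator)
    finally show "(\<lambda>x. indicator ?S x * (\<bar>det (matrix (T' x))\<bar> * ?f (?T x))) \<in> borel_measurable borel" .
  qed simp
  also have "\<dots> = (\<integral>\<^sup>+x\<in>?S. ennreal (area_element (\<phi>' x)) \<partial>lborel)"
  proof (intro nn_integral_cong)
    fix x
    show "ennreal (\<bar>det (matrix (T' x))\<bar> * ?f (?T x)) * indicator ?S x =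
        ennreal (area_element (\<phi>' x)) * indicator ?S x"
      by (cases "x \<in> ?S") (simp_all only: e ae indicator_simps mult_zero_right not_False_eq_True)
  qed
  finally show ?thesis by simp
qed

text \<open>One chart that misses only countably many null pieces determines the surface measure.
  Existence: the push-forward of its area has the prescribed value on every other chart by
  \<open>parametrization_area_overlap\<close>. Uniqueness: the value is prescribed on the image of
  the chart and is zero on the rest.\<close>

lemma surface_measure_eq_distr:
  assumes P: "local_parametrization M U \<phi> \<phi>'" and M: "M \<in> sets borel"
    and \<phi>: "\<phi> \<in> borel_measurable borel"
    and cover: "countable \<C>" "M - \<phi> ` U \<subseteq> \<Union>\<C>"
    and null: "\<And>C. C \<in> \<C> \<Longrightarrow> C \<in> sets borel \<and> C \<subseteq> M \<and>
        (\<exists>V \<tau> \<tau>'. local_parametrization M V \<tau> \<tau>' \<and> C \<subseteq> \<tau> ` V \<and> V \<inter> \<tau> -` C \<in> null_sets lborel)"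
  shows "surface_measure M =
     distr (density lborel (\<lambda>x. ennreal (area_element (\<phi>' x)) * indicator U x)) borel \<phi>"
    (is "_ = ?\<mu>")
proof -
  have U: "open U" and \<phi>M: "\<phi> ` U \<subseteq> M"
    using P unfolding local_parametrization_def by (auto dest: openin_imp_subset)
  have am: "(\<lambda>x. ennreal (area_element (\<phi>' x)) * indicator U x) \<in> borel_measurable borel"
    using U by (intro area_element_measurable(2)[OF P]) auto
  have em: "emeasure ?\<mu> B = (\<integral>\<^sup>+x\<in>U \<inter> \<phi> -` B. ennreal (area_element (\<phi>' x)) \<partial>lborel)" if "B \<in> sets borel" for B
  proof -
    have b: "\<phi> -` B \<in> sets borel" using measurable_sets[OF \<phi> that] by simp
    have "emeasure ?\<mu> B = emeasure (density lborel (\<lambda>x. ennreal (area_element (\<phi>' x)) * indicator U x)) (\<phi> -` B)"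
      using that \<phi> by (subst emeasure_distr) auto
    also have "\<dots> = (\<integral>\<^sup>+x\<in>\<phi> -` B. ennreal (area_element (\<phi>' x)) * indicator U x \<partial>lborel)"
      using b am by (intro emeasure_density) auto
    also have "\<dots> = (\<integral>\<^sup>+x\<in>U \<inter> \<phi> -` B. ennreal (area_element (\<phi>' x)) \<partial>lborel)"
      by (intro nn_integral_cong) (auto split: split_indicator)
    finally show ?thesis .
  qed
  have \<phi>U: "\<phi> ` U \<in> sets borel"
    using U by (intro local_parametrization_image_borel[OF P M]) auto
  have null0: "(\<integral>\<^sup>+x\<in>A. f x \<partial>lborel) = 0" if "A \<in> null_sets lborel" for A and f :: "real^3 \<Rightarrow> ennreal"
  proof -
    have "AE x in lborel. f x * indicator A x = 0"
      using AE_not_in[OF that] by eventually_elim auto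
    then have "(\<integral>\<^sup>+x\<in>A. f x \<partial>lborel) = (\<integral>\<^sup>+(x::real^3). 0 \<partial>lborel)" by (rule nn_integral_cong_AE)
    then show ?thesis by simp
  qed
  have ex: "is_surface_measure M ?\<mu>"
    unfolding is_surface_measure_def
  proof (intro conjI allI impI)
    show "sets ?\<mu> = sets borel" by simp
    have "U \<inter> \<phi> -` (- M) = {}" using \<phi>M by auto
    then show "emeasure ?\<mu> (- M) = 0" using M by (subst em) auto
  next
    fix V \<tau> \<tau>' A
    assume Q: "local_parametrization M V \<tau> \<tau>'" and A: "A \<in> sets borel" "A \<subseteq> V"
    have V: "open V" and \<tau>M: "\<tau> ` V \<subseteq> M"
      using Q unfolding local_parametrization_def by (auto dest: openin_imp_subset)
    have \<tau>A: "\<tau> ` A \<in> sets borel" by (rule local_parametrization_image_borel[OF Q M A])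
    let ?a = "\<lambda>x. ennreal (area_element (\<tau>' x))"
    let ?B = "\<tau> ` A \<inter> \<phi> ` U"
    \<comment> \<open>\<open>C\<close> is known to be null in some other chart. Chart independence
      transports areas rather than Lebesgue null sets, so the conclusion is confined to points where
      the area element of \<tau> does not vanish; for the integral this suffices.\<close>
    have nul: "AE x in lborel. x \<in> A \<longrightarrow> ?a x \<noteq> 0 \<longrightarrow> \<tau> x \<notin> C" if C: "C \<in> \<C>" for C
    proof -
      obtain W \<eta> \<eta>' where R: "local_parametrization M W \<eta> \<eta>'" "C \<subseteq> \<eta> ` W" "W \<inter> \<eta> -` C \<in> null_sets lborel"
        and Cb: "C \<in> sets borel" using null[OF C] by blast
      let ?D = "\<tau> ` A \<inter> C"
      have D: "?D \<in> sets borel" using \<tau>A Cb by simp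
      have "(\<integral>\<^sup>+x\<in>V \<inter> \<tau> -` ?D. ?a x \<partial>lborel) = (\<integral>\<^sup>+x\<in>W \<inter> \<eta> -` ?D. ennreal (area_element (\<eta>' x)) \<partial>lborel)"
        by (rule parametrization_area_overlap[OF Q R(1) D]) (use A R in auto)
      also have "W \<inter> \<eta> -` ?D \<in> sets borel"
        using D R(1) by (intro vimage_Int_borel local_parametrization_continuous[OF R(1)]) (auto simp: local_parametrization_def)
      then have "(\<integral>\<^sup>+x\<in>W \<inter> \<eta> -` ?D. ennreal (area_element (\<eta>' x)) \<partial>lborel) = 0"
        by (intro null0 null_sets_subset[OF R(3)]) auto
      finally have z: "(\<integral>\<^sup>+x\<in>V \<inter> \<tau> -` ?D. ?a x \<partial>lborel) = 0" .
      have "V \<inter> \<tau> -` ?D \<in> sets borel"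
        using D V by (intro vimage_Int_borel local_parametrization_continuous[OF Q]) auto
      then have mm: "(\<lambda>x. ?a x * indicator (V \<inter> \<tau> -` ?D) x) \<in> borel_measurable lborel"
        using area_element_measurable(2)[OF Q] by simp
      have "AE x in lborel. ?a x * indicator (V \<inter> \<tau> -` ?D) x = 0"
        using z nn_integral_0_iff_AE[OF mm] by simp
      then show ?thesis by eventually_elim (use A in \<open>auto split: split_indicator_asm\<close>)
    qed
    then have "AE x in lborel. \<forall>C\<in>\<C>. x \<in> A \<longrightarrow> ?a x \<noteq> 0 \<longrightarrow> \<tau> x \<notin> C"
      using cover(1) by (subst AE_ball_countable) auto
    then have ae: "AE x in lborel. ?a x * indicator (V \<inter> \<tau> -` ?B) x = ?a x * indicator A x"
    proof eventually_elim
      case (elim x)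
      have "x \<in> V \<and> \<tau> x \<in> \<tau> ` A \<longleftrightarrow> x \<in> A"
        using local_parametrization_inj[OF Q] A(2) by (auto dest: inj_onD)
      moreover have "x \<in> A \<longrightarrow> \<tau> x \<in> \<phi> ` U \<or> ?a x = 0" using elim cover(2) \<tau>M A(2) by blast
      ultimately show ?case by (auto split: split_indicator)
    qed
    have "emeasure ?\<mu> (\<tau> ` A) = (\<integral>\<^sup>+x\<in>U \<inter> \<phi> -` (\<tau> ` A). ennreal (area_element (\<phi>' x)) \<partial>lborel)"
      by (rule em[OF \<tau>A])
    also have "U \<inter> \<phi> -` (\<tau> ` A) = U \<inter> \<phi> -` ?B" by auto
    also have "(\<integral>\<^sup>+x\<in>U \<inter> \<phi> -` ?B. ennreal (area_element (\<phi>' x)) \<partial>lborel) = (\<integral>\<^sup>+x\<in>V \<inter> \<tau> -` ?B. ?a x \<partial>lborel)"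
      by (rule parametrization_area_overlap[OF P Q]) (use A \<tau>A \<phi>U in auto)
    also have "\<dots> = (\<integral>\<^sup>+x\<in>A. ?a x \<partial>lborel)" by (rule nn_integral_cong_AE[OF ae])
    finally show "emeasure ?\<mu> (\<tau> ` A) = (\<integral>\<^sup>+x\<in>A. ?a x \<partial>lborel)" .
  qed
  \<comment> \<open>Any surface measure annihilates \<open>- M\<close> and every \<open>C\<close>,
    so it is concentrated on the image of \<open>U\<close>, where the chart \<phi> prescribes
    it.\<close>
  have un: "\<nu> = ?\<mu>" if \<nu>: "is_surface_measure M \<nu>" for \<nu>
  proof (rule measure_eqI)
    have s: "sets \<nu> = sets borel" using \<nu> by (simp add: is_surface_measure_def)
    show "sets \<nu> = sets ?\<mu>" by (simp add: s)
    fix B assume "B \<in> sets \<nu>"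
    then have B: "B \<in> sets borel" by (simp add: s)
    have "C \<in> null_sets \<nu>" if C: "C \<in> \<C>" for C
    proof -
      obtain W \<eta> \<eta>' where R: "local_parametrization M W \<eta> \<eta>'" "C \<subseteq> \<eta> ` W" "W \<inter> \<eta> -` C \<in> null_sets lborel"
        and Cb: "C \<in> sets borel" using null[OF C] by blast
      have "C = \<eta> ` (W \<inter> \<eta> -` C)" using R(2) by auto
      moreover have "W \<inter> \<eta> -` C \<in> sets borel" using null_setsD2[OF R(3)] by simp
      then have "emeasure \<nu> (\<eta> ` (W \<inter> \<eta> -` C)) = (\<integral>\<^sup>+x\<in>W \<inter> \<eta> -` C. ennreal (area_element (\<eta>' x)) \<partial>lborel)"
        using \<nu> R(1) unfolding is_surface_measure_def by blast
      ultimately have "emeasure \<nu> C = (\<integral>\<^sup>+x\<in>W \<inter> \<eta> -` C. ennreal (area_element (\<eta>' x)) \<partial>lborel)"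
        by simp
      then show ?thesis using null0[OF R(3)] Cb s by (auto simp: null_sets_def)
    qed
    then have "(\<Union>C\<in>\<C>. C) \<in> null_sets \<nu>" using cover(1) by (intro null_sets_UN')
    then have "(\<Union>\<C>) \<in> null_sets \<nu>" by simp
    moreover have "- M \<in> null_sets \<nu>" using \<nu> M s by (auto simp: null_sets_def is_surface_measure_def)
    ultimately have N: "- M \<union> \<Union>\<C> \<in> null_sets \<nu>" by blast
    let ?B = "B \<inter> \<phi> ` U"
    have "AE x in \<nu>. x \<in> B \<longleftrightarrow> x \<in> ?B"
      using AE_not_in[OF N] by eventually_elim (use cover(2) in auto)
    then have "emeasure \<nu> B = emeasure \<nu> ?B"
      using B \<phi>U s by (intro emeasure_eq_AE) auto
    also have "?B = \<phi> ` (U \<inter> \<phi> -` B)" by auto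
    also have "emeasure \<nu> \<dots> = (\<integral>\<^sup>+x\<in>U \<inter> \<phi> -` B. ennreal (area_element (\<phi>' x)) \<partial>lborel)"
    proof -
      have "U \<inter> \<phi> -` B \<in> sets borel"
        using U B by (intro vimage_Int_borel local_parametrization_continuous[OF P]) auto
      then show ?thesis using \<nu> P unfolding is_surface_measure_def by blast
    qed
    also have "\<dots> = emeasure ?\<mu> B" using em[OF B] by simp
    finally show "emeasure \<nu> B = emeasure ?\<mu> B" .
  qed
  show ?thesis unfolding surface_measure_def
    using ex un by (rule the_equality)
qed

section \<open>Charts of the boundary\<close>

definition closed_egg :: "nat \<Rightarrow> C2 set" where
  "closed_egg m = {p. (cmod (fst p))\<^sup>2 + cmod (snd p) ^ (2 * m) \<le> 1}"

lemma egg_subset_closed_egg: "egg m \<subseteq> closed_egg m"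
  by (auto simp: egg_def closed_egg_def)

lemma closed_closed_egg: "closed (closed_egg m)"
  unfolding closed_egg_def by (intro closed_Collect_le continuous_intros)

lemma closed_egg_bounds:
  assumes "m \<ge> 1" "p \<in> closed_egg m"
  shows "cmod (fst p) \<le> 1" "cmod (snd p) \<le> 1"
proof -
  have "(cmod (fst p))\<^sup>2 \<le> 1" "cmod (snd p) ^ (2 * m) \<le> 1"
    using assms(2) zero_le_power[OF norm_ge_zero, of "snd p" "2 * m"] zero_le_power2[of "cmod (fst p)"]
    unfolding closed_egg_def mem_Collect_eq by linarith+
  then show "cmod (fst p) \<le> 1" "cmod (snd p) \<le> 1"
    using assms(1) power_le_one_iff[of "cmod (fst p)" 2] power_le_one_iff[of "cmod (snd p)" "2 * m"] by auto
qed

lemma compact_closed_egg: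
  assumes "m \<ge> 1"
  shows "compact (closed_egg m)"
proof -
  have "closed_egg m \<subseteq> cball 0 1 \<times> cball 0 1"
    using closed_egg_bounds[OF assms] by (auto simp: mem_Times_iff)
  then have "bounded (closed_egg m)" using bounded_Times bounded_cball bounded_subset by blast
  then show ?thesis using closed_closed_egg compact_eq_bounded_closed by blast
qed

lemma dilate_mem_egg:
  assumes m: "m \<ge> 1" and r: "0 \<le> r" "r < 1" and p: "p \<in> closed_egg m"
  shows "r *\<^sub>R p \<in> egg m"
proof -
  have "(cmod (fst (r *\<^sub>R p)))\<^sup>2 + cmod (snd (r *\<^sub>R p)) ^ (2 * m) = r^2 * (cmod (fst p))\<^sup>2 + r^(2*m) * cmod (snd p) ^ (2 * m)"
    using r by (simp add: power_mult_distrib)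
  also have "\<dots> \<le> r^2 * (cmod (fst p))\<^sup>2 + r^2 * cmod (snd p) ^ (2 * m)"
    using r m by (intro add_mono mult_right_mono power_decreasing) auto
  also have "\<dots> = r^2 * ((cmod (fst p))\<^sup>2 + cmod (snd p) ^ (2 * m))" by (simp add: algebra_simps)
  also have "\<dots> \<le> r^2 * 1" using p by (intro mult_left_mono) (auto simp: closed_egg_def)
  also have "\<dots> < 1" using r by (simp add: power_less_one_iff abs_square_less_1)
  finally show ?thesis by (simp add: egg_def split_beta)
qed

lemma open_egg: "open (egg m)"
proof -
  have "egg m = {p. (cmod (fst p))\<^sup>2 + cmod (snd p) ^ (2 * m) < 1}" by (auto simp: egg_def)
  then show ?thesis by (simp add: open_Collect_less continuous_intros)
qed

text \<open>Dilations with factors increasing to 1 move the closed egg into the open one, which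
  identifies the closure.\<close>

lemma frontier_egg:
  assumes m: "m \<ge> 1"
  shows "frontier (egg m) = {(z, w). (cmod z)\<^sup>2 + cmod w ^ (2 * m) = 1}"
proof -
  have c: "closure (egg m) = closed_egg m"
  proof
    show "closure (egg m) \<subseteq> closed_egg m"
      by (intro closure_minimal egg_subset_closed_egg closed_closed_egg)
    show "closed_egg m \<subseteq> closure (egg m)"
    proof
      fix p assume p: "p \<in> closed_egg m"
      define f where "f n = (1 - 1 / real (n + 2)) *\<^sub>R p" for n
      have "f \<longlonglongrightarrow> 1 *\<^sub>R p" unfolding f_def
        by (rule tendsto_eq_intros LIMSEQ_ignore_initial_segment[OF lim_1_over_n] refl | simp)+
      moreover have "f n \<in> egg m" for n
        unfolding f_def by (rule dilate_mem_egg[OF m _ _ p]) simp_all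
      ultimately show "p \<in> closure (egg m)" unfolding closure_sequential by auto
    qed
  qed
  show ?thesis unfolding frontier_def c interior_open[OF open_egg] by (auto simp: egg_def closed_egg_def)
qed

lemma frontier_subset_closed_egg: "m \<ge> 1 \<Longrightarrow> frontier (egg m) \<subseteq> closed_egg m"
  by (auto simp: frontier_egg closed_egg_def)

text \<open>A graph over the parameter space in the direction \<open>b\<close>. The linear
  projection \<open>q\<close> kills \<open>b\<close>, so it inverts the chart and, applied to the
  derivative, yields its injectivity; only the height \<gamma> has to be differentiated.\<close>

lemma local_parametrization_graph:
  fixes a :: "real^3 \<Rightarrow> C2"
  assumes U: "open U" and a: "bounded_linear a" and q: "bounded_linear q"
    and qa: "\<And>x. q (a x) = x" and qb: "q b = 0"
    and \<gamma>: "\<And>x. x \<in> U \<Longrightarrow> (\<gamma> has_derivative \<gamma>' x) (at x)"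
    and c: "\<And>h. continuous_on U (\<lambda>x. \<gamma>' x h)"
    and im: "(\<lambda>x. a x + \<gamma> x *\<^sub>R b) ` U = M \<inter> W" and W: "open W"
  shows "\<exists>\<phi>'. local_parametrization M U (\<lambda>x. a x + \<gamma> x *\<^sub>R b) \<phi>'"
proof -
  let ?\<phi> = "\<lambda>x. a x + \<gamma> x *\<^sub>R b"
  define \<phi>' where "\<phi>' x = Blinfun (\<lambda>h. a h + \<gamma>' x h *\<^sub>R b)" for x
  have bl: "bounded_linear (\<lambda>h. a h + \<gamma>' x h *\<^sub>R b)" if "x \<in> U" for x
    using has_derivative_bounded_linear[OF \<gamma>[OF that]] a
    by (intro bounded_linear_add bounded_linear_scaleR_const)
  have ap: "blinfun_apply (\<phi>' x) = (\<lambda>h. a h + \<gamma>' x h *\<^sub>R b)" if "x \<in> U" for x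
    using bl[OF that] by (simp add: \<phi>'_def bounded_linear_Blinfun_apply)
  have q': "q (?\<phi> x) = x" for x
    using q by (simp add: qa qb linear_simps)
  have der: "(?\<phi> has_derivative blinfun_apply (\<phi>' x)) (at x)" if "x \<in> U" for x
    unfolding ap[OF that]
    by (auto intro!: derivative_eq_intros bounded_linear.has_derivative[OF a] \<gamma>[OF that])
  have "local_parametrization M U ?\<phi> \<phi>'"
    unfolding local_parametrization_def
  proof (intro conjI ballI)
    show "open U" by fact
    show "openin (top_of_set M) (?\<phi> ` U)" using im W by (auto simp: openin_open)
    have "continuous_on U ?\<phi>"
      using der by (intro has_derivative_continuous_on) (rule has_derivative_at_withinI)
    then have "homeomorphism U (?\<phi> ` U) ?\<phi> q"
      using q by (intro homeomorphismI) (auto simp: q' linear_continuous_on)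
    then show "\<exists>\<psi>. homeomorphism U (?\<phi> ` U) ?\<phi> \<psi>" by blast
    show "(?\<phi> has_derivative blinfun_apply (\<phi>' x)) (at x)" if "x \<in> U" for x by (rule der[OF that])
    show "continuous_on U \<phi>'"
    proof (rule continuous_on_blinfun_componentwise)
      fix i
      have "continuous_on U (\<lambda>x. a i + \<gamma>' x i *\<^sub>R b)" by (intro continuous_intros c)
      then show "continuous_on U (\<lambda>x. blinfun_apply (\<phi>' x) i)"
        by (rule continuous_on_eq) (simp add: ap)
    qed
    show "inj (blinfun_apply (\<phi>' x))" if "x \<in> U" for x
    proof (rule injI)
      fix h k assume "blinfun_apply (\<phi>' x) h = blinfun_apply (\<phi>' x) k"
      then have "q (a h + \<gamma>' x h *\<^sub>R b) = q (a k + \<gamma>' x k *\<^sub>R b)" by (simp add: ap[OF that])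
      then show "h = k" using q by (simp add: qa qb linear_simps)
    qed
  qed
  then show ?thesis by blast
qed

section \<open>Graph charts that solve for one real coordinate\<close>

lemma cmod_power_even: "cmod w ^ (2 * m) = ((Re w)\<^sup>2 + (Im w)\<^sup>2) ^ m"
  by (simp add: power_mult cmod_power2)

lemma bounded_linear_Complex:
  assumes "bounded_linear f" "bounded_linear g"
  shows "bounded_linear (\<lambda>x. Complex (f x) (g x))"
  using assms by (auto simp: Complex_eq intro!: bounded_linear_add bounded_linear_mult_const bounded_linear_const_mult
      bounded_linear_compose[OF bounded_linear_of_real])

lemma bounded_linear_vec3:
  assumes "bounded_linear f" "bounded_linear g" "bounded_linear h"
  shows "bounded_linear (\<lambda>x. vector [f x, g x, h x] :: real^3)"
proof -
  have "(\<lambda>x. vector [f x, g x, h x] :: real^3) = (\<lambda>x. f x *\<^sub>R axis 1 1 + g x *\<^sub>R axis 2 1 + h x *\<^sub>R axis 3 1)"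
    by (auto simp: vec_eq_iff forall_3 axis_def)
  then show ?thesis using assms by (auto intro!: bounded_linear_add bounded_linear_scaleR_const)
qed

lemma continuous_on_vec3:
  assumes "continuous_on S f" "continuous_on S g" "continuous_on S h"
  shows "continuous_on S (\<lambda>x. vector [f x, g x, h x] :: real^3)"
proof -
  have "(\<lambda>x. vector [f x, g x, h x] :: real^3) = (\<lambda>x. f x *\<^sub>R axis 1 1 + g x *\<^sub>R axis 2 1 + h x *\<^sub>R axis 3 1)"
    by (auto simp: vec_eq_iff forall_3 axis_def)
  then show ?thesis by (simp only:) (intro continuous_intros assms)
qed

text \<open>If \<open>c\<close> is the rotated coordinate and \<open>v\<close> the other one,
  \<open>|c|^(2k) + |v|^(2m) = 1\<close> means \<open>|c|^2 = (1 - |v|^(2m))^(1/k)\<close>; with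
  \<open>Im c = x$1\<close> prescribed, the positive root is \<open>Re c\<close>.\<close>

definition graph_chart :: "nat \<Rightarrow> nat \<Rightarrow> (C2 \<Rightarrow> C2) \<Rightarrow> complex \<Rightarrow> real^3 \<Rightarrow> C2" where
  "graph_chart k m P \<omega> x = P (\<omega> * Complex (sqrt ((1 - ((x$2)\<^sup>2 + (x$3)\<^sup>2) ^ m) powr (1 / real k) - (x$1)\<^sup>2)) (x$1),
     Complex (x$2) (x$3))"

text \<open>With \<open>P\<close> the identity or the exchange of coordinates, both coordinates of the egg are treated at once;
  the chart solves for the real part of the first coordinate after a rotation by \<open>\<omega>\<close>.\<close>

lemma graph_chart_parametrization:
  fixes k m :: nat
  assumes k: "k \<ge> 1" and \<omega>: "cmod \<omega> = 1" and P: "bounded_linear P" "\<And>p. P (P p) = p"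
  defines "U \<equiv> {x :: real^3. (x$1)\<^sup>2 ^ k + ((x$2)\<^sup>2 + (x$3)\<^sup>2) ^ m < 1}"
    and "M \<equiv> {p. cmod (fst (P p)) ^ (2 * k) + cmod (snd (P p)) ^ (2 * m) = 1}"
  shows "graph_chart k m P \<omega> ` U = M \<inter> {p. Re (cnj \<omega> * fst (P p)) > 0}"
    and "\<exists>\<phi>'. local_parametrization M U (graph_chart k m P \<omega>) \<phi>'"
proof -
  let ?v = "\<lambda>x::real^3. ((x$2)\<^sup>2 + (x$3)\<^sup>2)"
  let ?s = "\<lambda>x::real^3. 1 - ?v x ^ m"
  let ?\<gamma> = "\<lambda>x::real^3. sqrt (?s x powr (1 / real k) - (x$1)\<^sup>2)"
  let ?W = "{p :: C2. Re (cnj \<omega> * fst (P p)) > 0}"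
  have \<omega>2: "cnj \<omega> * \<omega> = 1" "\<omega> * cnj \<omega> = 1" using \<omega> by (simp_all add: complex_norm_square[symmetric] mult.commute)
  have can: "cnj \<omega> * (\<omega> * c) = c" "\<omega> * (cnj \<omega> * c) = c" for c
    using \<omega>2 by (metis mult.assoc mult_1)+
  have un: "cmod (\<omega> * c) ^ (2 * k) = ((Re c)\<^sup>2 + (Im c)\<^sup>2) ^ k" for c
    using \<omega> by (simp only: norm_mult mult_1 cmod_power_even)
  have pw: "(r powr (1 / real k)) ^ k = r" if "r > 0" for r
    using k that by (simp add: powr_realpow[symmetric] powr_powr)
  have s0: "?s x > 0" if "x \<in> U" for x
    using that zero_le_power[OF zero_le_power2[of "x$1"], of k] unfolding U_def mem_Collect_eq by linarith
  have g0: "?s x powr (1 / real k) - (x$1)\<^sup>2 > 0" if "x \<in> U" for x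
  proof -
    have "(x$1)\<^sup>2 ^ k < (?s x powr (1 / real k)) ^ k" unfolding pw[OF s0[OF that]] using that by (simp add: U_def)
    then show ?thesis by (simp add: power_less_imp_less_base)
  qed
  show im: "graph_chart k m P \<omega> ` U = M \<inter> ?W"
  proof (intro equalityI subsetI)
    fix p assume "p \<in> graph_chart k m P \<omega> ` U"
    then obtain x where x: "x \<in> U" "p = graph_chart k m P \<omega> x" by blast
    show "p \<in> M \<inter> ?W"
      using g0[OF x(1)] by (simp add: x(2) graph_chart_def M_def P(2) can un cmod_power_even[of "Complex _ _"]
          pw[OF s0[OF x(1)]] del: times_complex.simps)
  next
    fix p assume p: "p \<in> M \<inter> ?W"
    obtain z w where zw: "P p = (z, w)" by (cases "P p")
    define c where "c = cnj \<omega> * z"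
    have z: "z = \<omega> * c" by (simp add: c_def can)
    have M: "((Re c)\<^sup>2 + (Im c)\<^sup>2) ^ k + ((Re w)\<^sup>2 + (Im w)\<^sup>2) ^ m = 1"
      using p unfolding M_def by (simp add: zw z un cmod_power_even[of w] del: times_complex.simps)
    have R: "Re c > 0" using p by (simp add: zw c_def)
    define x where "x = (vector [Im c, Re w, Im w] :: real^3)"
    have x: "x$1 = Im c" "x$2 = Re w" "x$3 = Im w" by (simp_all add: x_def)
    have s: "?s x = ((Re c)\<^sup>2 + (Im c)\<^sup>2) ^ k" using M by (simp add: x)
    have "(Re c)\<^sup>2 + (Im c)\<^sup>2 > 0" using R by (simp add: add_pos_nonneg)
    then have "?s x powr (1 / real k) = (Re c)\<^sup>2 + (Im c)\<^sup>2"
      unfolding s using k by (simp add: powr_realpow[symmetric] powr_powr)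
    then have "graph_chart k m P \<omega> x = P (z, w)" using R by (simp add: graph_chart_def x z)
    then have "p = graph_chart k m P \<omega> x" using P(2)[of p] zw by simp
    moreover have "x \<in> U"
    proof -
      have "(Im c)\<^sup>2 ^ k < ((Re c)\<^sup>2 + (Im c)\<^sup>2) ^ k" using R k by (intro power_strict_mono) auto
      then show ?thesis using M unfolding U_def mem_Collect_eq x by linarith
    qed
    ultimately show "p \<in> graph_chart k m P \<omega> ` U" by blast
  qed
  let ?a = "\<lambda>x::real^3. P (\<omega> * Complex 0 (x$1), Complex (x$2) (x$3))"
  let ?q = "\<lambda>p::C2. vector [Im (cnj \<omega> * fst (P p)), Re (snd (P p)), Im (snd (P p))] :: real^3"
  have g_eq: "graph_chart k m P \<omega> = (\<lambda>x. ?a x + ?\<gamma> x *\<^sub>R P (\<omega>, 0))"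
  proof
    fix x
    have "?a x + ?\<gamma> x *\<^sub>R P (\<omega>, 0) = P ((\<omega> * Complex 0 (x$1), Complex (x$2) (x$3)) + ?\<gamma> x *\<^sub>R (\<omega>, 0))"
      using P(1) by (simp only: linear_simps)
    also have "(\<omega> * Complex 0 (x$1), Complex (x$2) (x$3)) + ?\<gamma> x *\<^sub>R (\<omega>, 0) = (\<omega> * Complex (?\<gamma> x) (x$1), Complex (x$2) (x$3))"
      by (auto simp: complex_eq_iff algebra_simps)
    finally show "graph_chart k m P \<omega> x = ?a x + ?\<gamma> x *\<^sub>R P (\<omega>, 0)" by (simp only: graph_chart_def)
  qed
  show "\<exists>\<phi>'. local_parametrization M U (graph_chart k m P \<omega>) \<phi>'"
    unfolding g_eq
  proof (rule local_parametrization_graph)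
    show "open U" unfolding U_def by (intro open_Collect_less continuous_intros)
    show "bounded_linear ?a"
      by (intro bounded_linear_compose[OF P(1)] bounded_linear_Pair bounded_linear_const_mult bounded_linear_Complex
          bounded_linear_vec_nth bounded_linear_zero)
    show "bounded_linear ?q"
      by (intro bounded_linear_vec3 bounded_linear_compose[OF bounded_linear_Im] bounded_linear_compose[OF bounded_linear_Re]
          bounded_linear_const_mult bounded_linear_compose[OF bounded_linear_fst P(1)] bounded_linear_compose[OF bounded_linear_snd P(1)])
    show "?q (?a x) = x" for x by (simp add: P(2) can vec_eq_iff forall_3)
    show "?q (P (\<omega>, 0)) = 0" using \<omega>2 by (simp add: P(2) vec_eq_iff forall_3)
    show "open ?W"
      by (intro open_Collect_less continuous_intros bounded_linear.continuous_on[OF P(1)])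
    show "(\<lambda>x. ?a x + ?\<gamma> x *\<^sub>R P (\<omega>, 0)) ` U = M \<inter> ?W" using im unfolding g_eq .
    let ?D = "\<lambda>(x::real^3) (h::real^3). (1 / real k * ?s x powr (1 / real k - 1) *
        (- (real m * ?v x ^ (m - 1) * (2 * x$2 * h$2 + 2 * x$3 * h$3))) - 2 * x$1 * h$1) / (2 * ?\<gamma> x)"
    show "(?\<gamma> has_derivative ?D x) (at x)" if "x \<in> U" for x
    proof -
      note n = bounded_linear.has_derivative[OF bounded_linear_vec_nth]
      have d1: "(?s has_derivative (\<lambda>h. - (real m * ?v x ^ (m - 1) * (2 * x$2 * h$2 + 2 * x$3 * h$3)))) (at x)"
        by (auto intro!: derivative_eq_intros n)
      have "((\<lambda>r. r powr (1 / real k)) has_real_derivative (1 / real k) * ?s x powr (1 / real k - 1)) (at (?s x))"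
        using s0[OF that] by (rule has_real_derivative_powr)
      then have "((\<lambda>r. r powr (1 / real k)) has_derivative (\<lambda>h. (1 / real k) * ?s x powr (1 / real k - 1) * h)) (at (?s x))"
        unfolding has_field_derivative_def .
      from has_derivative_compose[OF d1 this]
      have "((\<lambda>x. ?s x powr (1 / real k) - (x$1)\<^sup>2) has_derivative
          (\<lambda>h. 1 / real k * ?s x powr (1 / real k - 1) * (- (real m * ?v x ^ (m - 1) * (2 * x$2 * h$2 + 2 * x$3 * h$3))) - 2 * x$1 * h$1)) (at x)"
        (is "(?G has_derivative ?G') _")
      proof (rule has_derivative_diff)
        show "((\<lambda>x::real^3. (x$1)\<^sup>2) has_derivative (\<lambda>h. 2 * x$1 * h$1)) (at x)"
          by (auto intro!: derivative_eq_intros n)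
      qed
      moreover have "(sqrt has_derivative (\<lambda>h. inverse (?\<gamma> x) / 2 * h)) (at (?G x))"
        using DERIV_real_sqrt[OF g0[OF that]] unfolding has_field_derivative_def .
      ultimately have "((\<lambda>x. sqrt (?G x)) has_derivative (\<lambda>h. inverse (?\<gamma> x) / 2 * ?G' h)) (at x)"
        by (rule has_derivative_compose)
      also have "(\<lambda>h. inverse (?\<gamma> x) / 2 * ?G' h) = ?D x"
        by (simp only: divide_inverse inverse_mult_distrib mult_ac)
      finally show ?thesis .
    qed
    show "continuous_on U (\<lambda>x. ?D x h)" for h
    proof -
      have c1: "continuous_on U (\<lambda>x. ?s x powr c)" for c
      proof (rule continuous_on_powr)
        show "continuous_on U ?s" by (intro continuous_intros)
        show "\<forall>x\<in>U. ?s x \<noteq> 0" using s0 by (metis less_irrefl)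
      qed simp
      have "continuous_on U ?\<gamma>"
        by (intro continuous_on_real_sqrt continuous_on_diff c1 continuous_on_power continuous_on_component continuous_on_id)
      then show ?thesis
      proof (intro continuous_on_divide continuous_on_mult continuous_on_const)
        show "\<forall>x\<in>U. 2 * ?\<gamma> x \<noteq> 0" using g0 by force
      qed (intro continuous_on_mult continuous_on_diff continuous_on_minus continuous_on_add continuous_on_power c1
          continuous_on_component continuous_on_id continuous_on_const)
    qed
  qed
qed

lemma hyperplane_null_set:
  assumes "A \<in> sets borel" "A \<subseteq> {x::real^3. x $ i = 0}"
  shows "A \<in> null_sets lborel"
proof -
  have "negligible A" using assms(2) negligible_standard_hyperplane_cart negligible_subset by blast
  then have "A \<in> null_sets lebesgue" by (simp add: negligible_iff_null_sets)
  then show ?thesis using assms(1) by (simp add: null_sets_completion_iff)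
qed

text \<open>The parameter is \<open>t = |z|^2\<close> rather than \<open>|z|\<close>: with it
  \<open>|w|^2 = (1 - t)^(1/m)\<close>, and the radial integrals involve only powers of
  \<open>t\<close> and \<open>1 - t\<close>. Angles count full turns, so the parameters fill a unit
  cube and integrals over angles are means.\<close>

definition polar :: "nat \<Rightarrow> real \<times> real \<times> real \<Rightarrow> C2" where
  "polar m = (\<lambda>(t, u, v). (of_real (sqrt t) * cis (2 * pi * u), of_real ((1 - t) powr (1 / (2 * real m))) * cis (2 * pi * v)))"

text \<open>Charts live on \<open>real^3\<close>, where Jacobian determinants are formed; iterated
  integration uses the product type.\<close>

definition coords :: "real^3 \<Rightarrow> real \<times> real \<times> real" where
  "coords x = (x$1, x$2, x$3)"

definition cube :: "(real \<times> real \<times> real) set" where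
  "cube = {0<..<1} \<times> {0<..<1} \<times> {0<..<1}"

lemma coords_cube: "coords x \<in> cube \<longleftrightarrow> (\<forall>i. 0 < x $ i \<and> x $ i < 1)"
  by (auto simp: coords_def cube_def forall_3)

lemma Arg2pi_polar:
  assumes "r > 0" "0 < u" "u < 1"
  shows "Arg2pi (of_real r * cis (2 * pi * u)) = 2 * pi * u" "of_real r * cis (2 * pi * u) \<notin> \<real>\<^sub>\<ge>\<^sub>0"
proof -
  show *: "Arg2pi (of_real r * cis (2 * pi * u)) = 2 * pi * u"
    by (rule Arg2pi_unique[of r]) (use assms in \<open>auto simp: cis_conv_exp\<close>)
  show "of_real r * cis (2 * pi * u) \<notin> \<real>\<^sub>\<ge>\<^sub>0"
  proof
    assume "of_real r * cis (2 * pi * u) \<in> \<real>\<^sub>\<ge>\<^sub>0"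
    then have "Arg2pi (of_real r * cis (2 * pi * u)) = 0"
      unfolding Arg2pi_eq_0 by (metis complex_nonneg_Reals_iff complex_is_Real_iff)
    then show False using * assms by simp
  qed
qed

lemma polar_Arg2pi:
  assumes "z \<notin> \<real>\<^sub>\<ge>\<^sub>0"
  shows "of_real (cmod z) * cis (2 * pi * (Arg2pi z / (2 * pi))) = z" "0 < Arg2pi z / (2 * pi)" "Arg2pi z / (2 * pi) < 1"
proof -
  show "of_real (cmod z) * cis (2 * pi * (Arg2pi z / (2 * pi))) = z"
    using Arg2pi_eq[of z] by (simp add: cis_conv_exp)
  have "Arg2pi z \<noteq> 0" using assms unfolding Arg2pi_eq_0
    by (metis complex_nonneg_Reals_iff complex_is_Real_iff)
  then show "0 < Arg2pi z / (2 * pi)" using Arg2pi_ge_0[of z] by simp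
  show "Arg2pi z / (2 * pi) < 1" using Arg2pi_lt_2pi[of z] by simp
qed

lemma has_derivative_cis_mult:
  fixes r u :: "real^3 \<Rightarrow> real"
  assumes "(r has_derivative r') (at x)" "(u has_derivative u') (at x)"
  shows "((\<lambda>x. of_real (r x) * cis (2 * pi * u x)) has_derivative
     (\<lambda>h. (of_real (r' h) + \<i> * of_real (2 * pi * r x * u' h)) * cis (2 * pi * u x))) (at x)"
proof -
  have "((\<lambda>x. 2 * pi * u x) has_derivative (\<lambda>h. 2 * pi * u' h)) (at x)"
    using assms(2) by (rule has_derivative_mult_right)
  note has_derivative_of_real[OF this, where 'a=complex]
  note has_derivative_mult_right[OF this, of \<i>]
  note has_derivative_compose[OF this DERIV_exp[unfolded has_field_derivative_def]]
  note has_derivative_mult[OF has_derivative_of_real[OF assms(1), where 'a=complex] this]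
  then show ?thesis unfolding cis_conv_exp
    by (rule has_derivative_eq_rhs) (auto simp: fun_eq_iff algebra_simps)
qed

text \<open>Rotations preserve the real inner product; this removes the phases from the Gram matrix
  of the polar chart.\<close>

lemma inner_cis:
  "((a + \<i> * b) * cis r) \<bullet> ((c + \<i> * d) * cis r) = (a + \<i> * b) \<bullet> (c + \<i> * d)"
proof -
  have "(x * cis r) \<bullet> (y * cis r) = x \<bullet> y" for x y :: complex
  proof -
    have "(x * cis r) \<bullet> (y * cis r) = (x \<bullet> y) * ((cos r)\<^sup>2 + (sin r)\<^sup>2)"
      unfolding inner_complex_def times_complex.simps cis.simps inner_real_def power2_eq_square by algebra
    then show ?thesis by simp
  qed
  then show ?thesis .
qed

text \<open>The excluded slits are where \<open>Arg2pi\<close> is discontinuous; off them it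
  furnishes the continuous inverse. The three partial derivatives are mutually orthogonal, so the
  area element is the product of the circle lengths \<open>2 pi sqrt t\<close> and
  \<open>2 pi |w|\<close> with the speed in \<open>t\<close> of the profile curve
  \<open>(|z|, |w|)\<close>.\<close>

lemma polar_parametrization:
  assumes m: "m \<ge> 1"
  defines "U \<equiv> {x. coords x \<in> cube}" and "\<phi> \<equiv> \<lambda>x. polar m (coords x)"
  shows "\<phi> ` U = frontier (egg m) \<inter> {p. fst p \<notin> \<real>\<^sub>\<ge>\<^sub>0 \<and> snd p \<notin> \<real>\<^sub>\<ge>\<^sub>0}"
    and "\<exists>\<phi>'. local_parametrization (frontier (egg m)) U \<phi> \<phi>' \<and>
      (\<forall>x\<in>U. area_element (\<phi>' x) = 4 * pi\<^sup>2 * sqrt (x$1) * (1 - x$1) powr (1 / (2 * real m)) *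
         sqrt (1 / (4 * x$1) + ((1 - x$1) powr (1 / (2 * real m) - 1) / (2 * real m))\<^sup>2))"
proof -
  let ?M = "frontier (egg m)" and ?W = "{p :: C2. fst p \<notin> \<real>\<^sub>\<ge>\<^sub>0 \<and> snd p \<notin> \<real>\<^sub>\<ge>\<^sub>0}"
  let ?r = "\<lambda>t. (1 - t) powr (1 / (2 * real m))"
  define r' where "r' t = - ((1 - t) powr (1 / (2 * real m) - 1) / (2 * real m))" for t
  define q where "q p = (vector [(cmod (fst p))\<^sup>2, Arg2pi (fst p) / (2 * pi), Arg2pi (snd p) / (2 * pi)] :: real^3)" for p :: C2
  have r_pos: "?r t > 0" if "t < 1" for t using that by simp
  have r_pow: "?r t ^ (2 * m) = 1 - t" if "t < 1" for t
  proof -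
    have "?r t ^ (2 * m) = ?r t powr (2 * real m)" using powr_realpow[OF r_pos[OF that], of "2 * m"] by simp
    then show ?thesis using that m by (simp only: powr_powr) simp
  qed
  have xU: "0 < x$1" "x$1 < 1" "0 < x$2" "x$2 < 1" "0 < x$3" "x$3 < 1" if "x \<in> U" for x :: "real^3"
    using that by (auto simp: U_def coords_cube)
  have \<phi>_eq: "\<phi> x = (of_real (sqrt (x$1)) * cis (2 * pi * (x$2)), of_real (?r (x$1)) * cis (2 * pi * (x$3)))" for x
    by (simp add: \<phi>_def polar_def coords_def)
  have q\<phi>: "q (\<phi> x) = x" if "x \<in> U" for x
    using xU[OF that] Arg2pi_polar(1)[of "sqrt (x$1)" "x$2"] Arg2pi_polar(1)[of "?r (x$1)" "x$3"]
    by (simp add: q_def \<phi>_eq vec_eq_iff forall_3 norm_mult)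
  show im: "\<phi> ` U = ?M \<inter> ?W"
  proof (intro equalityI subsetI)
    fix p assume "p \<in> \<phi> ` U"
    then obtain x where x: "x \<in> U" "p = \<phi> x" by blast
    show "p \<in> ?M \<inter> ?W"
    proof -
      have "of_real (sqrt (x$1)) * cis (2 * pi * x$2) \<notin> \<real>\<^sub>\<ge>\<^sub>0" "of_real (?r (x$1)) * cis (2 * pi * x$3) \<notin> \<real>\<^sub>\<ge>\<^sub>0"
        using xU[OF x(1)] by (intro Arg2pi_polar(2) r_pos; simp)+
      moreover have "p \<in> ?M"
        unfolding x(2) \<phi>_eq frontier_egg[OF m] using xU[OF x(1)] r_pow[of "x$1"]
        by (simp add: norm_mult)
      ultimately show ?thesis by (simp only: x(2) \<phi>_eq Int_iff mem_Collect_eq fst_conv snd_conv not_False_eq_True simp_thms)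
    qed
  next
    fix p assume p: "p \<in> ?M \<inter> ?W"
    obtain z w where zw: "p = (z, w)" by (cases p)
    have z: "z \<notin> \<real>\<^sub>\<ge>\<^sub>0" and w: "w \<notin> \<real>\<^sub>\<ge>\<^sub>0" and M: "(cmod z)\<^sup>2 + cmod w ^ (2 * m) = 1"
      using p by (auto simp: zw frontier_egg[OF m])
    then have z0: "cmod z > 0" "cmod w > 0" by auto
    then have p0: "cmod w ^ (2 * m) > 0" by simp
    have x: "q p $ 1 = (cmod z)\<^sup>2" "q p $ 2 = Arg2pi z / (2 * pi)" "q p $ 3 = Arg2pi w / (2 * pi)"
      by (simp_all add: q_def zw)
    have "1 - (cmod z)\<^sup>2 = cmod w ^ (2 * m)" using M by simp
    also have "\<dots> = cmod w powr (2 * real m)" using powr_realpow[OF z0(2), of "2 * m"] by simp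
    finally have r: "?r ((cmod z)\<^sup>2) = cmod w"
      using z0 m by (simp only: powr_powr) simp
    have "\<phi> (q p) = p"
      unfolding \<phi>_eq x r using polar_Arg2pi(1)[OF z] polar_Arg2pi(1)[OF w] by (simp add: zw)
    moreover have "(cmod z)\<^sup>2 \<in> {0<..<1}" using M p0 z0(1) zero_less_power[OF z0(1), of 2] by simp
    then have "q p \<in> U"
      using polar_Arg2pi(2,3)[OF z] polar_Arg2pi(2,3)[OF w]
      by (simp only: U_def coords_def cube_def x mem_Collect_eq mem_Times_iff fst_conv snd_conv greaterThanLessThan_iff simp_thms)
    ultimately show "p \<in> \<phi> ` U" by (metis imageI)
  qed
  define D where "D x h = ((of_real (h$1 / (2 * sqrt (x$1))) + \<i> * of_real (2 * pi * sqrt (x$1) * h$2)) * cis (2 * pi * x$2),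
      (of_real (r' (x$1) * h$1) + \<i> * of_real (2 * pi * ?r (x$1) * h$3)) * cis (2 * pi * x$3))" for x h :: "real^3"
  have D: "(\<phi> has_derivative D x) (at x)" if "x \<in> U" for x
  proof -
    note n = bounded_linear.has_derivative[OF bounded_linear_vec_nth has_derivative_ident]
    have "((\<lambda>x::real^3. sqrt (x$1)) has_derivative (\<lambda>h. h$1 / (2 * sqrt (x$1)))) (at x)"
      using xU[OF that] by (auto intro!: derivative_eq_intros n simp: field_simps)
    moreover have "(?r has_real_derivative r' (x$1)) (at (x$1))"
      using xU[OF that] unfolding r'_def by (auto intro!: derivative_eq_intros simp: powr_diff field_simps)
    then have "((\<lambda>x::real^3. ?r (x$1)) has_derivative (\<lambda>h. r' (x$1) * h$1)) (at x)"
      unfolding has_field_derivative_def by (rule has_derivative_compose[OF n])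
    ultimately show ?thesis
      unfolding \<phi>_eq D_def by (intro has_derivative_Pair has_derivative_cis_mult n) 
  qed
  define \<phi>' where "\<phi>' x = Blinfun (D x)" for x
  have ap: "blinfun_apply (\<phi>' x) = D x" if "x \<in> U" for x
    using has_derivative_bounded_linear[OF D[OF that]] by (simp add: \<phi>'_def bounded_linear_Blinfun_apply)
  have area: "area_element (\<phi>' x) = 4 * pi\<^sup>2 * sqrt (x$1) * ?r (x$1) * sqrt (1 / (4 * x$1) + (r' (x$1))\<^sup>2)"
    if x: "x \<in> U" for x
  proof -
    have i: "D x h \<bullet> D x k = (h$1 / (2 * sqrt (x$1))) * (k$1 / (2 * sqrt (x$1))) + (2 * pi * sqrt (x$1) * h$2) * (2 * pi * sqrt (x$1) * k$2)
       + (r' (x$1) * h$1) * (r' (x$1) * k$1) + (2 * pi * ?r (x$1) * h$3) * (2 * pi * ?r (x$1) * k$3)" for h k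
      unfolding D_def inner_Pair inner_cis by (simp add: inner_complex_def)
    have "det (\<chi> i j. D x (axis i 1) \<bullet> D x (axis j 1) :: real^3^3) =
       (1 / (4 * x$1) + (r' (x$1))\<^sup>2) * (2 * pi * sqrt (x$1))\<^sup>2 * (2 * pi * ?r (x$1))\<^sup>2"
      unfolding det_3 using xU[OF x] by (simp add: i axis_def power2_eq_square)
    then have "area_element (\<phi>' x) = sqrt (1 / (4 * x$1) + (r' (x$1))\<^sup>2) * (2 * pi * sqrt (x$1)) * (2 * pi * ?r (x$1))"
      unfolding area_element_def ap[OF x] using xU[OF x] by (simp only: real_sqrt_mult real_sqrt_abs) simp
    then show ?thesis by (simp add: power2_eq_square)
  qed
  have "local_parametrization ?M U \<phi> \<phi>'"
    unfolding local_parametrization_def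
  proof (intro conjI ballI)
    have "U = {x. 0 < x$1 \<and> x$1 < 1 \<and> 0 < x$2 \<and> x$2 < 1 \<and> 0 < x$3 \<and> x$3 < 1}"
      by (auto simp: U_def coords_def cube_def)
    then show "open U" by (simp only:) (intro open_Collect_conj open_Collect_less continuous_intros)
    have "?W = fst -` (- \<real>\<^sub>\<ge>\<^sub>0) \<inter> snd -` (- \<real>\<^sub>\<ge>\<^sub>0)" by auto
    then have "open ?W" by (simp only:) (intro open_Int open_vimage_fst open_vimage_snd open_Compl closed_nonneg_Reals_complex)
    then show "openin (top_of_set ?M) (\<phi> ` U)" unfolding im by (auto simp: openin_open)
    have "continuous_on U \<phi>"
      using D by (intro has_derivative_continuous_on) (rule has_derivative_at_withinI)
    moreover have "continuous_on (\<phi> ` U) q"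
    proof -
      have A: "continuous_on (- \<real>\<^sub>\<ge>\<^sub>0) Arg2pi"
        by (simp add: continuous_at_Arg2pi continuous_at_imp_continuous_on)
      have "continuous_on ?W (\<lambda>p. Arg2pi (fst p))" "continuous_on ?W (\<lambda>p. Arg2pi (snd p))"
        by (auto intro!: continuous_on_compose2[OF A] continuous_intros)
      then have "continuous_on ?W q" unfolding q_def
        by (intro continuous_on_vec3 continuous_intros) auto
      then show ?thesis using im by (auto intro: continuous_on_subset)
    qed
    ultimately have "homeomorphism U (\<phi> ` U) \<phi> q"
      by (intro homeomorphismI) (auto simp: q\<phi>)
    then show "\<exists>\<psi>. homeomorphism U (\<phi> ` U) \<phi> \<psi>" by blast
    show "(\<phi> has_derivative blinfun_apply (\<phi>' x)) (at x)" if "x \<in> U" for x using D[OF that] ap[OF that] by simp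
    show "continuous_on U \<phi>'"
    proof (rule continuous_on_blinfun_componentwise)
      fix i :: "real^3"
      have c1: "continuous_on U (\<lambda>x. (1 - x$1) powr c)" for c
      proof (rule continuous_on_powr)
        show "continuous_on U (\<lambda>x. 1 - x$1)" by (intro continuous_intros)
        show "\<forall>x\<in>U. 1 - x$1 \<noteq> 0" using xU by force
      qed simp
      have c2: "continuous_on U (\<lambda>x. r' (x$1))"
        unfolding r'_def using m by (intro continuous_on_minus continuous_on_divide c1 continuous_on_const) auto
      have c3: "continuous_on U (\<lambda>x. i$1 / (2 * sqrt (x$1)))"
        using xU by (intro continuous_intros) force
      have c4: "continuous_on U (\<lambda>x. cis (2 * pi * x$k))" for k
        unfolding cis_conv_exp by (intro continuous_intros)
      have "continuous_on U (\<lambda>x. D x i)"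
        unfolding D_def by (intro continuous_on_Pair continuous_on_mult continuous_on_add continuous_on_of_real c1 c2 c3 c4
          continuous_on_const continuous_on_real_sqrt continuous_on_component continuous_on_id)
      then show "continuous_on U (\<lambda>x. blinfun_apply (\<phi>' x) i)"
        by (rule continuous_on_eq) (simp add: ap)
    qed
    show "inj (blinfun_apply (\<phi>' x))" if "x \<in> U" for x
    proof -
      have "h = 0" if 0: "D x h = 0" for h
      proof -
        have "of_real (h$1 / (2 * sqrt (x$1))) + \<i> * of_real (2 * pi * sqrt (x$1) * h$2) = 0"
          and "of_real (r' (x$1) * h$1) + \<i> * of_real (2 * pi * ?r (x$1) * h$3) = 0"
          using 0 unfolding D_def zero_prod_def prod.inject mult_eq_0_iff using cis_neq_zero by blast+
        then have "h$1 / (2 * sqrt (x$1)) = 0" "2 * pi * sqrt (x$1) * h$2 = 0" "2 * pi * ?r (x$1) * h$3 = 0"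
          unfolding complex_eq_iff by simp_all
        then show ?thesis using xU[OF \<open>x \<in> U\<close>] by (simp add: vec_eq_iff forall_3)
      qed
      then show ?thesis unfolding ap[OF that] by (metis linear_injective_0 has_derivative_linear D that)
    qed
  qed
  then show "\<exists>\<phi>'. local_parametrization ?M U \<phi> \<phi>' \<and> (\<forall>x\<in>U. area_element (\<phi>' x) = 4 * pi\<^sup>2 * sqrt (x$1) * ?r (x$1) *
         sqrt (1 / (4 * x$1) + ((1 - x$1) powr (1 / (2 * real m) - 1) / (2 * real m))\<^sup>2))"
    using area by (intro exI[of _ \<phi>']) (simp add: r'_def)
qed

section \<open>The Fefferman measure in polar coordinates\<close>

lemma coords_measurable [measurable]: "coords \<in> borel_measurable borel"
  unfolding coords_def by (intro borel_measurable_continuous_onI continuous_intros)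

lemma cis_measurable [measurable]: "cis \<in> borel_measurable borel"
  unfolding cis_conv_exp[abs_def] by (intro borel_measurable_continuous_onI continuous_intros)

lemma triple_measurable [measurable]:
  "(\<lambda>x::real \<times> real \<times> real. fst x) \<in> borel_measurable borel"
  "(\<lambda>x::real \<times> real \<times> real. fst (snd x)) \<in> borel_measurable borel"
  "(\<lambda>x::real \<times> real \<times> real. snd (snd x)) \<in> borel_measurable borel"
  by (intro borel_measurable_continuous_onI continuous_intros)+

lemma polar_measurable [measurable]: "polar m \<in> borel_measurable borel"
proof -
  have "polar m = (\<lambda>x. (of_real (sqrt (fst x)) * cis (2 * pi * fst (snd x)),
      of_real ((1 - fst x) powr (1 / (2 * real m))) * cis (2 * pi * snd (snd x))))"
    by (auto simp: polar_def)
  also have "\<dots> \<in> borel_measurable borel" by (intro borel_measurable_Pair) measurable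
  finally show ?thesis .
qed

lemma cube_borel [measurable]: "cube \<in> sets borel"
  unfolding cube_def by (intro borel_open open_Times) auto

text \<open>The polar chart misses the points at which some coordinate is a nonnegative real.
  Finitely many sets cover them, each of which lies in a coordinate plane of some graph chart and is
  therefore null there.\<close>

lemma surface_measure_egg:
  assumes m: "m \<ge> 1"
  shows "surface_measure (frontier (egg m)) =
    distr (density lborel (\<lambda>x. ennreal (4 * pi\<^sup>2 * sqrt (x$1) * (1 - x$1) powr (1 / (2 * real m)) *
         sqrt (1 / (4 * x$1) + ((1 - x$1) powr (1 / (2 * real m) - 1) / (2 * real m))\<^sup>2)) * indicator cube (coords x)))
      borel (\<lambda>x. polar m (coords x))"
proof -
  let ?M = "frontier (egg m)" and ?\<phi> = "\<lambda>x. polar m (coords x)" and ?U = "{x. coords x \<in> cube}"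
  have M: "?M \<in> sets borel" by (simp add: borel_closed)
  obtain \<phi>' where \<phi>': "local_parametrization ?M ?U ?\<phi> \<phi>'"
      "\<And>x. coords x \<in> cube \<Longrightarrow> area_element (\<phi>' x) = 4 * pi\<^sup>2 * sqrt (x$1) * (1 - x$1) powr (1 / (2 * real m)) *
         sqrt (1 / (4 * x$1) + ((1 - x$1) powr (1 / (2 * real m) - 1) / (2 * real m))\<^sup>2)"
    using polar_parametrization(2)[OF m] by auto
  \<comment> \<open>Every nonzero complex number acquires positive real part after one of these four
    rotations, so the rotated graph charts together reach all points at which the coordinate solved
    for is nonzero.\<close>
  define \<Omega> where "\<Omega> = {1, -1, \<i>, -\<i>}"
  have \<Omega>: "cmod \<omega> = 1" if "\<omega> \<in> \<Omega>" for \<omega> using that by (auto simp: \<Omega>_def)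
  have \<Omega>ex: "\<exists>\<omega>\<in>\<Omega>. Re (cnj \<omega> * c) > 0" if "c \<noteq> 0" for c
  proof -
    have "Re c > 0 \<or> Re c < 0 \<or> Im c > 0 \<or> Im c < 0" using that by (auto simp: complex_eq_iff)
    then show ?thesis by (auto simp: \<Omega>_def)
  qed
  have id: "bounded_linear (\<lambda>p::C2. p)" by (rule bounded_linear_ident)
  have sw: "bounded_linear (prod.swap :: C2 \<Rightarrow> C2)"
    unfolding prod.swap_def by (intro bounded_linear_Pair bounded_linear_fst bounded_linear_snd)
  have M1: "{p. cmod (fst p) ^ (2 * 1) + cmod (snd p) ^ (2 * m) = 1} = ?M"
    and M2: "{p. cmod (snd p) ^ (2 * m) + cmod (fst p) ^ (2 * 1) = 1} = ?M"
    by (auto simp: frontier_egg[OF m] add.commute power2_eq_square)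
  \<comment> \<open>\<open>chart1\<close> solves for \<open>z\<close>, with \<open>k = 1\<close>;
    \<open>chart2\<close> exchanges the coordinates and solves for \<open>w\<close>, with
    \<open>k = m\<close>.\<close>
  note chart1 = graph_chart_parametrization[OF order_refl _ id refl, of _ m, unfolded M1]
    and chart2 = graph_chart_parametrization[OF m _ sw swap_swap, of _ 1, unfolded fst_swap snd_swap M2]
  define A where "A \<omega> = ?M \<inter> {p. Im (fst p) = 0} \<inter> {p. Re (cnj \<omega> * snd p) > 0}" for \<omega>
  define B where "B \<omega> = ?M \<inter> {p. Im (snd p) = 0} \<inter> {p. Re (cnj \<omega> * fst p) > 0}" for \<omega>
  define A' where "A' = ?M \<inter> {p. Im (fst p) = 0} \<inter> {p. Re (cnj 1 * fst p) > 0}"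
  define B' where "B' = ?M \<inter> {p. Im (snd p) = 0} \<inter> {p. Re (cnj 1 * snd p) > 0}"
  define N where "N C \<longleftrightarrow> C \<in> sets borel \<and> C \<subseteq> ?M \<and>
        (\<exists>V \<tau> \<tau>'. local_parametrization ?M V \<tau> \<tau>' \<and> C \<subseteq> \<tau> ` V \<and> V \<inter> \<tau> -` C \<in> null_sets lborel)" for C
  have sl: "N (?M \<inter> H \<inter> W)"
    if P: "\<exists>\<tau>'. local_parametrization ?M V \<tau> \<tau>'" and im: "\<tau> ` V = ?M \<inter> W" and W: "open W" and H: "closed H"
      and i: "\<And>x. \<tau> x \<in> H \<Longrightarrow> x $ i = 0" for V \<tau> W H i
  proof -
    have b: "?M \<inter> H \<inter> W \<in> sets borel" using W H by (auto simp: borel_closed borel_open)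
    obtain \<tau>' where P': "local_parametrization ?M V \<tau> \<tau>'" using P by blast
    have "V \<inter> \<tau> -` (?M \<inter> H \<inter> W) \<in> sets borel"
      using P' b by (intro vimage_Int_borel local_parametrization_continuous[OF P']) (auto simp: local_parametrization_def)
    then have "V \<inter> \<tau> -` (?M \<inter> H \<inter> W) \<in> null_sets lborel"
      by (rule hyperplane_null_set[where i = i]) (use i in auto)
    then show ?thesis unfolding N_def using b P' im by blast
  qed
  have cl: "closed {p :: C2. Im (fst p) = 0}" "closed {p :: C2. Im (snd p) = 0}"
    by (intro closed_Collect_eq continuous_intros)+
  have op: "open {p :: C2. Re (cnj \<omega> * fst p) > 0}" "open {p :: C2. Re (cnj \<omega> * snd p) > 0}" for \<omega>
    by (intro open_Collect_less continuous_intros)+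
  have N1: "N (A \<omega>)" if "\<omega> \<in> \<Omega>" for \<omega> unfolding A_def
    by (rule sl[OF chart2(2)[OF \<Omega>[OF that]] chart2(1)[OF \<Omega>[OF that]] op(2) cl(1), of 3]) (simp add: graph_chart_def)
  have N2: "N (B \<omega>)" if "\<omega> \<in> \<Omega>" for \<omega> unfolding B_def
    by (rule sl[OF chart1(2)[OF \<Omega>[OF that]] chart1(1)[OF \<Omega>[OF that]] op(1) cl(2), of 3]) (simp add: graph_chart_def)
  have N3: "N A'" unfolding A'_def
    by (rule sl[OF chart1(2,1) op(1) cl(1), of _ 1]) (simp_all add: graph_chart_def)
  have N4: "N B'" unfolding B'_def
    by (rule sl[OF chart2(2,1) op(2) cl(2), of _ 1]) (simp_all add: graph_chart_def)
  define \<C> where "\<C> = A ` \<Omega> \<union> B ` \<Omega> \<union> {A', B'}"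
  have cover: "?M - ?\<phi> ` ?U \<subseteq> \<Union>\<C>"
  proof
    fix p assume p: "p \<in> ?M - ?\<phi> ` ?U"
    obtain z w where zw: "p = (z, w)" by (cases p)
    have M1: "(cmod z)\<^sup>2 + cmod w ^ (2 * m) = 1" using p by (simp add: zw frontier_egg[OF m])
    have ne: "z \<noteq> 0 \<or> w \<noteq> 0" using M1 m by (auto simp: power_0_left)
    have "z \<in> \<real>\<^sub>\<ge>\<^sub>0 \<or> w \<in> \<real>\<^sub>\<ge>\<^sub>0" using p polar_parametrization(1)[OF m] by (auto simp: zw)
    then consider "Im z = 0" "Re z > 0" | "Im w = 0" "Re w > 0" | "z = 0" | "w = 0"
      by (force simp: complex_nonneg_Reals_iff complex_eq_iff)
    then show "p \<in> \<Union>\<C>"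
    proof cases
      case 1 then have "p \<in> A'" using p by (simp add: A'_def zw)
      then show ?thesis by (auto simp: \<C>_def)
    next
      case 2 then have "p \<in> B'" using p by (simp add: B'_def zw)
      then show ?thesis by (auto simp: \<C>_def)
    next
      case 3
      then obtain \<omega> where "\<omega> \<in> \<Omega>" "Re (cnj \<omega> * w) > 0" using ne \<Omega>ex by blast
      then have "p \<in> A \<omega>" using p 3 by (simp add: A_def zw)
      then show ?thesis using \<open>\<omega> \<in> \<Omega>\<close> by (auto simp: \<C>_def)
    next
      case 4
      then obtain \<omega> where "\<omega> \<in> \<Omega>" "Re (cnj \<omega> * z) > 0" using ne \<Omega>ex by blast
      then have "p \<in> B \<omega>" using p 4 by (simp add: B_def zw)
      then show ?thesis using \<open>\<omega> \<in> \<Omega>\<close> by (auto simp: \<C>_def)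
    qed
  qed
  have "?\<phi> \<in> borel_measurable borel" by measurable
  moreover have "countable \<C>" by (simp add: \<C>_def \<Omega>_def)
  moreover have "N C" if "C \<in> \<C>" for C using that N1 N2 N3 N4 by (auto simp: \<C>_def)
  ultimately have "surface_measure ?M = distr (density lborel (\<lambda>x. ennreal (area_element (\<phi>' x)) * indicator ?U x)) borel ?\<phi>"
    using surface_measure_eq_distr[OF \<phi>'(1) M _ _ cover] unfolding N_def by blast
  also have "(\<lambda>x. ennreal (area_element (\<phi>' x)) * indicator ?U x) = (\<lambda>x. ennreal (4 * pi\<^sup>2 * sqrt (x$1) * (1 - x$1) powr (1 / (2 * real m)) *
         sqrt (1 / (4 * x$1) + ((1 - x$1) powr (1 / (2 * real m) - 1) / (2 * real m))\<^sup>2)) * indicator cube (coords x))"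
    using \<phi>'(2) by (auto simp: fun_eq_iff indicator_def)
  finally show ?thesis .
qed

section \<open>Wirtinger derivatives of the defining function and the Fefferman density\<close>

lemma wirtinger_eq:
  assumes "(f has_derivative (\<lambda>h. a * fst h + b * cnj (fst h) + c * snd h + d * cnj (snd h))) (at p)"
  shows "wirtinger (1, 0) f p = a" "wirtinger_bar (1, 0) f p = b" "wirtinger (0, 1) f p = c" "wirtinger_bar (0, 1) f p = d"
proof -
  have e: "frechet_derivative f (at p) = (\<lambda>h. a * fst h + b * cnj (fst h) + c * snd h + d * cnj (snd h))"
    using frechet_derivative_at[OF assms] by simp
  have i: "\<i> * (\<i> * x) = - x" for x by (simp flip: mult.assoc)
  show "wirtinger (1, 0) f p = a" "wirtinger_bar (1, 0) f p = b" "wirtinger (0, 1) f p = c" "wirtinger_bar (0, 1) f p = d"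
    by (simp_all add: wirtinger_def wirtinger_bar_def e cscale_def i algebra_simps)
qed

lemma rhoc_eq: "rhoc m p = fst p * cnj (fst p) + snd p ^ m * cnj (snd p) ^ m - 1"
  by (cases p) (simp add: rho_def complex_norm_square[symmetric] power_mult power_mult_distrib[symmetric] complex_mod_cnj flip: of_real_power)

lemma rhoc_has_derivative:
  "(rhoc m has_derivative (\<lambda>h. cnj (fst p) * fst h + fst p * cnj (fst h) +
     (of_nat m * snd p ^ (m - 1) * cnj (snd p) ^ m) * snd h + (of_nat m * snd p ^ m * cnj (snd p) ^ (m - 1)) * cnj (snd h))) (at p)"
  unfolding rhoc_eq
  by (auto intro!: derivative_eq_intros simp: algebra_simps)

text \<open>The bordered determinant is \<open>m^2 |w|^(2m-2)\<close> times
  \<open>rho - |z|^2 - |w|^(2m)\<close>, and the last factor is -1 everywhere. The formula thus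
  holds on the whole ambient space, from which Borel measurability of the density is
  immediate.\<close>

lemma fefferman_density_eq:
  assumes m: "m \<ge> 1"
  shows "fefferman_density m p = root 3 ((real m)\<^sup>2 * cmod (snd p) ^ (2 * (m - 1))) /
     sqrt ((cmod (fst p))\<^sup>2 + (real m * cmod (snd p) ^ (2 * m - 1))\<^sup>2)"
proof -
  obtain k where k: "m = Suc k" using m by (cases m) auto
  let ?r = "rhoc m"
  have w1: "wirtinger (1, 0) ?r = (\<lambda>p. cnj (fst p))" "wirtinger_bar (1, 0) ?r = fst"
    "wirtinger (0, 1) ?r = (\<lambda>p. of_nat m * snd p ^ (m - 1) * cnj (snd p) ^ m)"
    "wirtinger_bar (0, 1) ?r = (\<lambda>p. of_nat m * snd p ^ m * cnj (snd p) ^ (m - 1))"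
    using wirtinger_eq[OF rhoc_has_derivative[of m]] by auto
  have "(fst has_derivative (\<lambda>h. 1 * fst h + 0 * cnj (fst h) + 0 * snd h + 0 * cnj (snd h))) (at p)" for p :: C2
    by (simp add: has_derivative_fst has_derivative_ident)
  note w2 = wirtinger_eq[OF this]
  have "((\<lambda>p. of_nat m * snd p ^ m * cnj (snd p) ^ (m - 1)) has_derivative (\<lambda>h. 0 * fst h + 0 * cnj (fst h) +
     (of_nat m * of_nat m * snd p ^ (m - 1) * cnj (snd p) ^ (m - 1)) * snd h +
     (of_nat m * snd p ^ m * of_nat (m - 1) * cnj (snd p) ^ (m - 1 - 1)) * cnj (snd h))) (at p)" for p :: C2
    by (auto intro!: derivative_eq_intros simp: algebra_simps)
  note w3 = wirtinger_eq[OF this]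
  have "det (fefferman_matrix m p) = - (of_nat m * of_nat m * (snd p * cnj (snd p)) ^ (m - 1))"
    unfolding fefferman_matrix_def Let_def w1 w2 w3 det_3 by (simp add: rhoc_eq k algebra_simps power_mult_distrib)
  then have "cmod (det (fefferman_matrix m p)) = (real m)\<^sup>2 * cmod (snd p) ^ (2 * (m - 1))"
    by (simp add: norm_mult norm_power power2_eq_square power_mult)
  moreover have "cmod (wirtinger (0, 1) ?r p) = real m * cmod (snd p) ^ (2 * m - 1)"
  proof -
    have "2 * m - 1 = (m - 1) + m" by (simp add: k)
    then show ?thesis unfolding w1 by (simp only: norm_mult norm_power norm_of_nat complex_mod_cnj power_add mult.assoc)
  qed
  ultimately show ?thesis unfolding fefferman_density_def by (simp add: w1)
qed

text \<open>The exponent collects powers of \<open>|w|\<close>, where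
  \<open>|w|^(2m) = 1 - t\<close>: \<open>|w| / |w|^(2m-1)\<close> from the area element and
  \<open>|w|^(2(m-1)/3)\<close> from the cube root of the determinant. The constant in front is the
  reciprocal of the constant of the kernel.\<close>

definition polar_weight :: "nat \<Rightarrow> real \<Rightarrow> real" where
  "polar_weight m t = 2 * pi\<^sup>2 / root 3 (real m) * (1 - t) powr (- (2 * (real m - 1) / (3 * real m)))"

text \<open>With \<open>b = m |w|^(2m-1)\<close> the area element carries
  \<open>sqrt (t + b^2)\<close> in the numerator and the density carries it in the denominator: the
  tangent of the profile curve is perpendicular to the gradient of rho, so its speed is proportional
  to the length of the gradient. What remains are pure powers of \<open>m\<close> and
  \<open>1 - t\<close>.\<close>

lemma area_times_density:
  assumes m: "m \<ge> 1" and x: "(t, u, v) \<in> cube"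
  shows "4 * pi\<^sup>2 * sqrt t * (1 - t) powr (1 / (2 * real m)) *
         sqrt (1 / (4 * t) + ((1 - t) powr (1 / (2 * real m) - 1) / (2 * real m))\<^sup>2) * fefferman_density m (polar m (t, u, v))
       = polar_weight m t"
proof -
  have t: "0 < t" "t < 1" using x by (auto simp: cube_def)
  define a where "a = 1 - t"
  have a: "a > 0" using t by (simp add: a_def)
  define s where "s = a powr (1 / (2 * real m))"
  have s: "s > 0" using a by (simp add: s_def)
  have spow: "s ^ n = a powr (real n / (2 * real m))" for n
    unfolding s_def using powr_realpow[of "a powr (1 / (2 * real m))" n] a by (simp add: powr_powr)
  define M where "M = real m"
  have M: "M > 0" using m by (simp add: M_def)
  define b where "b = M * s ^ (2 * m - 1)"
  have b: "b > 0" using M s by (simp add: b_def)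
  have e1: "a powr (1 / (2 * real m) - 1) = 1 / s ^ (2 * m - 1)"
  proof -
    have "1 / s ^ (2 * m - 1) = a powr (- (real (2 * m - 1) / (2 * real m)))"
      unfolding spow powr_minus_divide ..
    also have "- (real (2 * m - 1) / (2 * real m)) = 1 / (2 * real m) - 1"
      using m by (simp add: field_simps of_nat_diff)
    finally show ?thesis by simp
  qed
  have "1 / (4 * t) + (a powr (1 / (2 * real m) - 1) / (2 * real m))\<^sup>2 = (t + b\<^sup>2) / (4 * t * b\<^sup>2)"
  proof -
    have "a powr (1 / (2 * real m) - 1) / (2 * real m) = 1 / (2 * b)"
      unfolding e1 b_def M_def by (simp only: divide_divide_eq_left mult_ac)
    then have "1 / (4 * t) + (a powr (1 / (2 * real m) - 1) / (2 * real m))\<^sup>2 = 1 / (4 * t) + 1 / (4 * b\<^sup>2)"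
      by (simp only: power_divide power_mult_distrib) simp
    also have "\<dots> = (t + b\<^sup>2) / (4 * t * b\<^sup>2)" using t b by (simp add: field_simps)
    finally show ?thesis .
  qed
  then have e2: "sqrt (1 / (4 * t) + (a powr (1 / (2 * real m) - 1) / (2 * real m))\<^sup>2) = sqrt (t + b\<^sup>2) / (2 * sqrt t * b)"
    using b by (simp add: real_sqrt_divide real_sqrt_mult M_def)
  have c: "cmod (fst (polar m (t, u, v))) = sqrt t" "cmod (snd (polar m (t, u, v))) = s"
    using t by (simp_all add: polar_def norm_mult s_def a_def)
  have e3: "fefferman_density m (polar m (t, u, v)) = root 3 (M\<^sup>2 * s ^ (2 * (m - 1))) / sqrt (t + b\<^sup>2)"
    unfolding fefferman_density_eq[OF m] c using t by (simp add: b_def M_def)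
  have pos: "sqrt (t + b\<^sup>2) > 0" using t by (simp add: add_pos_nonneg)
  have "4 * pi\<^sup>2 * sqrt t * s * (sqrt (t + b\<^sup>2) / (2 * sqrt t * b)) * (root 3 (M\<^sup>2 * s ^ (2 * (m - 1))) / sqrt (t + b\<^sup>2))
     = 2 * pi\<^sup>2 * s / b * root 3 (M\<^sup>2 * s ^ (2 * (m - 1)))"
    using t b pos by (simp add: field_simps)
  also have "\<dots> = polar_weight m t"
  proof -
    have r3: "root 3 y = y powr (1/3)" if "y > 0" for y :: real using that by (simp add: root_powr_inverse)
    have i1: "M\<^sup>2 = M powr 2" using M by simp
    have i2: "root 3 (M\<^sup>2 * s ^ (2 * (m - 1))) = M powr (2/3) * a powr (real (2 * (m - 1)) / (2 * real m) / 3)"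
    proof -
      have "root 3 (M\<^sup>2 * s ^ (2 * (m - 1))) = (M\<^sup>2 * s ^ (2 * (m - 1))) powr (1/3)" using M s by (intro r3) simp
      also have "\<dots> = (M powr 2) powr (1/3) * (a powr (real (2 * (m - 1)) / (2 * real m))) powr (1/3)"
        unfolding i1 spow using powr_mult by simp
      finally show ?thesis unfolding powr_powr by simp
    qed
    have i3: "b = M powr 1 * a powr (real (2 * m - 1) / (2 * real m))" using M unfolding b_def spow by simp
    have "2 * pi\<^sup>2 * s / b * root 3 (M\<^sup>2 * s ^ (2 * (m - 1))) =
      2 * pi\<^sup>2 * (M powr (2/3) / M powr 1) * (a powr (1 / (2 * real m)) * a powr (real (2 * (m - 1)) / (2 * real m) / 3) / a powr (real (2 * m - 1) / (2 * real m)))"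
      unfolding i2 i3 by (simp add: s_def)
    also have "M powr (2/3) / M powr 1 = 1 / M powr (1/3)"
    proof -
      have "M powr (2/3) / M powr 1 = M powr (- (1/3))" unfolding powr_diff[symmetric] by simp
      then show ?thesis by (simp only: powr_minus_divide)
    qed
    also have "a powr (1 / (2 * real m)) * a powr (real (2 * (m - 1)) / (2 * real m) / 3) / a powr (real (2 * m - 1) / (2 * real m))
       = a powr (1 / (2 * real m) + real (2 * (m - 1)) / (2 * real m) / 3 - real (2 * m - 1) / (2 * real m))"
      by (simp add: powr_add powr_diff)
    also have "1 / (2 * real m) + real (2 * (m - 1)) / (2 * real m) / 3 - real (2 * m - 1) / (2 * real m) = - (2 * (real m - 1) / (3 * real m))"
      using m by (simp add: field_simps of_nat_diff)
    finally show ?thesis using M by (simp add: polar_weight_def a_def r3 M_def)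
  qed
  finally show ?thesis by (simp only: e3 e2 a_def[symmetric] s_def[symmetric])
qed

text \<open>Lebesgue measure is characterized by its values on boxes, so comparing side lengths is
  enough.\<close>

lemma distr_coords: "distr lborel borel coords = (lborel :: (real \<times> real \<times> real) measure)"
proof (rule lborel_eqI[symmetric])
  note cm = coords_measurable
  fix l u :: "real \<times> real \<times> real"
  assume lu: "\<And>b. b \<in> Basis \<Longrightarrow> l \<bullet> b \<le> u \<bullet> b"
  obtain l1 l2 l3 u1 u2 u3 where e: "l = (l1, l2, l3)" "u = (u1, u2, u3)" by (metis prod.exhaust)
  have le: "l1 \<le> u1" "l2 \<le> u2" "l3 \<le> u3"
    using lu[of "(1, 0, 0)"] lu[of "(0, 1, 0)"] lu[of "(0, 0, 1)"] by (auto simp: e Basis_prod_def zero_prod_def)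
  have "coords -` box l u = box (vector [l1, l2, l3]) (vector [u1, u2, u3])"
  proof -
    have "box l u = {l1<..<u1} \<times> {l2<..<u2} \<times> {l3<..<u3}" by (auto simp: e box_def Basis_prod_def)
    then show ?thesis by (auto simp: coords_def mem_box_cart forall_3)
  qed
  then have "emeasure (distr lborel borel coords) (box l u) = emeasure lborel (box (vector [l1, l2, l3] :: real^3) (vector [u1, u2, u3]))"
    using cm by (subst emeasure_distr) auto
  also have "\<dots> = ennreal (\<Prod>b\<in>Basis. (vector [u1, u2, u3] - vector [l1, l2, l3] :: real^3) \<bullet> b)"
  proof (rule emeasure_lborel_box)
    have "\<forall>i. (vector [l1, l2, l3] :: real^3) $ i \<le> vector [u1, u2, u3] $ i" by (simp add: forall_3 le)
    then show "\<And>b. b \<in> Basis \<Longrightarrow> (vector [l1, l2, l3] :: real^3) \<bullet> b \<le> vector [u1, u2, u3] \<bullet> b"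
      by (auto simp: Basis_vec_def inner_axis)
  qed
  also have "(\<Prod>b\<in>Basis. (vector [u1, u2, u3] - vector [l1, l2, l3] :: real^3) \<bullet> b) = (\<Prod>i\<in>UNIV. (vector [u1, u2, u3] - vector [l1, l2, l3] :: real^3) $ i)"
  proof -
    have B: "(Basis :: (real^3) set) = (\<lambda>i. axis i 1) ` UNIV" by (auto simp: Basis_vec_def)
    have i: "inj (\<lambda>i. axis i 1 :: real^3)" by (auto simp: inj_on_def axis_eq_axis)
    show ?thesis unfolding B prod.reindex[OF i] by (simp add: inner_axis)
  qed
  also have "\<dots> = (\<Prod>b\<in>Basis. (u - l) \<bullet> b)"
    unfolding UNIV_3 by (simp add: e Basis_prod_def prod.union_disjoint prod.reindex inj_on_def)
  finally show "emeasure (distr lborel borel coords) (box l u) = ennreal (\<Prod>b\<in>Basis. (u - l) \<bullet> b)" .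
qed simp

lemma fefferman_measure_eq:
  assumes m: "m \<ge> 1"
  shows "fefferman_measure m = distr (density lborel (\<lambda>x. ennreal (polar_weight m (fst x) * indicator cube x))) borel (polar m)"
proof -
  note cm = coords_measurable
  note pm = polar_measurable
  note cb = cube_borel
  have fm: "fefferman_density m \<in> borel_measurable borel"
  proof -
    have [measurable]: "(fst :: C2 \<Rightarrow> complex) \<in> borel_measurable borel" "(snd :: C2 \<Rightarrow> complex) \<in> borel_measurable borel"
      by (intro borel_measurable_continuous_onI continuous_intros)+
    show ?thesis unfolding fefferman_density_eq[OF m, abs_def] by measurable
  qed
  let ?a = "\<lambda>t. 4 * pi\<^sup>2 * sqrt t * (1 - t) powr (1 / (2 * real m)) *
         sqrt (1 / (4 * t) + ((1 - t) powr (1 / (2 * real m) - 1) / (2 * real m))\<^sup>2)"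
  let ?g = "\<lambda>x. ennreal (?a (fst x)) * indicator cube x"
  have gm: "?g \<in> borel_measurable borel" using cb by measurable
  have "fefferman_measure m = density (distr (density lborel (\<lambda>x. ?g (coords x))) borel (\<lambda>x. polar m (coords x))) (\<lambda>\<xi>. ennreal (fefferman_density m \<xi>))"
    unfolding fefferman_measure_def surface_measure_egg[OF m] by (simp add: coords_def)
  also have "distr (density lborel (\<lambda>x. ?g (coords x))) borel (\<lambda>x. polar m (coords x)) = distr (density lborel ?g) borel (polar m)"
  proof -
    have "distr (density lborel ?g) borel (polar m) = distr (density (distr lborel borel coords) ?g) borel (polar m)"
      by (simp add: distr_coords)
    also have "\<dots> = distr (distr (density lborel (\<lambda>x. ?g (coords x))) borel coords) borel (polar m)"
      using cm gm by (subst density_distr) auto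
    also have "\<dots> = distr (density lborel (\<lambda>x. ?g (coords x))) borel (polar m \<circ> coords)"
      using cm pm by (subst distr_distr) auto
    finally show ?thesis by (simp add: o_def)
  qed
  also have "density (distr (density lborel ?g) borel (polar m)) (\<lambda>\<xi>. ennreal (fefferman_density m \<xi>))
     = distr (density (density lborel ?g) (\<lambda>x. ennreal (fefferman_density m (polar m x)))) borel (polar m)"
    using pm fm by (subst density_distr) auto
  also have "density (density lborel ?g) (\<lambda>x. ennreal (fefferman_density m (polar m x))) =
     density lborel (\<lambda>x. ?g x * ennreal (fefferman_density m (polar m x)))"
    using pm fm gm by (subst density_density_eq) auto
  also have "(\<lambda>x. ?g x * ennreal (fefferman_density m (polar m x))) = (\<lambda>x. ennreal (polar_weight m (fst x) * indicator cube x))"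
  proof
    fix x :: "real \<times> real \<times> real"
    obtain t u v where x: "x = (t, u, v)" by (metis prod.exhaust)
    show "?g x * ennreal (fefferman_density m (polar m x)) = ennreal (polar_weight m (fst x) * indicator cube x)"
    proof (cases "x \<in> cube")
      case True
      then have t: "0 < t" "t < 1" by (auto simp: x cube_def)
      have "0 \<le> ?a t" using t by simp
      then have "ennreal (?a t) * ennreal (fefferman_density m (polar m x)) = ennreal (?a t * fefferman_density m (polar m x))"
        by (simp add: ennreal_mult' )
      then show ?thesis using True area_times_density[OF m] by (simp add: x)
    qed simp
  qed
  finally show ?thesis .
qed

section \<open>Polynomial approximation\<close>

abbreviation circ :: "real \<Rightarrow> real \<Rightarrow> complex" where
  "circ R u \<equiv> of_real R * cis (2 * pi * u)"

text \<open>For \<open>c = circ R u\<close> one has \<open>dc = 2 pi \<i> c du\<close>; the factor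
  \<open>c\<close> lowers the exponent in Cauchy's formula from \<open>n + 1\<close> to
  \<open>n\<close>. The value is free of \<open>R\<close>.\<close>

lemma cauchy_circle_coeff:
  assumes h: "h holomorphic_on ball 0 R0" and R: "0 < R" "R < R0"
  shows "integral {0..1} (\<lambda>u. h (circ R u) / (circ R u) ^ n) = (deriv ^^ n) h 0 / fact n"
proof -
  have c: "continuous_on (cball 0 R) h" and hb: "h holomorphic_on ball 0 R"
    using h R by (auto intro!: holomorphic_on_imp_continuous_on elim!: holomorphic_on_subset)
  have "((\<lambda>u. h u / (u - 0) ^ Suc n) has_contour_integral (2 * pi * \<i> / fact n * (deriv ^^ n) h 0)) (circlepath 0 R)"
    using Cauchy_has_contour_integral_higher_derivative_circlepath[OF c hb, of 0 n] R by simp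
  then have "((\<lambda>x. h (circlepath 0 R x) / circlepath 0 R x ^ Suc n * vector_derivative (circlepath 0 R) (at x within {0..1}))
     has_integral (2 * pi * \<i> / fact n * (deriv ^^ n) h 0)) {0..1}"
    unfolding has_contour_integral_def by simp
  then have "((\<lambda>x. 2 * pi * \<i> * (h (circ R x) / (circ R x) ^ n))
     has_integral (2 * pi * \<i> / fact n * (deriv ^^ n) h 0)) {0..1}"
  proof (rule has_integral_eq[rotated])
    fix t :: real assume t: "t \<in> {0..1}"
    define c where "c = circ R t"
    have ne: "c \<noteq> 0" using R by (simp add: c_def)
    have cc: "circlepath 0 R t = c" by (simp add: circlepath c_def cis_conv_exp mult_ac)
    have "vector_derivative (circlepath 0 R) (at t within {0..1}) = 2 * pi * \<i> * c"
      using t by (simp add: vector_derivative_circlepath01 c_def cis_conv_exp mult_ac)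
    then show "h (circlepath 0 R t) / circlepath 0 R t ^ Suc n * vector_derivative (circlepath 0 R) (at t within {0..1}) =
         2 * pi * \<i> * (h (circ R t) / (circ R t) ^ n)"
      unfolding cc c_def[symmetric] using ne by (simp add: field_simps)
  qed
  then have "((\<lambda>x. (1 / (2 * pi * \<i>)) * (2 * pi * \<i> * (h (circ R x) / (circ R x) ^ n)))
     has_integral (1 / (2 * pi * \<i>)) * (2 * pi * \<i> / fact n * (deriv ^^ n) h 0)) {0..1}"
    by (rule has_integral_mult_right)
  then show ?thesis by (simp add: integral_unique)
qed

text \<open>The Cauchy kernel takes the form \<open>1 / (1 - x / c)\<close>, ready for expansion
  into a geometric series in \<open>x / c\<close>.\<close>

lemma cauchy_circle:
  assumes h: "h holomorphic_on ball 0 R0" and R: "0 < R" "R < R0" and x: "cmod x < R"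
  shows "integral {0..1} (\<lambda>u. h (circ R u) / (1 - x / (circ R u))) = h x"
proof -
  have c: "continuous_on (cball 0 R) h" and hb: "h holomorphic_on ball 0 R"
    using h R by (auto intro!: holomorphic_on_imp_continuous_on elim!: holomorphic_on_subset)
  have "((\<lambda>u. h u / (u - x)) has_contour_integral (2 * pi * \<i> * h x)) (circlepath 0 R)"
    using Cauchy_integral_circlepath[OF c hb] x by simp
  then have "((\<lambda>t. h (circlepath 0 R t) / (circlepath 0 R t - x) * vector_derivative (circlepath 0 R) (at t within {0..1}))
     has_integral (2 * pi * \<i> * h x)) {0..1}"
    unfolding has_contour_integral_def by simp
  then have "((\<lambda>t. 2 * pi * \<i> * (h (circ R t) / (1 - x / (circ R t))))
     has_integral (2 * pi * \<i> * h x)) {0..1}"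
  proof (rule has_integral_eq[rotated])
    fix t :: real assume t: "t \<in> {0..1}"
    define c where "c = circ R t"
    have "cmod c = R" using R by (simp add: c_def norm_mult)
    then have ne: "c \<noteq> 0" "c - x \<noteq> 0" using x R by auto
    have cc: "circlepath 0 R t = c" by (simp add: circlepath c_def cis_conv_exp mult_ac)
    have "vector_derivative (circlepath 0 R) (at t within {0..1}) = 2 * pi * \<i> * c"
      using t by (simp add: vector_derivative_circlepath01 c_def cis_conv_exp mult_ac)
    then show "h (circlepath 0 R t) / (circlepath 0 R t - x) * vector_derivative (circlepath 0 R) (at t within {0..1}) =
         2 * pi * \<i> * (h (circ R t) / (1 - x / (circ R t)))"
      unfolding cc c_def[symmetric] using ne by (simp add: field_simps)
  qed
  then have "((\<lambda>t. (1 / (2 * pi * \<i>)) * (2 * pi * \<i> * (h (circ R t) / (1 - x / (circ R t)))))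
     has_integral (1 / (2 * pi * \<i>)) * (2 * pi * \<i> * h x)) {0..1}"
    by (rule has_integral_mult_right)
  then show ?thesis by (simp add: integral_unique)
qed

lemma geometric_partial_bounds:
  fixes x :: complex
  assumes "cmod x \<le> q" "q < 1"
  shows "cmod (1 / (1 - x)) \<le> 1 / (1 - q)" "cmod (\<Sum>a<N. x ^ a) \<le> 1 / (1 - q)"
    "cmod (1 / (1 - x) - (\<Sum>a<N. x ^ a)) \<le> q ^ N / (1 - q)"
proof -
  have q: "0 \<le> q" using assms(1) norm_ge_zero[of x] by linarith
  have n: "1 - q \<le> cmod (1 - x)" using norm_triangle_ineq2[of 1 x] assms by simp
  have x1: "x \<noteq> 1" using assms by auto
  show "cmod (1 / (1 - x)) \<le> 1 / (1 - q)"
    using n assms by (simp add: norm_divide frac_le)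
  have "cmod (\<Sum>a<N. x ^ a) \<le> (\<Sum>a<N. q ^ a)"
    using assms by (intro sum_norm_le) (simp add: norm_power power_mono)
  also have "\<dots> = (1 - q ^ N) / (1 - q)" using assms by (simp add: sum_gp_strict)
  also have "\<dots> \<le> 1 / (1 - q)" using assms q by (simp add: divide_right_mono)
  finally show "cmod (\<Sum>a<N. x ^ a) \<le> 1 / (1 - q)" .
  have "1 / (1 - x) - (\<Sum>a<N. x ^ a) = x ^ N / (1 - x)"
    using x1 by (simp add: sum_gp_strict diff_divide_distrib[symmetric])
  then show "cmod (1 / (1 - x) - (\<Sum>a<N. x ^ a)) \<le> q ^ N / (1 - q)"
    using n assms q by (simp add: norm_divide norm_power frac_le power_mono)
qed

section \<open>Tori in the egg and Cauchy's formula in two variables\<close>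

lemma mem_egg: "(z, w) \<in> egg m \<longleftrightarrow> (cmod z)\<^sup>2 + cmod w ^ (2 * m) < 1"
  by (simp add: egg_def)

lemma holomorphic2_on_continuous: "holomorphic2_on f D \<Longrightarrow> continuous_on D f"
  unfolding holomorphic2_on_def
  by (metis continuous_at_imp_continuous_on has_derivative_continuous)

lemma holomorphic2_on_slice1:
  assumes "holomorphic2_on f D" "\<And>z. z \<in> S \<Longrightarrow> (z, w) \<in> D"
  shows "(\<lambda>z. f (z, w)) holomorphic_on S"
proof (rule holomorphic_onI)
  fix z assume "z \<in> S"
  then obtain a b where d: "(f has_derivative (\<lambda>h. a * fst h + b * snd h)) (at (z, w))"
    using assms unfolding holomorphic2_on_def by blast
  have "((\<lambda>z. (z, w)) has_derivative (\<lambda>h. (h, 0))) (at z)" by (auto intro!: derivative_eq_intros)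
  from has_derivative_compose[OF this d] have "((\<lambda>z. f (z, w)) has_field_derivative a) (at z)"
    by (simp add: has_field_derivative_def)
  then show "(\<lambda>z. f (z, w)) field_differentiable at z within S"
    using field_differentiable_at_within field_differentiable_def by blast
qed

lemma holomorphic2_on_slice2:
  assumes "holomorphic2_on f D" "\<And>w. w \<in> S \<Longrightarrow> (z, w) \<in> D"
  shows "(\<lambda>w. f (z, w)) holomorphic_on S"
proof (rule holomorphic_onI)
  fix w assume "w \<in> S"
  then obtain a b where d: "(f has_derivative (\<lambda>h. a * fst h + b * snd h)) (at (z, w))"
    using assms unfolding holomorphic2_on_def by blast
  have "((\<lambda>w. (z, w)) has_derivative (\<lambda>h. (0, h))) (at w)" by (auto intro!: derivative_eq_intros)
  from has_derivative_compose[OF this d] have "((\<lambda>w. f (z, w)) has_field_derivative b) (at w)"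
    by (simp add: has_field_derivative_def)
  then show "(\<lambda>w. f (z, w)) field_differentiable at w within S"
    using field_differentiable_at_within field_differentiable_def by blast
qed

definition torus :: "real \<Rightarrow> real \<Rightarrow> real \<times> real \<Rightarrow> C2" where
  "torus R S = (\<lambda>(u, v). (circ R u, circ S v))"

text \<open>The closed polydisc with these radii lies in the egg.\<close>

definition torus_radii :: "nat \<Rightarrow> (real \<times> real) set" where
  "torus_radii m = {(R, S). 0 < R \<and> 0 < S \<and> R\<^sup>2 + S ^ (2 * m) < 1}"

lemma torus_mem_egg: "(R, S) \<in> torus_radii m \<Longrightarrow> torus R S p \<in> egg m"
  by (cases p) (auto simp: torus_def torus_radii_def mem_egg norm_mult)

lemma continuous_on_torus: "continuous_on A (torus R S)"
proof -
  have "torus R S = (\<lambda>p. (of_real R * cis (2 * pi * fst p), of_real S * cis (2 * pi * snd p)))"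
    by (auto simp: torus_def)
  then show ?thesis by (simp only: cis_conv_exp) (intro continuous_intros)
qed

lemma torus_nonzero: "(R, S) \<in> torus_radii m \<Longrightarrow> fst (torus R S p) \<noteq> 0 \<and> snd (torus R S p) \<noteq> 0"
  by (cases p) (auto simp: torus_def torus_radii_def)

text \<open>Cauchy's integral for the Taylor coefficient of \<open>z^a w^b\<close>. The radii are
  kept as arguments until \<open>torus_coeff_indep\<close> shows that they do not matter.\<close>

definition torus_coeff :: "(C2 \<Rightarrow> complex) \<Rightarrow> nat \<Rightarrow> nat \<Rightarrow> real \<Rightarrow> real \<Rightarrow> complex" where
  "torus_coeff f a b R S =
     integral (cbox (0, 0) (1, 1)) (\<lambda>p. f (torus R S p) / (fst (torus R S p) ^ a * snd (torus R S p) ^ b))"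

lemma continuous_on_torus_comp:
  assumes f: "holomorphic2_on f (egg m)" and RS: "(R, S) \<in> torus_radii m"
  shows "continuous_on A (\<lambda>p. f (torus R S p))"
  by (rule continuous_on_compose2[OF holomorphic2_on_continuous[OF f] continuous_on_torus])
    (use torus_mem_egg[OF RS] in auto)

lemma torus_iterated:
  assumes "continuous_on (cbox (0, 0) (1, 1)) G"
  shows "integral (cbox (0, 0) (1::real, 1::real)) G = integral {0..1} (\<lambda>u. integral {0..1} (\<lambda>v. G (u, v)) :: complex)"
    and "integral (cbox (0, 0) (1::real, 1::real)) G = integral {0..1} (\<lambda>v. integral {0..1} (\<lambda>u. G (u, v)) :: complex)"
proof -
  show 1: "integral (cbox (0, 0) (1::real, 1::real)) G = integral {0..1} (\<lambda>u. integral {0..1} (\<lambda>v. G (u, v)))"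
    using integral_prod_continuous[of 0 0 1 1 G] assms by simp
  have "continuous_on (cbox (0, 0) (1, 1)) (\<lambda>(x, y). G (x, y))" using assms by simp
  from integral_swap_continuous[OF this]
  show "integral (cbox (0, 0) (1::real, 1::real)) G = integral {0..1} (\<lambda>v. integral {0..1} (\<lambda>u. G (u, v)))"
    unfolding 1 by simp
qed

text \<open>The slice of the egg contains a disc strictly larger than the circle of integration, as
  Cauchy's formulas on a closed disc require.\<close>

lemma egg_slice_radius1:
  assumes "(R, S) \<in> torus_radii m" "cmod w \<le> S"
  shows "R < sqrt (1 - S ^ (2 * m))" "\<And>z. z \<in> ball 0 (sqrt (1 - S ^ (2 * m))) \<Longrightarrow> (z, w) \<in> egg m"
proof -
  have RS: "0 < R" "0 < S" "R\<^sup>2 + S ^ (2 * m) < 1" using assms by (auto simp: torus_radii_def)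
  show "R < sqrt (1 - S ^ (2 * m))" using RS by (intro real_less_rsqrt) simp
  fix z :: complex assume "z \<in> ball 0 (sqrt (1 - S ^ (2 * m)))"
  then have "(cmod z)\<^sup>2 < (sqrt (1 - S ^ (2 * m)))\<^sup>2" by (intro power_strict_mono) auto
  also have "\<dots> = 1 - S ^ (2 * m)" using RS zero_le_power2[of R] by (intro real_sqrt_pow2) linarith
  finally have "(cmod z)\<^sup>2 < 1 - S ^ (2 * m)" .
  moreover have "cmod w ^ (2 * m) \<le> S ^ (2 * m)" using assms by (intro power_mono) auto
  ultimately show "(z, w) \<in> egg m" by (simp add: mem_egg)
qed

lemma egg_slice_radius2:
  assumes m: "m \<ge> 1" and "(R, S) \<in> torus_radii m" "cmod z \<le> R"
  shows "S < root (2 * m) (1 - R\<^sup>2)" "\<And>w. w \<in> ball 0 (root (2 * m) (1 - R\<^sup>2)) \<Longrightarrow> (z, w) \<in> egg m"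
proof -
  have RS: "0 < R" "0 < S" "R\<^sup>2 + S ^ (2 * m) < 1" using assms by (auto simp: torus_radii_def)
  have S: "S = root (2 * m) (S ^ (2 * m))" using RS m by (simp add: real_root_power_cancel)
  show "S < root (2 * m) (1 - R\<^sup>2)" using RS m by (subst S) (intro real_root_less_mono; simp)
  fix w :: complex assume "w \<in> ball 0 (root (2 * m) (1 - R\<^sup>2))"
  then have "cmod w ^ (2 * m) < root (2 * m) (1 - R\<^sup>2) ^ (2 * m)" using m by (intro power_strict_mono) auto
  also have "\<dots> = 1 - R\<^sup>2"
  proof -
    have "0 \<le> S ^ (2 * m)" using RS by simp
    then show ?thesis using RS m by (intro real_root_pow_pos2) (linarith+)
  qed
  finally have "cmod w ^ (2 * m) < 1 - R\<^sup>2" .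
  moreover have "(cmod z)\<^sup>2 \<le> R\<^sup>2" using assms by (intro power_mono) auto
  ultimately show "(z, w) \<in> egg m" by (simp add: mem_egg)
qed

text \<open>Integrating over \<open>u\<close> first evaluates the inner integral by
  \<open>cauchy_circle_coeff\<close> and eliminates \<open>R\<close>. Its companion
  \<open>torus_coeff_eq2\<close> uses the other order and eliminates \<open>S\<close>.\<close>

lemma torus_coeff_eq1:
  assumes f: "holomorphic2_on f (egg m)" and RS: "(R, S) \<in> torus_radii m"
  shows "torus_coeff f a b R S =
    integral {0..1} (\<lambda>v. (deriv ^^ a) (\<lambda>z. f (z, circ S v)) 0 / fact a / (circ S v) ^ b)"
proof -
  have RS': "0 < R" "0 < S" using RS by (auto simp: torus_radii_def)
  have c: "continuous_on (cbox (0, 0) (1, 1)) (\<lambda>p. f (torus R S p) / (fst (torus R S p) ^ a * snd (torus R S p) ^ b))"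
    using torus_nonzero[OF RS] by (intro continuous_intros continuous_on_torus_comp[OF f RS] continuous_on_torus) auto
  show ?thesis
    unfolding torus_coeff_def torus_iterated(2)[OF c]
  proof (rule integral_cong)
    fix v
    let ?w = "circ S v"
    have w: "cmod ?w \<le> S" using RS' by (simp add: norm_mult)
    have h: "(\<lambda>z. f (z, ?w)) holomorphic_on ball 0 (sqrt (1 - S ^ (2 * m)))"
      by (rule holomorphic2_on_slice1[OF f]) (rule egg_slice_radius1(2)[OF RS w])
    have "integral {0..1} (\<lambda>u. f (torus R S (u, v)) / (fst (torus R S (u, v)) ^ a * snd (torus R S (u, v)) ^ b))
       = integral {0..1} (\<lambda>u. f (circ R u, ?w) / (circ R u) ^ a / ?w ^ b)"
      by (simp add: torus_def)
    also have "\<dots> = integral {0..1} (\<lambda>u. f (circ R u, ?w) / (circ R u) ^ a) / ?w ^ b"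
      by (rule integral_divide)
    also have "\<dots> = (deriv ^^ a) (\<lambda>z. f (z, ?w)) 0 / fact a / ?w ^ b"
      by (subst cauchy_circle_coeff[OF h RS'(1) egg_slice_radius1(1)[OF RS w]]) simp
    finally show "integral {0..1} (\<lambda>u. f (torus R S (u, v)) / (fst (torus R S (u, v)) ^ a * snd (torus R S (u, v)) ^ b))
       = (deriv ^^ a) (\<lambda>z. f (z, ?w)) 0 / fact a / ?w ^ b" .
  qed
qed

lemma torus_coeff_eq2:
  assumes m: "m \<ge> 1" and f: "holomorphic2_on f (egg m)" and RS: "(R, S) \<in> torus_radii m"
  shows "torus_coeff f a b R S =
    integral {0..1} (\<lambda>u. (deriv ^^ b) (\<lambda>w. f (circ R u, w)) 0 / fact b / (circ R u) ^ a)"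
proof -
  have RS': "0 < R" "0 < S" using RS by (auto simp: torus_radii_def)
  have c: "continuous_on (cbox (0, 0) (1, 1)) (\<lambda>p. f (torus R S p) / (fst (torus R S p) ^ a * snd (torus R S p) ^ b))"
    using torus_nonzero[OF RS] by (intro continuous_intros continuous_on_torus_comp[OF f RS] continuous_on_torus) auto
  show ?thesis
    unfolding torus_coeff_def torus_iterated(1)[OF c]
  proof (rule integral_cong)
    fix u
    let ?z = "circ R u"
    have z: "cmod ?z \<le> R" using RS' by (simp add: norm_mult)
    have h: "(\<lambda>w. f (?z, w)) holomorphic_on ball 0 (root (2 * m) (1 - R\<^sup>2))"
      by (rule holomorphic2_on_slice2[OF f]) (rule egg_slice_radius2(2)[OF m RS z])
    have "integral {0..1} (\<lambda>v. f (torus R S (u, v)) / (fst (torus R S (u, v)) ^ a * snd (torus R S (u, v)) ^ b))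
       = integral {0..1} (\<lambda>v. f (?z, circ S v) / (circ S v) ^ b / ?z ^ a)"
      by (simp add: torus_def mult.commute)
    also have "\<dots> = integral {0..1} (\<lambda>v. f (?z, circ S v) / (circ S v) ^ b) / ?z ^ a"
      by (rule integral_divide)
    also have "\<dots> = (deriv ^^ b) (\<lambda>w. f (?z, w)) 0 / fact b / ?z ^ a"
      by (subst cauchy_circle_coeff[OF h RS'(2) egg_slice_radius2(1)[OF m RS z]]) simp
    finally show "integral {0..1} (\<lambda>v. f (torus R S (u, v)) / (fst (torus R S (u, v)) ^ a * snd (torus R S (u, v)) ^ b))
       = (deriv ^^ b) (\<lambda>w. f (?z, w)) 0 / fact b / ?z ^ a" .
  qed
qed

text \<open>Changing one radius at a time may leave the egg: neither \<open>(R, S')\<close> nor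
  \<open>(R', S)\<close> has to be admissible on the way. The path \<open>(R, S)\<close>,
  \<open>(R, T)\<close>, \<open>(R', T)\<close>, \<open>(R', S')\<close> with
  \<open>T = min S S'\<close> stays admissible.\<close>

lemma torus_coeff_indep:
  assumes m: "m \<ge> 1" and f: "holomorphic2_on f (egg m)"
    and RS: "(R, S) \<in> torus_radii m" and RS': "(R', S') \<in> torus_radii m"
  shows "torus_coeff f a b R S = torus_coeff f a b R' S'"
proof -
  define T where "T = min S S'"
  have p: "S ^ (2 * m) \<ge> T ^ (2 * m)" "S' ^ (2 * m) \<ge> T ^ (2 * m)"
    using RS RS' by (auto simp: T_def torus_radii_def intro!: power_mono)
  have T: "(R, T) \<in> torus_radii m" "(R', T) \<in> torus_radii m"
    using RS RS' p by (auto simp: torus_radii_def T_def)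
  show ?thesis
    using torus_coeff_eq1[OF f T(1)] torus_coeff_eq1[OF f T(2)]
      torus_coeff_eq2[OF m f T(1)] torus_coeff_eq2[OF m f RS] torus_coeff_eq2[OF m f T(2)] torus_coeff_eq2[OF m f RS']
    by metis
qed

lemma cauchy_torus:
  assumes m: "m \<ge> 1" and f: "holomorphic2_on f (egg m)" and RS: "(R, S) \<in> torus_radii m"
    and z: "cmod z < R" and w: "cmod w < S"
  shows "continuous_on (cbox (0, 0) (1, 1)) (\<lambda>p. f (torus R S p) * (1 / (1 - z / fst (torus R S p)) * (1 / (1 - w / snd (torus R S p)))))"
    and "integral (cbox (0, 0) (1, 1)) (\<lambda>p. f (torus R S p) * (1 / (1 - z / fst (torus R S p)) * (1 / (1 - w / snd (torus R S p))))) = f (z, w)"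
proof -
  have RS': "0 < R" "0 < S" using RS by (auto simp: torus_radii_def)
  have n: "cmod (fst (torus R S p)) = R" "cmod (snd (torus R S p)) = S" for p
    using RS' by (cases p; simp add: torus_def norm_mult)+
  have ne: "1 - z / fst (torus R S p) \<noteq> 0" "1 - w / snd (torus R S p) \<noteq> 0" for p
    using n[of p] z w torus_nonzero[OF RS, of p] by auto
  show c: "continuous_on (cbox (0, 0) (1, 1)) (\<lambda>p. f (torus R S p) * (1 / (1 - z / fst (torus R S p)) * (1 / (1 - w / snd (torus R S p)))))"
    using torus_nonzero[OF RS] ne
    by (intro continuous_intros continuous_on_torus_comp[OF f RS] continuous_on_torus) auto
  have hw: "(\<lambda>w. f (z, w)) holomorphic_on ball 0 (root (2 * m) (1 - R\<^sup>2))"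
    by (rule holomorphic2_on_slice2[OF f]) (rule egg_slice_radius2(2)[OF m RS less_imp_le[OF z]])
  have "integral (cbox (0, 0) (1, 1)) (\<lambda>p. f (torus R S p) * (1 / (1 - z / fst (torus R S p)) * (1 / (1 - w / snd (torus R S p)))))
    = integral {0..1} (\<lambda>v. f (z, circ S v) / (1 - w / (circ S v)))"
    unfolding torus_iterated(2)[OF c]
  proof (rule integral_cong)
    fix v
    let ?w = "circ S v"
    have w': "cmod ?w \<le> S" using RS' by (simp add: norm_mult)
    have h: "(\<lambda>z. f (z, ?w)) holomorphic_on ball 0 (sqrt (1 - S ^ (2 * m)))"
      by (rule holomorphic2_on_slice1[OF f]) (rule egg_slice_radius1(2)[OF RS w'])
    have "integral {0..1} (\<lambda>u. f (torus R S (u, v)) * (1 / (1 - z / fst (torus R S (u, v))) * (1 / (1 - w / snd (torus R S (u, v))))))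
      = integral {0..1} (\<lambda>u. f (circ R u, ?w) / (1 - z / (circ R u)) / (1 - w / ?w))"
      by (simp add: torus_def)
    also have "\<dots> = integral {0..1} (\<lambda>u. f (circ R u, ?w) / (1 - z / (circ R u))) / (1 - w / ?w)"
      by (rule integral_divide)
    also have "\<dots> = f (z, ?w) / (1 - w / ?w)"
      by (subst cauchy_circle[OF h RS'(1) egg_slice_radius1(1)[OF RS w'] z]) simp
    finally show "integral {0..1} (\<lambda>u. f (torus R S (u, v)) * (1 / (1 - z / fst (torus R S (u, v))) * (1 / (1 - w / snd (torus R S (u, v))))))
      = f (z, ?w) / (1 - w / ?w)" .
  qed
  also have "\<dots> = f (z, w)"
    by (rule cauchy_circle[OF hw RS'(2) egg_slice_radius2(1)[OF m RS less_imp_le[OF z]] w])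
  finally show "integral (cbox (0, 0) (1, 1)) (\<lambda>p. f (torus R S p) * (1 / (1 - z / fst (torus R S p)) * (1 / (1 - w / snd (torus R S p))))) = f (z, w)" .
qed

text \<open>By \<open>cauchy_torus\<close> the value of \<open>f\<close> is the mean over the torus
  against a product of two geometric series, and the polynomial is the mean against the product of
  their truncations. The two products differ by a multiple of \<open>q ^ N\<close>, uniformly on the
  torus.\<close>

lemma torus_poly_error:
  assumes m: "m \<ge> 1" and f: "holomorphic2_on f (egg m)" and RS: "(R, S) \<in> torus_radii m"
    and q: "q < 1" and z: "cmod z \<le> q * R" and w: "cmod w \<le> q * S"
    and C: "\<And>p. cmod (f (torus R S p)) \<le> C"
  shows "cmod (f (z, w) - (\<Sum>a<N. \<Sum>b<N. torus_coeff f a b R S * z ^ a * w ^ b)) \<le> C * (2 * q ^ N / (1 - q)\<^sup>2)"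
proof -
  let ?Q = "cbox (0, 0) (1::real, 1::real)"
  let ?x = "\<lambda>p. z / fst (torus R S p)" and ?y = "\<lambda>p. w / snd (torus R S p)"
  let ?F = "\<lambda>p. f (torus R S p)"
  have RS': "0 < R" "0 < S" using RS by (auto simp: torus_radii_def)
  have "0 \<le> q * R" using z norm_ge_zero[of z] by linarith
  then have q0: "0 \<le> q" using RS' by (simp add: zero_le_mult_iff)
  have zR: "cmod z < R" and wS: "cmod w < S"
    using z w RS' mult_strict_right_mono[OF q, of R] mult_strict_right_mono[OF q, of S] by linarith+
  have n: "cmod (fst (torus R S p)) = R" "cmod (snd (torus R S p)) = S" for p
    using RS' by (cases p; simp add: torus_def norm_mult)+
  have x: "cmod (?x p) \<le> q" and y: "cmod (?y p) \<le> q" for p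
    using z w RS' n[of p] by (simp_all add: norm_divide pos_divide_le_eq)
  have cF: "continuous_on ?Q ?F" by (rule continuous_on_torus_comp[OF f RS])
  have cm: "continuous_on ?Q (\<lambda>p. ?F p * (?x p ^ a * ?y p ^ b))" for a b
    using torus_nonzero[OF RS] by (intro continuous_intros cF continuous_on_torus) auto
  have cs: "continuous_on ?Q (\<lambda>p. ?F p * ((\<Sum>a<N. ?x p ^ a) * (\<Sum>b<N. ?y p ^ b)))"
    using torus_nonzero[OF RS] by (intro continuous_intros cF continuous_on_torus) auto
  have "(\<Sum>a<N. \<Sum>b<N. torus_coeff f a b R S * z ^ a * w ^ b)
     = (\<Sum>a<N. \<Sum>b<N. integral ?Q (\<lambda>p. ?F p * (?x p ^ a * ?y p ^ b)))"
  proof (intro sum.cong refl)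
    fix a b
    have "torus_coeff f a b R S * z ^ a * w ^ b = torus_coeff f a b R S * (z ^ a * w ^ b)" by simp
    also have "\<dots> = integral ?Q (\<lambda>p. ?F p / (fst (torus R S p) ^ a * snd (torus R S p) ^ b) * (z ^ a * w ^ b))"
      unfolding torus_coeff_def by (rule integral_mult_left[symmetric])
    finally show "torus_coeff f a b R S * z ^ a * w ^ b = integral ?Q (\<lambda>p. ?F p * (?x p ^ a * ?y p ^ b))"
      by (simp add: power_divide)
  qed
  also have "\<dots> = integral ?Q (\<lambda>p. \<Sum>a<N. \<Sum>b<N. ?F p * (?x p ^ a * ?y p ^ b))"
    by (subst integral_sum; (intro integrable_sum integrable_continuous cm finite_lessThan)?)
       (simp add: integral_sum integrable_continuous cm)
  also have "\<dots> = integral ?Q (\<lambda>p. ?F p * ((\<Sum>a<N. ?x p ^ a) * (\<Sum>b<N. ?y p ^ b)))"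
  proof -
    have "(\<Sum>a<N. \<Sum>b<N. ?F p * (?x p ^ a * ?y p ^ b)) = ?F p * ((\<Sum>a<N. ?x p ^ a) * (\<Sum>b<N. ?y p ^ b))" for p
      by (simp only: sum_product) (simp only: sum_distrib_left)
    then show ?thesis by (simp only:)
  qed
  finally have s: "(\<Sum>a<N. \<Sum>b<N. torus_coeff f a b R S * z ^ a * w ^ b) = \<dots>" .
  have "f (z, w) - (\<Sum>a<N. \<Sum>b<N. torus_coeff f a b R S * z ^ a * w ^ b) =
     integral ?Q (\<lambda>p. ?F p * (1 / (1 - ?x p) * (1 / (1 - ?y p))) - ?F p * ((\<Sum>a<N. ?x p ^ a) * (\<Sum>b<N. ?y p ^ b)))"
    unfolding s cauchy_torus(2)[OF m f RS zR wS, symmetric]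
    by (rule integral_diff[symmetric]) (intro integrable_continuous cs cauchy_torus(1)[OF m f RS zR wS])+
  also have "cmod \<dots> \<le> C * (2 * q ^ N / (1 - q)\<^sup>2) * measure lborel ?Q"
  proof (rule has_integral_bound)
    show "0 \<le> C * (2 * q ^ N / (1 - q)\<^sup>2)"
      using order_trans[OF norm_ge_zero C] q0 q by (intro mult_nonneg_nonneg) auto
    show "((\<lambda>p. ?F p * (1 / (1 - ?x p) * (1 / (1 - ?y p))) - ?F p * ((\<Sum>a<N. ?x p ^ a) * (\<Sum>b<N. ?y p ^ b)))
      has_integral integral ?Q (\<lambda>p. ?F p * (1 / (1 - ?x p) * (1 / (1 - ?y p))) - ?F p * ((\<Sum>a<N. ?x p ^ a) * (\<Sum>b<N. ?y p ^ b)))) ?Q"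
      by (intro integrable_integral integrable_continuous continuous_on_diff cs cauchy_torus(1)[OF m f RS zR wS])
    fix p assume "p \<in> ?Q"
    define X where "X = 1 / (1 - ?x p)"
    define Y where "Y = 1 / (1 - ?y p)"
    define X' where "X' = (\<Sum>a<N. ?x p ^ a)"
    define Y' where "Y' = (\<Sum>a<N. ?y p ^ a)"
    have b: "cmod X \<le> 1 / (1 - q)" "cmod Y' \<le> 1 / (1 - q)" "cmod (X - X') \<le> q ^ N / (1 - q)" "cmod (Y - Y') \<le> q ^ N / (1 - q)"
      unfolding X_def Y_def X'_def Y'_def by (intro geometric_partial_bounds x y q)+
    \<comment> \<open>Each summand pairs one small difference with a factor bounded independently of
      \<open>N\<close>.\<close>
    have "X * Y - X' * Y' = X * (Y - Y') + (X - X') * Y'" by (simp add: algebra_simps)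
    also have "cmod \<dots> \<le> cmod X * cmod (Y - Y') + cmod (X - X') * cmod Y'"
      by (rule order_trans[OF norm_triangle_ineq]) (simp add: norm_mult)
    also have "\<dots> \<le> 1 / (1 - q) * (q ^ N / (1 - q)) + q ^ N / (1 - q) * (1 / (1 - q))"
      using b q q0 by (intro add_mono mult_mono) auto
    also have "\<dots> = 2 * q ^ N / (1 - q)\<^sup>2" by (simp add: power2_eq_square)
    finally have "cmod (X * Y - X' * Y') \<le> 2 * q ^ N / (1 - q)\<^sup>2" .
    then have "cmod (?F p) * cmod (X * Y - X' * Y') \<le> C * (2 * q ^ N / (1 - q)\<^sup>2)"
      using C order_trans[OF norm_ge_zero C] by (intro mult_mono) auto
    then show "cmod (?F p * (1 / (1 - ?x p) * (1 / (1 - ?y p))) - ?F p * ((\<Sum>a<N. ?x p ^ a) * (\<Sum>b<N. ?y p ^ b))) \<le> C * (2 * q ^ N / (1 - q)\<^sup>2)"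
      unfolding X_def[symmetric] Y_def[symmetric] X'_def[symmetric] Y'_def[symmetric]
      by (simp add: norm_mult flip: right_diff_distrib)
  qed
  also have "measure lborel ?Q = 1" by (simp add: content_Pair)
  finally show ?thesis by simp
qed

text \<open>The egg is a union of polydiscs without being one, so the torus has to follow the point
  \<open>(z, w)\<close>. All admissible tori give the same coefficients, and the tori chosen stay in
  one compact part of the egg; hence a single polynomial works and the error is uniform.\<close>

lemma egg_poly_approx:
  assumes m: "m \<ge> 1" and f: "holomorphic2_on f (egg m)" and r: "0 < r" "r < 1" and e: "e > 0"
  shows "\<exists>N c. \<forall>z w. (cmod z)\<^sup>2 + cmod w ^ (2 * m) \<le> 1 \<longrightarrow>
     cmod (f (of_real r * z, of_real r * w) - (\<Sum>a<N. \<Sum>b<N. c a b * z ^ a * w ^ b)) < e"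
proof -
  \<comment> \<open>Chosen so that \<open>k = r * (1 + 2 * d)\<close> equals
    \<open>(1 + r) / 2\<close>, still below 1; the compact set \<open>?K\<close> will contain all
    tori in use.\<close>
  define d where "d = (1 / r - 1) / 4"
  have d: "d > 0" using r by (simp add: d_def field_simps)
  define k where "k = r * (1 + 2 * d)"
  have k: "k < 1" using r by (simp add: k_def d_def field_simps)
  let ?K = "{p :: C2. (cmod (fst p))\<^sup>2 + cmod (snd p) ^ (2 * m) \<le> k}"
  have Ksub: "?K \<subseteq> egg m" using k by (auto simp: egg_def)
  have "?K \<subseteq> closed_egg m" using k by (auto simp: closed_egg_def)
  moreover have "closed ?K" by (intro closed_Collect_le continuous_intros)
  ultimately have "compact ?K" using compact_Int_closed[OF compact_closed_egg[OF m], of ?K] by (simp only: Int_absorb1)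
  then have "bounded (f ` ?K)"
    using holomorphic2_on_continuous[OF f] Ksub continuous_on_subset compact_continuous_image compact_imp_bounded by blast
  then obtain C where C: "\<And>p. p \<in> ?K \<Longrightarrow> cmod (f p) \<le> C" unfolding bounded_iff by blast
  \<comment> \<open>The dilation is spent in two halves, \<open>r = q^2\<close>: one factor
    \<open>q\<close> brings the tori into \<open>?K\<close>, the other bounds the ratios of
    \<open>r z\<close> to \<open>R\<close> and of \<open>r w\<close> to \<open>S\<close>.\<close>
  define q where "q = sqrt r"
  have q: "0 < q" "q < 1" "q\<^sup>2 = r" using r by (auto simp: q_def)
  have "(\<lambda>N. C * (2 * q ^ N / (1 - q)\<^sup>2)) \<longlonglongrightarrow> C * (2 * 0 / (1 - q)\<^sup>2)"
    using q by (intro tendsto_intros LIMSEQ_power_zero) auto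
  then have "eventually (\<lambda>N. C * (2 * q ^ N / (1 - q)\<^sup>2) < e) sequentially"
    using e by (intro order_tendstoD) auto
  then obtain N where N: "C * (2 * q ^ N / (1 - q)\<^sup>2) < e" by (auto simp: eventually_sequentially)
  \<comment> \<open>The coefficients are read off from one fixed admissible torus.\<close>
  define c where "c a b = torus_coeff f a b (1/2) (1/2)" for a b
  have half: "(1/2, 1/2) \<in> torus_radii m"
  proof -
    have "(1/2 :: real) ^ (2 * m) \<le> (1/2) ^ 2" using m by (intro power_decreasing) auto
    then show ?thesis by (simp add: torus_radii_def power2_eq_square)
  qed
  show ?thesis
  proof (intro exI[of _ N] exI[of _ "\<lambda>a b. c a b * of_real r ^ a * of_real r ^ b"] allI impI)
    fix z w :: complex assume zw: "(cmod z)\<^sup>2 + cmod w ^ (2 * m) \<le> 1"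
    \<comment> \<open>The summand \<open>d\<close> keeps both radii positive when \<open>z\<close>
      or \<open>w\<close> vanishes.\<close>
    define R where "R = q * sqrt ((cmod z)\<^sup>2 + d)"
    define S where "S = q * root (2 * m) (cmod w ^ (2 * m) + d)"
    have dp: "(cmod z)\<^sup>2 + d > 0" "cmod w ^ (2 * m) + d > 0" using d by (auto simp: add_nonneg_pos)
    have RSp: "0 < R" "0 < S" using q dp m by (auto simp: R_def S_def)
    have "R\<^sup>2 = r * ((cmod z)\<^sup>2 + d)" using dp q by (simp add: R_def power_mult_distrib)
    moreover have "S ^ (2 * m) = r ^ m * (cmod w ^ (2 * m) + d)"
    proof -
      have "q ^ (2 * m) = r ^ m" by (simp only: power_mult q(3))
      moreover have "root (2 * m) (cmod w ^ (2 * m) + d) ^ (2 * m) = cmod w ^ (2 * m) + d"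
        using dp m by (intro real_root_pow_pos2) auto
      ultimately show ?thesis by (simp only: S_def power_mult_distrib)
    qed
    moreover have "r ^ m * (cmod w ^ (2 * m) + d) \<le> r * (cmod w ^ (2 * m) + d)"
      using dp r m power_decreasing[of 1 m r] by (intro mult_right_mono) auto
    ultimately have "R\<^sup>2 + S ^ (2 * m) \<le> r * (((cmod z)\<^sup>2 + cmod w ^ (2 * m)) + 2 * d)" by (simp add: algebra_simps)
    also have "\<dots> \<le> k" unfolding k_def using zw r by (intro mult_left_mono) auto
    finally have RSk: "R\<^sup>2 + S ^ (2 * m) \<le> k" .
    have RS: "(R, S) \<in> torus_radii m" using RSk k RSp by (simp add: torus_radii_def)
    have "torus R S p \<in> ?K" for p using RSk RSp by (cases p) (simp add: torus_def norm_mult)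
    then have CC: "cmod (f (torus R S p)) \<le> C" for p using C by blast
    have "cmod z \<le> sqrt ((cmod z)\<^sup>2 + d)" using d by (intro real_le_rsqrt) simp
    then have z: "cmod (of_real r * z) \<le> q * R"
      unfolding R_def using q r by (simp add: norm_mult power2_eq_square[symmetric] mult.assoc[symmetric])
    have "cmod w = root (2 * m) (cmod w ^ (2 * m))" using m by (simp add: real_root_power_cancel)
    also have "\<dots> \<le> root (2 * m) (cmod w ^ (2 * m) + d)" using d m by (intro real_root_le_mono) auto
    finally have w: "cmod (of_real r * w) \<le> q * S"
      unfolding S_def using q r by (simp add: norm_mult power2_eq_square[symmetric] mult.assoc[symmetric])
    have "torus_coeff f a b R S = c a b" for a b
      unfolding c_def by (rule torus_coeff_indep[OF m f RS half])
    then have "cmod (f (of_real r * z, of_real r * w) - (\<Sum>a<N. \<Sum>b<N. c a b * (of_real r * z) ^ a * (of_real r * w) ^ b)) \<le> C * (2 * q ^ N / (1 - q)\<^sup>2)"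
      using torus_poly_error[OF m f RS q(2) z w CC, of N] by simp
    then show "cmod (f (of_real r * z, of_real r * w) - (\<Sum>a<N. \<Sum>b<N. c a b * of_real r ^ a * of_real r ^ b * z ^ a * w ^ b)) < e"
      using N by (simp add: power_mult_distrib mult_ac)
  qed
qed

section \<open>Approach regions\<close>

text \<open>The real gradient of rho under the identification of \<open>C2\<close> with real
  4-space. Writing \<open>|w|^2\<close> as an inner product keeps its powers visibly differentiable
  at \<open>w = 0\<close>.\<close>

definition rho_grad :: "nat \<Rightarrow> C2 \<Rightarrow> C2" where
  "rho_grad m p = (2 *\<^sub>R fst p, (2 * real m * (snd p \<bullet> snd p) ^ (m - 1)) *\<^sub>R snd p)"

lemma rho_inner: "rho m p = fst p \<bullet> fst p + (snd p \<bullet> snd p) ^ m - 1"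
  by (cases p) (simp add: rho_def power_mult dot_square_norm)

lemma outward_normal_eq: "outward_normal m \<xi> = sgn (rho_grad m \<xi>)"
proof -
  have "(rho m has_derivative (\<lambda>h. rho_grad m \<xi> \<bullet> h)) (at \<xi>)"
    unfolding rho_inner[abs_def] rho_grad_def
    by (auto intro!: derivative_eq_intros simp: inner_prod_def inner_commute algebra_simps)
  then have "frechet_derivative (rho m) (at \<xi>) = (\<lambda>h. rho_grad m \<xi> \<bullet> h)"
    using frechet_derivative_at by metis
  then show ?thesis unfolding outward_normal_def by (simp add: euclidean_representation)
qed

context
  fixes m :: nat
  assumes m: "m \<ge> 1"
begin

lemma frontier_bounds:
  assumes "\<xi> \<in> frontier (egg m)"
  shows "(cmod (fst \<xi>))\<^sup>2 + cmod (snd \<xi>) ^ (2 * m) = 1" "cmod (fst \<xi>) \<le> 1" "cmod (snd \<xi>) \<le> 1" "norm \<xi> \<le> 2"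
proof -
  show "(cmod (fst \<xi>))\<^sup>2 + cmod (snd \<xi>) ^ (2 * m) = 1" using assms by (auto simp: frontier_egg[OF m])
  show *: "cmod (fst \<xi>) \<le> 1" "cmod (snd \<xi>) \<le> 1"
    using closed_egg_bounds[OF m subsetD[OF frontier_subset_closed_egg[OF m] assms]] by auto
  have "norm \<xi> \<le> cmod (fst \<xi>) + cmod (snd \<xi>)" by (metis norm_Pair_le prod.collapse)
  then show "norm \<xi> \<le> 2" using * by linarith
qed

lemma inner_rho_grad:
  "\<xi> \<bullet> rho_grad m \<xi> = 2 * (cmod (fst \<xi>))\<^sup>2 + 2 * real m * cmod (snd \<xi>) ^ (2 * m)"
proof -
  have "\<xi> \<bullet> rho_grad m \<xi> = 2 * (fst \<xi> \<bullet> fst \<xi>) + 2 * real m * ((snd \<xi> \<bullet> snd \<xi>) ^ (m - 1) * (snd \<xi> \<bullet> snd \<xi>))"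
    by (simp add: rho_grad_def inner_prod_def)
  also have "(snd \<xi> \<bullet> snd \<xi>) ^ (m - 1) * (snd \<xi> \<bullet> snd \<xi>) = (snd \<xi> \<bullet> snd \<xi>) ^ m"
    using m by (intro power_minus_mult) simp
  finally show ?thesis by (simp add: dot_square_norm power_mult)
qed

lemma hermitian_dot_rho_grad:
  "hermitian_dot (c *\<^sub>R \<xi>) (k *\<^sub>R rho_grad m \<xi>) = of_real (c * k * (\<xi> \<bullet> rho_grad m \<xi>))"
proof -
  have zz: "z * cnj z = of_real (z \<bullet> z)" for z by (simp add: complex_norm_square[symmetric] dot_square_norm)
  have *: "(c *\<^sub>R z) * cnj (k *\<^sub>R (d *\<^sub>R z)) = of_real (c * k * (z \<bullet> (d *\<^sub>R z)))" for c k d :: real and z :: complex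
  proof -
    have "(c *\<^sub>R z) * cnj (k *\<^sub>R (d *\<^sub>R z)) = of_real (c * k * d) * (z * cnj z)"
      by (simp add: scaleR_conv_of_real mult_ac)
    then show ?thesis by (simp add: zz)
  qed
  show ?thesis unfolding hermitian_dot_def rho_grad_def inner_prod_def
    by (simp only: * fst_conv snd_conv fst_scaleR snd_scaleR of_real_add[symmetric] distrib_left)
qed

text \<open>The constants do not depend on \<xi>, so that one \<open>r0\<close> can serve the whole
  boundary. The first bound expresses that radii cross the boundary transversally, uniformly in the
  point.\<close>

lemma rho_grad_bounds:
  assumes "\<xi> \<in> frontier (egg m)"
  shows "\<xi> \<bullet> rho_grad m \<xi> \<ge> 2" "norm (rho_grad m \<xi>) \<ge> 1" "norm (rho_grad m \<xi>) \<le> 2 + 2 * real m"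
proof -
  note b = frontier_bounds[OF assms]
  have "2 * (cmod (fst \<xi>))\<^sup>2 + 2 * real m * cmod (snd \<xi>) ^ (2 * m) \<ge> 2 * (cmod (fst \<xi>))\<^sup>2 + 2 * 1 * cmod (snd \<xi>) ^ (2 * m)"
    using m by (intro add_left_mono mult_right_mono) auto
  then show 1: "\<xi> \<bullet> rho_grad m \<xi> \<ge> 2" unfolding inner_rho_grad using b(1) by simp
  have "\<xi> \<bullet> rho_grad m \<xi> \<le> norm \<xi> * norm (rho_grad m \<xi>)" by (rule norm_cauchy_schwarz)
  also have "\<dots> \<le> 2 * norm (rho_grad m \<xi>)" using b by (intro mult_right_mono) auto
  finally show "norm (rho_grad m \<xi>) \<ge> 1" using 1 by simp
  have w: "(snd \<xi> \<bullet> snd \<xi>) ^ (m - 1) * cmod (snd \<xi>) \<le> 1 * 1"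
    using b by (intro mult_mono power_le_one) (auto simp: dot_square_norm power_le_one)
  have "norm (rho_grad m \<xi>) \<le> norm (2 *\<^sub>R fst \<xi>) + norm ((2 * real m * (snd \<xi> \<bullet> snd \<xi>) ^ (m - 1)) *\<^sub>R snd \<xi>)"
    unfolding rho_grad_def by (rule norm_Pair_le)
  also have "\<dots> = 2 * cmod (fst \<xi>) + 2 * real m * ((snd \<xi> \<bullet> snd \<xi>) ^ (m - 1) * cmod (snd \<xi>))"
    by (simp add: abs_mult)
  also have "\<dots> \<le> 2 * 1 + 2 * real m * 1"
    using b w by (intro add_mono mult_left_mono) auto
  finally show "norm (rho_grad m \<xi>) \<le> 2 + 2 * real m" by simp
qed

lemma outward_normal_props:
  assumes "\<xi> \<in> frontier (egg m)"
  shows "norm (outward_normal m \<xi>) = 1" "outward_normal m \<xi> = (1 / norm (rho_grad m \<xi>)) *\<^sub>R rho_grad m \<xi>"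
proof -
  have "rho_grad m \<xi> \<noteq> 0" using rho_grad_bounds(2)[OF assms] by auto
  then show "norm (outward_normal m \<xi>) = 1" "outward_normal m \<xi> = (1 / norm (rho_grad m \<xi>)) *\<^sub>R rho_grad m \<xi>"
    by (auto simp: outward_normal_eq norm_sgn sgn_div_norm divide_inverse)
qed

end

lemma infdist_hyperplane:
  fixes \<nu> :: "'a::euclidean_space"
  assumes "norm \<nu> = 1"
  shows "infdist p {x. (x - \<xi>) \<bullet> \<nu> = 0} = \<bar>(p - \<xi>) \<bullet> \<nu>\<bar>"
proof (rule antisym)
  have n: "\<nu> \<bullet> \<nu> = 1" using assms by (simp add: dot_square_norm)
  let ?P = "{x. (x - \<xi>) \<bullet> \<nu> = 0}"
  define x where "x = p - ((p - \<xi>) \<bullet> \<nu>) *\<^sub>R \<nu>"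
  have "x \<in> ?P" by (simp add: x_def inner_diff_left n algebra_simps)
  then have "infdist p ?P \<le> dist p x" by (rule infdist_le)
  also have "\<dots> = \<bar>(p - \<xi>) \<bullet> \<nu>\<bar>" by (simp add: x_def dist_norm assms)
  finally show "infdist p ?P \<le> \<bar>(p - \<xi>) \<bullet> \<nu>\<bar>" .
  have "\<bar>(p - \<xi>) \<bullet> \<nu>\<bar> \<le> dist p y" if "y \<in> ?P" for y
  proof -
    have "(p - \<xi>) \<bullet> \<nu> = (p - y) \<bullet> \<nu>" using that by (simp add: inner_diff_left)
    also have "\<bar>\<dots>\<bar> \<le> norm (p - y) * norm \<nu>" by (rule Cauchy_Schwarz_ineq2)
    finally show ?thesis by (simp add: assms dist_norm)
  qed
  then show "\<bar>(p - \<xi>) \<bullet> \<nu>\<bar> \<le> infdist p ?P"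
    unfolding infdist_def using \<open>x \<in> ?P\<close> by (auto intro!: cINF_greatest)
qed

text \<open>A first-order Taylor expansion whose quadratic remainder is uniform in \<open>A\<close>
  and \<open>B\<close>; it will be applied to squared moduli. The Lipschitz bound from a first
  induction feeds the induction for the remainder.\<close>

lemma power_taylor_bound:
  fixes A B :: real
  assumes A: "0 \<le> A" "A \<le> 1" and B: "0 \<le> B" "B \<le> 1"
  shows "\<bar>B ^ n - A ^ n - real n * A ^ (n - 1) * (B - A)\<bar> \<le> (real n)\<^sup>2 * (B - A)\<^sup>2"
proof -
  have 1: "\<bar>B ^ n - A ^ n\<bar> \<le> real n * \<bar>B - A\<bar>" for n
  proof (induction n)
    case (Suc n)
    have "B ^ Suc n - A ^ Suc n = B * (B ^ n - A ^ n) + A ^ n * (B - A)" by (simp add: algebra_simps)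
    then have "\<bar>B ^ Suc n - A ^ Suc n\<bar> \<le> B * \<bar>B ^ n - A ^ n\<bar> + A ^ n * \<bar>B - A\<bar>"
      using A B abs_triangle_ineq[of "B * (B ^ n - A ^ n)" "A ^ n * (B - A)"] by (simp add: abs_mult)
    also have "\<dots> \<le> 1 * (real n * \<bar>B - A\<bar>) + 1 * \<bar>B - A\<bar>"
      using A B Suc by (intro add_mono mult_mono power_le_one) auto
    finally show ?case by (simp add: algebra_simps)
  qed simp
  show "\<bar>B ^ n - A ^ n - real n * A ^ (n - 1) * (B - A)\<bar> \<le> (real n)\<^sup>2 * (B - A)\<^sup>2"
  proof (induction n)
    case (Suc n)
    let ?E = "B ^ n - A ^ n - real n * A ^ (n - 1) * (B - A)"
    have "B ^ Suc n - A ^ Suc n - real (Suc n) * A ^ (Suc n - 1) * (B - A) = A * ?E + (B - A) * (B ^ n - A ^ n)"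
      by (cases n) (simp_all add: algebra_simps)
    then have "\<bar>B ^ Suc n - A ^ Suc n - real (Suc n) * A ^ (Suc n - 1) * (B - A)\<bar> \<le> A * \<bar>?E\<bar> + \<bar>B - A\<bar> * \<bar>B ^ n - A ^ n\<bar>"
      using A abs_triangle_ineq[of "A * ?E" "(B - A) * (B ^ n - A ^ n)"] by (simp add: abs_mult)
    also have "\<dots> \<le> 1 * ((real n)\<^sup>2 * (B - A)\<^sup>2) + \<bar>B - A\<bar> * (real n * \<bar>B - A\<bar>)"
      using A Suc 1 by (intro add_mono mult_mono) auto
    also have "\<dots> = ((real n)\<^sup>2 + real n) * (B - A)\<^sup>2"
    proof -
      have "\<bar>B - A\<bar> * (real n * \<bar>B - A\<bar>) = real n * (B - A)\<^sup>2"
        by (metis abs_mult_self_eq mult.left_commute power2_eq_square)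
      then show ?thesis by (simp only: distrib_right mult_1)
    qed
    also have "\<dots> \<le> (real (Suc n))\<^sup>2 * (B - A)\<^sup>2"
      by (intro mult_right_mono zero_le_power2) (simp add: power2_eq_square algebra_simps)
    finally show ?case .
  qed simp
qed

text \<open>Both points lie on one level set of rho, so Taylor's formula leaves the linear term and
  a quadratic remainder. Geometrically, the boundary bends inwards from its tangent plane by at most
  a quadratic amount. In the constant, 1 stems from the first coordinate, \<open>m\<close> from the
  square inside \<open>B - A\<close>, and \<open>4 m^2\<close> from the remainder of the
  power.\<close>

lemma rho_quadratic_bound:
  assumes m: "m \<ge> 1" and \<xi>: "\<xi> \<in> frontier (egg m)" and x: "x \<in> frontier (egg m)"
  shows "0 \<le> rho_grad m \<xi> \<bullet> (x - \<xi>) + (1 + real m + 4 * (real m)\<^sup>2) * (norm (x - \<xi>))\<^sup>2"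
proof -
  obtain z w where zw: "\<xi> = (z, w)" by (cases \<xi>)
  obtain z' w' where zw': "x = (z', w')" by (cases x)
  define A where "A = w \<bullet> w"
  define B where "B = w' \<bullet> w'"
  note b1 = frontier_bounds[OF m \<xi>] and b2 = frontier_bounds[OF m x]
  have A: "0 \<le> A" "A \<le> 1" and B: "0 \<le> B" "B \<le> 1"
    using b1 b2 by (auto simp: A_def B_def zw zw' dot_square_norm power_le_one)
  have 1: "z \<bullet> z + A ^ m = 1" "z' \<bullet> z' + B ^ m = 1"
    using b1(1) b2(1) by (auto simp: A_def B_def zw zw' dot_square_norm power_mult)
  let ?d = "w' - w"
  have BA: "B - A = 2 * (w \<bullet> ?d) + ?d \<bullet> ?d"
    by (simp add: A_def B_def inner_diff_left inner_diff_right inner_commute)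
  have zz: "z' \<bullet> z' - z \<bullet> z = 2 * (z \<bullet> (z' - z)) + (z' - z) \<bullet> (z' - z)"
    by (simp add: inner_diff_left inner_diff_right inner_commute)
  have "B - A = ?d \<bullet> (w' + w)" by (simp add: A_def B_def inner_diff_left inner_diff_right inner_add_right inner_commute)
  also have "\<bar>\<dots>\<bar> \<le> norm ?d * norm (w' + w)" by (rule Cauchy_Schwarz_ineq2)
  also have "\<dots> \<le> norm ?d * 2"
    using b1 b2 norm_triangle_ineq[of w' w] by (intro mult_left_mono) (auto simp: zw zw')
  finally have "(B - A)\<^sup>2 \<le> (norm ?d * 2)\<^sup>2" by (metis abs_le_square_iff abs_mult abs_norm_cancel abs_numeral)
  then have BA2: "(B - A)\<^sup>2 \<le> 4 * (?d \<bullet> ?d)" by (simp add: dot_square_norm power_mult_distrib)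
  have "B ^ m - A ^ m \<le> real m * A ^ (m - 1) * (B - A) + (real m)\<^sup>2 * (B - A)\<^sup>2"
    using power_taylor_bound[OF A B, of m] by linarith
  also have "\<dots> \<le> real m * A ^ (m - 1) * (2 * (w \<bullet> ?d)) + real m * (?d \<bullet> ?d) + (real m)\<^sup>2 * (4 * (?d \<bullet> ?d))"
  proof -
    have "real m * A ^ (m - 1) * (?d \<bullet> ?d) \<le> real m * 1 * (?d \<bullet> ?d)"
      using A by (intro mult_right_mono mult_left_mono power_le_one) auto
    moreover have "(real m)\<^sup>2 * (B - A)\<^sup>2 \<le> (real m)\<^sup>2 * (4 * (?d \<bullet> ?d))" using BA2 by (intro mult_left_mono) auto
    ultimately show ?thesis unfolding BA by (simp add: algebra_simps)
  qed
  finally have "0 \<le> 2 * (z \<bullet> (z' - z)) + (z' - z) \<bullet> (z' - z) + real m * A ^ (m - 1) * (2 * (w \<bullet> ?d)) + real m * (?d \<bullet> ?d) + (real m)\<^sup>2 * (4 * (?d \<bullet> ?d))"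
    using 1 zz by linarith
  also have "\<dots> = rho_grad m \<xi> \<bullet> (x - \<xi>) + (z' - z) \<bullet> (z' - z) + (real m + 4 * (real m)\<^sup>2) * (?d \<bullet> ?d)"
    by (simp add: rho_grad_def zw zw' A_def[symmetric] inner_prod_def algebra_simps)
  also have "\<dots> \<le> rho_grad m \<xi> \<bullet> (x - \<xi>) + (1 + real m + 4 * (real m)\<^sup>2) * ((z' - z) \<bullet> (z' - z) + ?d \<bullet> ?d)"
  proof -
    have "(z' - z) \<bullet> (z' - z) \<le> (1 + real m + 4 * (real m)\<^sup>2) * ((z' - z) \<bullet> (z' - z))"
      using mult_right_mono[of 1 "1 + real m + 4 * (real m)\<^sup>2" "(z' - z) \<bullet> (z' - z)"] by simp
    moreover have "(real m + 4 * (real m)\<^sup>2) * (?d \<bullet> ?d) \<le> (1 + real m + 4 * (real m)\<^sup>2) * (?d \<bullet> ?d)"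
      by (intro mult_right_mono) auto
    ultimately show ?thesis unfolding distrib_left by linarith
  qed
  finally show ?thesis by (simp add: zw zw' norm_Pair dot_square_norm)
qed

lemma boundary_delta_eq:
  assumes "m \<ge> 1" "\<xi> \<in> frontier (egg m)"
  shows "boundary_delta m \<xi> p = min (infdist p (frontier (egg m))) \<bar>(p - \<xi>) \<bullet> outward_normal m \<xi>\<bar>"
  unfolding boundary_delta_def tangent_plane_def
  by (subst infdist_hyperplane[OF outward_normal_props(1)[OF assms]]) simp

text \<open>The radius to a boundary point approaches it non-tangentially, although it need not be normal to
  the boundary: \<open>(\<xi> - r \<xi>) \<cdot> \<nu>\<close> is real because \<open>z \<partial>\<rho>/\<partial>z\<close> and \<open>w \<partial>\<rho>/\<partial>w\<close> are.\<close>

lemma radius_in_approach_region: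
  assumes m: "m \<ge> 1" and \<alpha>: "\<alpha> > 0"
  shows "\<exists>r0. 0 < r0 \<and> r0 < 1 \<and> (\<forall>r \<xi>. r0 < r \<longrightarrow> r < 1 \<longrightarrow> \<xi> \<in> frontier (egg m) \<longrightarrow> r *\<^sub>R \<xi> \<in> approach_region m \<alpha> \<xi>)"
proof -
  \<comment> \<open>\<open>C\<close> is the constant of \<open>rho_quadratic_bound\<close>. In
    \<open>K\<close>, 16 is the square of the 4 in \<open>norm (x - \<xi>) \<le> 4 * h\<close>, and
    \<open>1 + real m\<close> converts \<open>h\<close> into a multiple of \<open>D\<close>.
    \<open>N\<close> is so large that \<open>h * N < \<alpha>\<close> yields both inequalities of
    the approach region.\<close>
  define C where "C = 1 + real m + 4 * (real m)\<^sup>2"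
  define K where "K = 16 * C * (1 + real m)"
  have C: "C \<ge> 1" by (simp add: C_def)
  have K: "K \<ge> 1" using C mult_mono[of 1 "16 * C" 1 "1 + real m"] by (simp add: K_def)
  define N where "N = (1 + \<alpha>) * K + 4 * (1 + real m) + \<alpha> * K"
  have aK: "\<alpha> \<le> \<alpha> * K" using mult_left_mono[OF K, of \<alpha>] \<alpha> by simp
  have N: "N > \<alpha>" "(1 + \<alpha>) * K \<le> N" "4 * (1 + real m) + \<alpha> * K \<le> N" "N > 0"
  proof -
    have e: "(1 + \<alpha>) * K = K + \<alpha> * K" "4 * (1 + real m) = 4 + 4 * real m" by (simp_all add: algebra_simps)
    show "N > \<alpha>" "(1 + \<alpha>) * K \<le> N" "4 * (1 + real m) + \<alpha> * K \<le> N" "N > 0"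
      unfolding N_def e using aK \<alpha> K of_nat_0_le_iff[of m] by linarith+
  qed
  show ?thesis
  proof (intro exI[of _ "1 - \<alpha> / N"] conjI allI impI)
    show "0 < 1 - \<alpha> / N" "1 - \<alpha> / N < 1" using N \<alpha> by (auto simp: field_simps)
    fix r :: real and \<xi> :: C2
    assume r: "1 - \<alpha> / N < r" "r < 1" and \<xi>: "\<xi> \<in> frontier (egg m)"
    define h where "h = 1 - r"
    have h: "0 < h" "h < \<alpha> / N" using r by (auto simp: h_def)
    have hN: "h * N < \<alpha>" using h N by (simp add: pos_less_divide_eq)
    have "\<alpha> / N < 1" using N \<alpha> by (simp add: pos_divide_less_eq)
    then have r0: "0 \<le> r" using r by linarith
    let ?\<nu> = "outward_normal m \<xi>" and ?g = "rho_grad m \<xi>" and ?M = "frontier (egg m)" and ?p = "r *\<^sub>R \<xi>"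
    note b = frontier_bounds[OF m \<xi>] and gb = rho_grad_bounds[OF m \<xi>] and \<nu> = outward_normal_props[OF m \<xi>]
    \<comment> \<open>The distance from \<open>?p\<close> to the tangent plane at \<xi>;
      \<open>?p\<close> lies on the inner side of that plane.\<close>
    define D where "D = h * ((\<xi> \<bullet> ?g) / norm ?g)"
    have diff: "\<xi> - ?p = h *\<^sub>R \<xi>" by (simp add: h_def algebra_simps)
    have Dn: "(\<xi> - ?p) \<bullet> ?\<nu> = D" unfolding diff \<nu>(2) by (simp add: D_def)
    have hd: "hermitian_dot (\<xi> - ?p) ?\<nu> = of_real D"
      unfolding diff \<nu>(2) hermitian_dot_rho_grad[OF m] by (simp add: D_def)
    have Dlow: "h / (1 + real m) \<le> D"
    proof -
      have "2 / (2 + 2 * real m) \<le> (\<xi> \<bullet> ?g) / norm ?g" using gb by (intro frac_le) auto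
      moreover have "2 / (2 + 2 * real m) = 1 / (1 + real m)" by (simp add: field_simps)
      ultimately have "1 / (1 + real m) \<le> (\<xi> \<bullet> ?g) / norm ?g" by simp
      then show ?thesis unfolding D_def using mult_left_mono[of _ _ h] h by fastforce
    qed
    have D0: "D > 0" using Dlow h by (smt (verit) divide_pos_pos of_nat_0_le_iff)
    have Dup: "D \<le> 2 * h"
    proof -
      have "D = h * (\<xi> \<bullet> ?\<nu>)" using Dn unfolding diff by simp
      also have "\<xi> \<bullet> ?\<nu> \<le> norm \<xi> * norm ?\<nu>" by (rule norm_cauchy_schwarz)
      then have "h * (\<xi> \<bullet> ?\<nu>) \<le> h * 2" using h b \<nu> by (intro mult_left_mono) auto
      finally show ?thesis by simp
    qed
    \<comment> \<open>A boundary point closer to \<open>?p\<close> than \<open>D\<close> lies within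
      \<open>4 * h\<close> of \<xi> and hence almost in the tangent plane, which is at distance
      \<open>D\<close>. So the boundary is no closer than \<open>D\<close> reduced by a factor that
      tends to 1 with \<open>h\<close>.\<close>
    have low: "D * (1 - K * h) \<le> dist ?p x" if x: "x \<in> ?M" for x
    proof (cases "D \<le> dist ?p x")
      case True
      moreover have "D * (1 - K * h) \<le> D * 1" using D0 K h by (intro mult_left_mono) auto
      ultimately show ?thesis by linarith
    next
      case False
      have "norm (x - \<xi>) \<le> norm (x - ?p) + norm (?p - \<xi>)" using norm_triangle_ineq[of "x - ?p" "?p - \<xi>"] by simp
      also have "norm (?p - \<xi>) = h * norm \<xi>" using diff h by (metis norm_minus_commute norm_scaleR abs_of_pos)
      also have "norm (x - ?p) + h * norm \<xi> \<le> 2 * h + h * 2"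
        using False Dup b h by (intro add_mono mult_left_mono) (auto simp: dist_norm norm_minus_commute)
      finally have xx: "norm (x - \<xi>) \<le> 4 * h" by simp
      have "0 \<le> ?g \<bullet> (x - \<xi>) + C * (norm (x - \<xi>))\<^sup>2" unfolding C_def by (rule rho_quadratic_bound[OF m \<xi> x])
      also have "\<dots> \<le> ?g \<bullet> (x - \<xi>) + C * (4 * h)\<^sup>2"
        using xx C by (intro add_left_mono mult_left_mono power_mono) auto
      finally have g1: "?g \<bullet> (\<xi> - x) \<le> C * (4 * h)\<^sup>2" by (simp add: inner_diff_right)
      have "?\<nu> \<bullet> (\<xi> - x) = (?g \<bullet> (\<xi> - x)) / norm ?g" unfolding \<nu>(2) by simp
      also have "\<dots> \<le> (C * (4 * h)\<^sup>2) / norm ?g" using g1 gb by (intro divide_right_mono) auto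
      also have "\<dots> \<le> (C * (4 * h)\<^sup>2) / 1" using gb C by (intro divide_left_mono mult_nonneg_nonneg) auto
      finally have n1: "?\<nu> \<bullet> (\<xi> - x) \<le> 16 * C * h * h" by (simp add: power2_eq_square mult_ac)
      have "D = ?\<nu> \<bullet> (\<xi> - x) + ?\<nu> \<bullet> (x - ?p)" unfolding Dn[symmetric] by (simp add: inner_diff_right inner_diff_left inner_commute)
      also have "?\<nu> \<bullet> (x - ?p) \<le> norm ?\<nu> * norm (x - ?p)" by (rule norm_cauchy_schwarz)
      finally have "D - 16 * C * h * h \<le> dist ?p x" using n1 \<nu>(1) by (simp add: dist_norm norm_minus_commute)
      moreover have "16 * C * h * h \<le> D * (K * h)"
      proof -
        have "16 * C * h * h = (h / (1 + real m)) * (K * h)" by (simp add: K_def field_simps)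
        also have "\<dots> \<le> D * (K * h)" using Dlow K h by (intro mult_right_mono) auto
        finally show ?thesis .
      qed
      ultimately show ?thesis by (simp add: algebra_simps)
    qed
    have "D * (1 - K * h) \<le> infdist ?p ?M"
      unfolding infdist_def using \<xi> low by (auto intro!: cINF_greatest)
    moreover have "\<bar>(?p - \<xi>) \<bullet> ?\<nu>\<bar> = D" using Dn D0 by (metis abs_minus_commute abs_of_pos inner_diff_left)
    moreover have "D * (1 - K * h) \<le> D * 1" using D0 K h by (intro mult_left_mono) auto
    ultimately have bd: "D * (1 - K * h) \<le> boundary_delta m \<xi> ?p"
      unfolding boundary_delta_eq[OF m \<xi>] by simp
    have h1: "h * ((1 + \<alpha>) * K) < \<alpha>" "h * (4 * (1 + real m) + \<alpha> * K) < \<alpha>"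
      using hN N mult_left_mono[of _ N h] h by (smt (verit))+
    show "?p \<in> approach_region m \<alpha> \<xi>"
      unfolding approach_region_def mem_Collect_eq
    proof (intro conjI)
      show "?p \<in> egg m"
        by (rule dilate_mem_egg[OF m r0 r(2) subsetD[OF frontier_subset_closed_egg[OF m] \<xi>]])
      have "1 < (1 + \<alpha>) * (1 - K * h)" using h1(1) by (simp add: algebra_simps)
      then have "D * 1 < D * ((1 + \<alpha>) * (1 - K * h))" using D0 by (intro mult_strict_left_mono)
      also have "\<dots> = (1 + \<alpha>) * (D * (1 - K * h))" by simp
      also have "\<dots> \<le> (1 + \<alpha>) * boundary_delta m \<xi> ?p" using bd \<alpha> by (intro mult_left_mono) auto
      finally show "cmod (hermitian_dot (\<xi> - ?p) ?\<nu>) < (1 + \<alpha>) * boundary_delta m \<xi> ?p"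
        unfolding hd using D0 by simp
      have "(norm (\<xi> - ?p))\<^sup>2 = h\<^sup>2 * (norm \<xi>)\<^sup>2" unfolding diff by (simp add: power_mult_distrib)
      also have "\<dots> \<le> h\<^sup>2 * 2\<^sup>2" using b by (intro mult_left_mono power_mono) auto
      also have "\<dots> = h * (h / (1 + real m)) * (4 * (1 + real m))" by (simp add: power2_eq_square field_simps)
      also have "\<dots> \<le> h * D * (4 * (1 + real m))" using Dlow h by (intro mult_right_mono mult_left_mono) auto
      also have "\<dots> = D * (h * (4 * (1 + real m)))" by simp
      also have "\<dots> < D * (\<alpha> * (1 - K * h))" using h1(2) D0 by (intro mult_strict_left_mono) (auto simp: algebra_simps)
      also have "\<dots> = \<alpha> * (D * (1 - K * h))" by simp
      also have "\<dots> \<le> \<alpha> * boundary_delta m \<xi> ?p" using bd \<alpha> by (intro mult_left_mono) auto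
      finally show "(norm (\<xi> - ?p))\<^sup>2 < \<alpha> * boundary_delta m \<xi> ?p" .
    qed
  qed
qed

text \<open>For fixed \<open>p\<close> the boundary points whose approach region contains
  \<open>p\<close> form a relatively open set. Superlevel sets are unions of these, so the maximal
  function of an arbitrary \<open>f\<close> is lower semicontinuous on the boundary.\<close>

lemma nt_maximal_measurable:
  assumes m: "m \<ge> 1"
  shows "(\<lambda>\<xi>. nt_maximal m \<alpha> f \<xi> * indicator (frontier (egg m)) \<xi>) \<in> borel_measurable borel"
proof (rule borel_measurableI_greater)
  fix y :: ennreal
  let ?M = "frontier (egg m)"
  have cn: "continuous_on ?M (outward_normal m)"
    unfolding outward_normal_eq[abs_def]
  proof (intro continuous_on_sgn)
    show "continuous_on ?M (rho_grad m)" unfolding rho_grad_def[abs_def] by (intro continuous_intros)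
    show "\<forall>x\<in>?M. rho_grad m x \<noteq> 0" using rho_grad_bounds(2)[OF m] by fastforce
  qed
  have ch: "continuous_on ?M (\<lambda>\<xi>. hermitian_dot (\<xi> - p) (outward_normal m \<xi>))" for p
    unfolding hermitian_dot_def by (intro continuous_intros cn)
  have cd: "continuous_on ?M (\<lambda>\<xi>. boundary_delta m \<xi> p)" for p
  proof -
    have "continuous_on ?M (\<lambda>\<xi>. min (infdist p ?M) \<bar>(p - \<xi>) \<bullet> outward_normal m \<xi>\<bar>)"
      by (intro continuous_intros cn)
    then show ?thesis by (rule continuous_on_eq) (simp add: boundary_delta_eq[OF m])
  qed
  define T where "T p = {\<xi> \<in> ?M. p \<in> approach_region m \<alpha> \<xi>}" for p
  have oT: "openin (top_of_set ?M) (T p)" for p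
  proof (cases "p \<in> egg m")
    case True
    let ?g = "\<lambda>\<xi>. ((1 + \<alpha>) * boundary_delta m \<xi> p - cmod (hermitian_dot (\<xi> - p) (outward_normal m \<xi>)),
       \<alpha> * boundary_delta m \<xi> p - (norm (\<xi> - p))\<^sup>2)"
    have "continuous_on ?M ?g" by (intro continuous_intros ch cd)
    moreover have "open ({0::real<..} \<times> {0::real<..})" by (intro open_Times) auto
    ultimately have "openin (top_of_set ?M) (?M \<inter> ?g -` ({0<..} \<times> {0<..}))"
      by (rule continuous_openin_preimage_gen)
    also have "?M \<inter> ?g -` ({0<..} \<times> {0<..}) = T p"
      using True by (auto simp: T_def approach_region_def)
    finally show ?thesis .
  next
    case False
    then have "T p = {}" by (auto simp: T_def approach_region_def)
    then show ?thesis by simp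
  qed
  have "{\<xi> \<in> space borel. y < nt_maximal m \<alpha> f \<xi> * indicator ?M \<xi>} = \<Union>(T ` {p. y < ennreal (cmod (f p))})"
  proof (rule set_eqI)
    fix \<xi> :: C2
    show "\<xi> \<in> {\<xi> \<in> space borel. y < nt_maximal m \<alpha> f \<xi> * indicator ?M \<xi>} \<longleftrightarrow> \<xi> \<in> \<Union>(T ` {p. y < ennreal (cmod (f p))})"
    proof (cases "\<xi> \<in> ?M")
      case True
      then show ?thesis by (simp add: T_def nt_maximal_def less_SUP_iff del: split_paired_Ex) blast
    qed (simp add: T_def)
  qed
  moreover have "openin (top_of_set ?M) (\<Union>(T ` {p. y < ennreal (cmod (f p))}))"
    using oT by (intro openin_Union) auto
  then obtain W where "open W" "\<Union>(T ` {p. y < ennreal (cmod (f p))}) = ?M \<inter> W" unfolding openin_open by blast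
  ultimately show "{\<xi> \<in> space borel. y < nt_maximal m \<alpha> f \<xi> * indicator ?M \<xi>} \<in> sets borel"
    by (simp add: borel_closed borel_open sets.Int)
qed

section \<open>The kernel\<close>

definition fs_kernel :: "nat \<Rightarrow> C2 \<Rightarrow> C2 \<Rightarrow> complex" where
  "fs_kernel m \<zeta> \<eta> =
     (let A = 1 - fst \<zeta> * cnj (fst \<eta>); x = snd \<zeta> * cnj (snd \<eta>) in
        complex_of_real (root 3 (real m) / (2 * pi\<^sup>2)) *
        ((of_nat m + 2) * A powr (1 / of_nat m) + (1 - of_nat m) * x) /
        (3 * of_nat m * A powr ((4 * of_nat m - 1) / (3 * of_nat m)) * (A powr (1 / of_nat m) - x)\<^sup>2))"

lemma powr_inverse_nat_power:
  fixes A :: complex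
  assumes "m \<ge> 1" "A \<noteq> 0"
  shows "(A powr (1 / of_nat m)) ^ m = A"
proof -
  have "(A powr (1 / of_nat m)) ^ m = exp (1 / of_nat m * Ln A) ^ m"
    using assms by (simp add: powr_def)
  also have "\<dots> = exp (of_nat m * (1 / of_nat m * Ln A))" by (rule exp_of_nat_mult[symmetric])
  also have "of_nat m * (1 / of_nat m * Ln A) = Ln A" using assms by simp
  finally show ?thesis using assms by simp
qed

text \<open>For \<open>w2\<close> nonzero, \<open>|w1 w2|^(2m) < (1 - |z1|^2) (1 - |z2|^2) \<le> (1
  - |z1 z2|)^2 \<le> |A|^2\<close>; the middle step is \<open>(|z1| - |z2|)^2 \<ge> 0\<close>. One
  of the points may lie on the boundary, which lets the kernel extend continuously.\<close>

lemma egg_kernel_denominators: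
  assumes m: "m \<ge> 1" and \<zeta>: "\<zeta> \<in> egg m" and \<eta>: "\<eta> \<in> closed_egg m"
  defines "A \<equiv> 1 - fst \<zeta> * cnj (fst \<eta>)"
  shows "cmod (fst \<zeta>) < 1" "cmod (fst \<zeta> * cnj (fst \<eta>)) < 1" "Re A > 0"
    "cmod (snd \<zeta> * cnj (snd \<eta>)) < cmod (A powr (1 / of_nat m))"
    "A \<noteq> 0" "A \<notin> \<real>\<^sub>\<le>\<^sub>0" "A powr (1 / of_nat m) - snd \<zeta> * cnj (snd \<eta>) \<noteq> 0"
proof -
  define a where "a = cmod (fst \<zeta>)"
  define b where "b = cmod (fst \<eta>)"
  have z: "a\<^sup>2 + cmod (snd \<zeta>) ^ (2 * m) < 1" using \<zeta> by (auto simp: egg_def a_def)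
  have e: "b\<^sup>2 + cmod (snd \<eta>) ^ (2 * m) \<le> 1" using \<eta> by (auto simp: closed_egg_def b_def)
  have b1: "0 \<le> b" "b \<le> 1" using closed_egg_bounds[OF m \<eta>] by (auto simp: b_def)
  have "a\<^sup>2 < 1" using z zero_le_power[OF norm_ge_zero, of "snd \<zeta>" "2 * m"] by linarith
  then have a1: "0 \<le> a" "a < 1" by (auto simp: a_def abs_square_less_1)
  then show "cmod (fst \<zeta>) < 1" by (simp add: a_def)
  have ab: "cmod (fst \<zeta> * cnj (fst \<eta>)) = a * b" by (simp add: norm_mult a_def b_def)
  have "a * b \<le> a * 1" using a1 b1 by (intro mult_left_mono)
  then have ab1: "a * b < 1" using a1 by linarith
  then show l: "cmod (fst \<zeta> * cnj (fst \<eta>)) < 1" by (simp add: ab)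
  have "Re (fst \<zeta> * cnj (fst \<eta>)) < 1" using complex_Re_le_cmod l by (rule le_less_trans)
  then show Re: "Re A > 0" by (simp add: A_def)
  then show A0: "A \<noteq> 0" by auto
  show "A \<notin> \<real>\<^sub>\<le>\<^sub>0" using Re by (auto simp: complex_nonpos_Reals_iff)
  have cA: "1 - a * b \<le> cmod A" using norm_triangle_ineq2[of 1 "fst \<zeta> * cnj (fst \<eta>)"] by (simp add: A_def ab)
  have "(cmod (snd \<zeta> * cnj (snd \<eta>)) ^ m)\<^sup>2 = cmod (snd \<zeta>) ^ (2 * m) * cmod (snd \<eta>) ^ (2 * m)"
    by (simp add: norm_mult power_mult_distrib power_mult[symmetric] mult.commute)
  also have "\<dots> < (cmod A)\<^sup>2"
  \<comment> \<open>Strictness comes from \<zeta> alone, since \<eta> may be a boundary point; it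
    survives multiplication by \<open>cmod (snd \<eta>) ^ (2 * m)\<close> only if this is
    positive.\<close>
  proof (cases "snd \<eta> = 0")
    case True
    then show ?thesis using A0 m by (simp add: power_0_left)
  next
    case False
    then have "cmod (snd \<zeta>) ^ (2 * m) * cmod (snd \<eta>) ^ (2 * m) < (1 - a\<^sup>2) * cmod (snd \<eta>) ^ (2 * m)"
      using z by (intro mult_strict_right_mono) auto
    also have "\<dots> \<le> (1 - a\<^sup>2) * (1 - b\<^sup>2)"
      using e \<open>a\<^sup>2 < 1\<close> by (intro mult_left_mono) auto
    also have "\<dots> \<le> (1 - a * b)\<^sup>2"
      using zero_le_power2[of "a - b"] by (simp add: power2_eq_square algebra_simps)
    also have "\<dots> \<le> (cmod A)\<^sup>2" using cA ab1 by (intro power_mono) auto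
    finally show ?thesis .
  qed
  finally have "cmod (snd \<zeta> * cnj (snd \<eta>)) ^ m < cmod A" by (simp add: power_less_imp_less_base)
  also have "cmod A = cmod (A powr (1 / of_nat m)) ^ m"
    unfolding norm_power[symmetric] powr_inverse_nat_power[OF m A0] ..
  finally show 4: "cmod (snd \<zeta> * cnj (snd \<eta>)) < cmod (A powr (1 / of_nat m))"
    by (rule power_less_imp_less_base) simp
  then show "A powr (1 / of_nat m) - snd \<zeta> * cnj (snd \<eta>) \<noteq> 0" by auto
qed

text \<open>Principal powers with real exponents commute with conjugation on the right half plane,
  so the kernel is Hermitian.\<close>

lemma cnj_fs_kernel:
  assumes m: "m \<ge> 1" and \<zeta>: "\<zeta> \<in> egg m" and \<eta>: "\<eta> \<in> closed_egg m"
  shows "cnj (fs_kernel m \<zeta> \<eta>) = fs_kernel m \<eta> \<zeta>"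
proof -
  have n: "Re (1 - fst \<zeta> * cnj (fst \<eta>)) \<ge> 0" using egg_kernel_denominators(3)[OF assms] by simp
  have c: "cnj (1 - fst \<zeta> * cnj (fst \<eta>)) = 1 - fst \<eta> * cnj (fst \<zeta>)" by (simp add: mult.commute)
  have "cnj ((1 - fst \<zeta> * cnj (fst \<eta>)) powr c) = (1 - fst \<eta> * cnj (fst \<zeta>)) powr cnj c" for c
    unfolding c[symmetric] by (rule cnj_powr) (use n in blast)
  then show ?thesis by (simp add: fs_kernel_def Let_def mult.commute)
qed

text \<open>With \<zeta> inside the egg, continuity in the other point reaches the boundary. The
  kernel is therefore bounded and provides its own boundary values.\<close>

lemma continuous_on_fs_kernel:
  assumes m: "m \<ge> 1" and \<zeta>: "\<zeta> \<in> egg m"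
  shows "continuous_on (closed_egg m) (fs_kernel m \<zeta>)"
proof -
  have "continuous_on (closed_egg m) (\<lambda>\<eta>. (1 - fst \<zeta> * cnj (fst \<eta>)) powr c)" for c
  proof (rule continuous_on_eq)
    show "continuous_on (closed_egg m) (\<lambda>\<eta>. exp (c * Ln (1 - fst \<zeta> * cnj (fst \<eta>))))"
      using egg_kernel_denominators(6)[OF m \<zeta>] by (intro continuous_intros) blast
    show "exp (c * Ln (1 - fst \<zeta> * cnj (fst \<eta>))) = (1 - fst \<zeta> * cnj (fst \<eta>)) powr c" if "\<eta> \<in> closed_egg m" for \<eta>
      using egg_kernel_denominators(5)[OF m \<zeta> that] by (simp add: powr_def)
  qed
  note P = this
  show ?thesis unfolding fs_kernel_def[abs_def] Let_def
  proof (rule continuous_on_divide)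
    show "\<forall>\<eta>\<in>closed_egg m. 3 * of_nat m * (1 - fst \<zeta> * cnj (fst \<eta>)) powr ((4 * of_nat m - 1) / (3 * of_nat m)) *
        ((1 - fst \<zeta> * cnj (fst \<eta>)) powr (1 / of_nat m) - snd \<zeta> * cnj (snd \<eta>))\<^sup>2 \<noteq> 0"
    proof
      fix \<eta> assume "\<eta> \<in> closed_egg m"
      note d = egg_kernel_denominators(5,7)[OF m \<zeta> this]
      show "3 * of_nat m * (1 - fst \<zeta> * cnj (fst \<eta>)) powr ((4 * of_nat m - 1) / (3 * of_nat m)) *
        ((1 - fst \<zeta> * cnj (fst \<eta>)) powr (1 / of_nat m) - snd \<zeta> * cnj (snd \<eta>))\<^sup>2 \<noteq> 0"
        using d m by (simp only: mult_eq_0_iff power_eq_0_iff powr_eq_0_iff of_nat_eq_0_iff zero_neq_numeral[symmetric]) auto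
    qed
  qed (intro continuous_on_mult continuous_on_add continuous_on_diff continuous_on_power continuous_on_const P
      continuous_on_cnj continuous_on_snd continuous_on_id)+
qed

section \<open>Holomorphy of the conjugated kernel\<close>

definition holomorphic2_at :: "(C2 \<Rightarrow> complex) \<Rightarrow> C2 \<Rightarrow> bool" where
  "holomorphic2_at f p \<longleftrightarrow> (\<exists>a b. (f has_derivative (\<lambda>h. a * fst h + b * snd h)) (at p))"

lemma holomorphic2_atI:
  assumes "(f has_derivative f') (at p)" "\<And>h. f' h = a * fst h + b * snd h"
  shows "holomorphic2_at f p"
proof -
  have "f' = (\<lambda>h. a * fst h + b * snd h)" using assms(2) by (rule ext)
  then show ?thesis using assms(1) unfolding holomorphic2_at_def by blast
qed

lemma holomorphic2_at_const: "holomorphic2_at (\<lambda>_. c) p"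
  by (rule holomorphic2_atI[of _ "\<lambda>_. 0" _ 0 0]) auto

lemma holomorphic2_at_fst: "holomorphic2_at (\<lambda>p. fst p) p"
  by (rule holomorphic2_atI[of _ "\<lambda>h. fst h" _ 1 0]) (auto intro!: derivative_eq_intros)

lemma holomorphic2_at_snd: "holomorphic2_at (\<lambda>p. snd p) p"
  by (rule holomorphic2_atI[of _ "\<lambda>h. snd h" _ 0 1]) (auto intro!: derivative_eq_intros)

lemma holomorphic2_at_add:
  assumes "holomorphic2_at f p" "holomorphic2_at g p"
  shows "holomorphic2_at (\<lambda>p. f p + g p) p"
proof -
  obtain a b c d where "(f has_derivative (\<lambda>h. a * fst h + b * snd h)) (at p)" "(g has_derivative (\<lambda>h. c * fst h + d * snd h)) (at p)"
    using assms unfolding holomorphic2_at_def by blast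
  from has_derivative_add[OF this] show ?thesis
    by (rule holomorphic2_atI[of _ _ _ "a + c" "b + d"]) (simp add: algebra_simps)
qed

lemma holomorphic2_at_mult:
  assumes "holomorphic2_at f p" "holomorphic2_at g p"
  shows "holomorphic2_at (\<lambda>p. f p * g p) p"
proof -
  obtain a b c d where "(f has_derivative (\<lambda>h. a * fst h + b * snd h)) (at p)" "(g has_derivative (\<lambda>h. c * fst h + d * snd h)) (at p)"
    using assms unfolding holomorphic2_at_def by blast
  from has_derivative_mult[OF this] show ?thesis
    by (rule holomorphic2_atI[of _ _ _ "f p * c + a * g p" "f p * d + b * g p"]) (simp add: algebra_simps)
qed

lemma holomorphic2_at_compose:
  assumes "holomorphic2_at f p" "(g has_field_derivative g') (at (f p))"
  shows "holomorphic2_at (\<lambda>p. g (f p)) p"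
proof -
  obtain a b where "(f has_derivative (\<lambda>h. a * fst h + b * snd h)) (at p)"
    using assms unfolding holomorphic2_at_def by blast
  from has_derivative_compose[OF this assms(2)[unfolded has_field_derivative_def]] show ?thesis
    by (rule holomorphic2_atI[of _ _ _ "g' * a" "g' * b"]) (simp add: algebra_simps)
qed

text \<open>By Hermitian symmetry the function is \<open>fs_kernel m \<eta> \<zeta>\<close>, in
  which \<eta> enters without conjugation.\<close>

lemma holomorphic2_fs_kernel:
  assumes m: "m \<ge> 1" and \<zeta>: "\<zeta> \<in> egg m"
  shows "holomorphic2_on (\<lambda>\<eta>. cnj (fs_kernel m \<zeta> \<eta>)) (egg m)"
  unfolding holomorphic2_on_def
proof
  fix p assume p: "p \<in> egg m"
  have p': "\<zeta> \<in> closed_egg m" using \<zeta> egg_subset_closed_egg by blast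
  note d = egg_kernel_denominators[OF m p p']
  let ?A = "\<lambda>\<eta>. 1 - fst \<eta> * cnj (fst \<zeta>)" and ?x = "\<lambda>\<eta>. snd \<eta> * cnj (snd \<zeta>)"
  have A: "holomorphic2_at ?A p"
    using holomorphic2_at_add[OF holomorphic2_at_const[of 1] holomorphic2_at_mult[OF holomorphic2_at_fst holomorphic2_at_const[of "- cnj (fst \<zeta>)"]]]
    by simp
  have P: "holomorphic2_at (\<lambda>\<eta>. ?A \<eta> powr c) p" for c
    by (rule holomorphic2_at_compose[OF A, where g = "\<lambda>z. z powr c", OF has_field_derivative_powr[OF d(6)]])
  have x: "holomorphic2_at ?x p" by (intro holomorphic2_at_mult holomorphic2_at_snd holomorphic2_at_const)
  define den where "den = (\<lambda>\<eta>. 3 * of_nat m * ?A \<eta> powr ((4 * of_nat m - 1) / (3 * of_nat m)) *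
     ((?A \<eta> powr (1 / of_nat m) + (- 1) * ?x \<eta>) * (?A \<eta> powr (1 / of_nat m) + (- 1) * ?x \<eta>)))"
  have den1: "holomorphic2_at den p"
    unfolding den_def by (intro holomorphic2_at_mult[OF _ holomorphic2_at_mult] holomorphic2_at_mult[OF holomorphic2_at_const P]
      holomorphic2_at_add P holomorphic2_at_mult[OF holomorphic2_at_const x])
  have den2: "den p \<noteq> 0"
    unfolding den_def using d(5,7) m by simp
  note den = den1 den2
  have inv: "holomorphic2_at (\<lambda>\<eta>. inverse (den \<eta>)) p"
    by (rule holomorphic2_at_compose[OF den(1) DERIV_inverse[OF den(2)]])
  have "holomorphic2_at (\<lambda>\<eta>. complex_of_real (root 3 (real m) / (2 * pi\<^sup>2)) *
        ((of_nat m + 2) * ?A \<eta> powr (1 / of_nat m) + (1 - of_nat m) * ?x \<eta>) * inverse (den \<eta>)) p"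
    by (intro holomorphic2_at_mult holomorphic2_at_add holomorphic2_at_const P x inv)
  also have "(\<lambda>\<eta>. complex_of_real (root 3 (real m) / (2 * pi\<^sup>2)) *
        ((of_nat m + 2) * ?A \<eta> powr (1 / of_nat m) + (1 - of_nat m) * ?x \<eta>) * inverse (den \<eta>)) = (\<lambda>\<eta>. fs_kernel m \<eta> \<zeta>)"
    by (simp only: fs_kernel_def Let_def den_def divide_inverse[symmetric] power2_eq_square mult_minus1 add_uminus_conv_diff)
  finally obtain a b where "((\<lambda>\<eta>. fs_kernel m \<eta> \<zeta>) has_derivative (\<lambda>h. a * fst h + b * snd h)) (at p)"
    unfolding holomorphic2_at_def by blast
  then have "((\<lambda>\<eta>. cnj (fs_kernel m \<zeta> \<eta>)) has_derivative (\<lambda>h. a * fst h + b * snd h)) (at p)"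
    by (rule has_derivative_transform_within_open[OF _ open_egg p])
      (metis cnj_fs_kernel[OF m \<zeta>] egg_subset_closed_egg subsetD)
  then show "\<exists>a b. ((\<lambda>\<eta>. cnj (fs_kernel m \<zeta> \<eta>)) has_derivative (\<lambda>h. a * fst h + b * snd h)) (at p)" by blast
qed

text \<open>The open interval agrees with \<open>cube\<close>, so that Fubini produces circle means
  literally.\<close>

definition circle_mean :: "(real \<Rightarrow> complex) \<Rightarrow> complex" where
  "circle_mean f = (\<integral>v. indicator {0<..<1} v *\<^sub>R f v \<partial>lborel)"

lemma circle_mean_character:
  "circle_mean (\<lambda>v. cnj (cis (2 * pi * v)) ^ n * cis (2 * pi * v) ^ b) = (if n = b then 1 else 0)"
proof -
  define k where "k = real b - real n"
  have e: "cnj (cis (2 * pi * v)) ^ n * cis (2 * pi * v) ^ b = cis (2 * pi * k * v)" for v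
    unfolding cis_cnj Complex.DeMoivre cis_mult k_def by (rule arg_cong[where f = cis]) (simp add: algebra_simps)
  have "((\<lambda>v. cis (2 * pi * k * v)) has_integral (if n = b then 1 else 0)) {0..1}"
  proof (cases "n = b")
    case True
    then show ?thesis using has_integral_const_real[of "1::complex" 0 1] by (simp add: k_def)
  next
    case False
    then have k: "k \<noteq> 0" by (simp add: k_def)
    have "((\<lambda>v. cis (2 * pi * k * v)) has_integral (cis (2 * pi * k * 1) / (\<i> * (2 * pi * k)) - cis (2 * pi * k * 0) / (\<i> * (2 * pi * k)))) {0..1}"
    proof (rule fundamental_theorem_of_calculus)
      fix x :: real
      have "((\<lambda>z. exp (\<i> * (2 * pi * k) * z) / (\<i> * (2 * pi * k))) has_field_derivative exp (\<i> * (2 * pi * k) * of_real x)) (at (of_real x))"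
        using k by (auto intro!: derivative_eq_intros)
      then have "((\<lambda>x. exp (\<i> * (2 * pi * k) * of_real x) / (\<i> * (2 * pi * k))) has_vector_derivative exp (\<i> * (2 * pi * k) * of_real x)) (at x within {0..1})"
        by (rule has_vector_derivative_real_field[THEN has_vector_derivative_at_within])
      then show "((\<lambda>v. cis (2 * pi * k * v) / (\<i> * (2 * pi * k))) has_vector_derivative cis (2 * pi * k * x)) (at x within {0..1})"
        by (simp add: cis_conv_exp mult_ac)
    qed simp
    moreover have "cis (2 * pi * k) = 1"
    proof -
      have "cis (2 * pi * k) = cis (2 * pi * of_int (int b - int n))" by (simp add: k_def)
      also have "\<dots> = 1" by (rule cis_multiple_2pi) simp
      finally show ?thesis .
    qed
    ultimately show ?thesis using False by simp
  qed
  moreover have "set_integrable lborel {0..1} (\<lambda>v. cis (2 * pi * k * v))"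
    unfolding cis_conv_exp by (intro borel_integrable_atLeastAtMost' continuous_intros)
  ultimately have "(\<integral>v. indicator {0..1} v *\<^sub>R cis (2 * pi * k * v) \<partial>lborel) = (if n = b then 1 else 0)"
    using set_borel_integral_eq_integral(2)[of "{0..1}" "\<lambda>v. cis (2 * pi * k * v)"]
    by (simp add: set_lebesgue_integral_def integral_unique)
  moreover have "circle_mean (\<lambda>v. cis (2 * pi * k * v)) = (\<integral>v. indicator {0..1} v *\<^sub>R cis (2 * pi * k * v) \<partial>lborel)"
    unfolding circle_mean_def
  proof (rule integral_cong_AE)
    have "AE v in lborel. v \<noteq> (0::real) \<and> v \<noteq> 1"
      using AE_lborel_singleton[of "0::real"] AE_lborel_singleton[of "1::real"] by eventually_elim simp
    then show "AE v in lborel. indicator {0<..<1} v *\<^sub>R cis (2 * pi * k * v) = indicator {0..1} v *\<^sub>R cis (2 * pi * k * v)"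
      by eventually_elim (auto split: split_indicator)
  qed measurable
  ultimately show ?thesis by (simp only: e)
qed

text \<open>Reads off a Fourier coefficient: the series runs over conjugate powers of
  \<open>cis\<close>, so multiplication by the power \<open>b\<close> singles out its term
  \<open>b\<close>. Absolute summability justifies integrating termwise.\<close>

lemma circle_mean_series:
  assumes c: "summable (\<lambda>n. cmod (c n))"
    and g: "\<And>v. (\<lambda>n. c n * cnj (cis (2 * pi * v)) ^ n) sums g v"
  shows "circle_mean (\<lambda>v. g v * cis (2 * pi * v) ^ b) = c b"
proof -
  let ?f = "\<lambda>n v. indicator {0<..<1} v *\<^sub>R (c n * (cnj (cis (2 * pi * v)) ^ n * cis (2 * pi * v) ^ b))"
  have ind: "integrable lborel (\<lambda>v::real. indicator {0<..<1} v :: real)" by simp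
  have nf: "norm (?f n v) = cmod (c n) * indicator {0<..<1} v" for n v
    by (simp add: norm_mult norm_power split: split_indicator)
  have [measurable]: "(\<lambda>v. cnj (cis (2 * pi * v)) ^ n * cis (2 * pi * v) ^ b) \<in> borel_measurable borel" for n
    unfolding cis_conv_exp by (intro borel_measurable_continuous_onI continuous_intros)
  have i: "integrable lborel (?f n)" for n
    by (rule Bochner_Integration.integrable_bound[OF integrable_mult_right[OF ind, of "cmod (c n)"]])
      (simp_all add: norm_mult norm_power split: split_indicator, measurable)
  have "circle_mean (\<lambda>v. g v * cis (2 * pi * v) ^ b) = (\<integral>v. (\<Sum>n. ?f n v) \<partial>lborel)"
    unfolding circle_mean_def
  proof (rule Bochner_Integration.integral_cong[OF refl])
    fix v
    have "(\<lambda>n. indicator {0<..<1} v *\<^sub>R (c n * cnj (cis (2 * pi * v)) ^ n * cis (2 * pi * v) ^ b)) sums (indicator {0<..<1} v *\<^sub>R (g v * cis (2 * pi * v) ^ b))"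
      by (intro sums_scaleR_right sums_mult2 g)
    then show "indicator {0<..<1} v *\<^sub>R (g v * cis (2 * pi * v) ^ b) = (\<Sum>n. ?f n v)"
      by (simp add: sums_iff mult.assoc)
  qed
  also have "\<dots> = (\<Sum>n. \<integral>v. ?f n v \<partial>lborel)"
  proof (rule integral_suminf[OF i])
    show "AE v in lborel. summable (\<lambda>n. norm (?f n v))"
      unfolding nf using c by (intro AE_I2 summable_mult2)
    have "(\<integral>v. norm (?f n v) \<partial>lborel) = cmod (c n)" for n
      unfolding nf by simp
    then show "summable (\<lambda>n. \<integral>v. norm (?f n v) \<partial>lborel)" using c by simp
  qed
  also have "(\<lambda>n. \<integral>v. ?f n v \<partial>lborel) = (\<lambda>n. if n = b then c b else 0)"
  proof
    fix n
    have "(\<integral>v. ?f n v \<partial>lborel) = c n * circle_mean (\<lambda>v. cnj (cis (2 * pi * v)) ^ n * cis (2 * pi * v) ^ b)"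
      unfolding circle_mean_def by (simp flip: Bochner_Integration.integral_mult_right_zero)
    then show "(\<integral>v. ?f n v \<partial>lborel) = (if n = b then c b else 0)" by (simp add: circle_mean_character)
  qed
  also have "(\<Sum>n. if n = b then c b else 0) = c b" using sums_single[of b "\<lambda>_. c b"] by (simp add: sums_iff)
  finally show ?thesis .
qed

section \<open>Moments of the kernel\<close>

lemma beta_bochner_integral:
  fixes q :: real
  assumes q: "q > - 1"
  shows "has_bochner_integral lborel (\<lambda>t. indicator {0<..<1} t * (t ^ a * (1 - t) powr q)) (Beta (real a + 1) (q + 1))"
proof -
  let ?f = "\<lambda>t::real. t powr (real a + 1 - 1) * (1 - t) powr (q + 1 - 1)"
  have "(?f has_integral Beta (real a + 1) (q + 1)) {0..1}"
    using q by (intro has_integral_Beta_real) auto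
  then have h: "(?f has_integral Beta (real a + 1) (q + 1)) {0<..<1}"
    by (simp add: has_integral_Icc_iff_Ioo)
  have nn: "(\<integral>\<^sup>+t. ennreal (indicator {0<..<1} t * ?f t) \<partial>lborel) = ennreal (Beta (real a + 1) (q + 1))"
  proof (rule nn_integral_has_integral_lborel)
    have "((\<lambda>t. if t \<in> {0<..<1} then ?f t else 0) has_integral Beta (real a + 1) (q + 1)) UNIV"
      using h by (simp only: has_integral_restrict_UNIV)
    also have "(\<lambda>t. if t \<in> {0<..<1} then ?f t else 0) = (\<lambda>t. indicator {0<..<1} t * ?f t)"
      by (auto simp: fun_eq_iff)
    finally show "((\<lambda>t. indicator {0<..<1} t * ?f t) has_integral Beta (real a + 1) (q + 1)) UNIV" .
  qed simp_all
  have B: "0 \<le> Beta (real a + 1) (q + 1)"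
    by (rule has_integral_nonneg[OF h]) simp
  have "has_bochner_integral lborel (\<lambda>t. indicator {0<..<1} t * ?f t) (Beta (real a + 1) (q + 1))"
    by (rule has_bochner_integral_nn_integral[OF _ _ B nn]) simp_all
  moreover have "(\<lambda>t::real. indicator {0<..<1} t * ?f t) = (\<lambda>t. indicator {0<..<1} t * (t ^ a * (1 - t) powr q))"
    by (auto simp: fun_eq_iff powr_realpow split: split_indicator)
  ultimately show ?thesis by simp
qed

section \<open>Integration against the Fefferman measure\<close>

lemma weight_exponent:
  assumes "m \<ge> 1"
  shows "- (2 * (real m - 1) / (3 * real m)) > - 1"
  using assms by (simp add: field_simps)

lemma polar_weight_nonneg: "m \<ge> 1 \<Longrightarrow> polar_weight m t \<ge> 0"
  by (simp add: polar_weight_def)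

lemma polar_weight_measurable [measurable]: "polar_weight m \<in> borel_measurable borel"
  unfolding polar_weight_def[abs_def] by measurable

lemma polar_weight_integrable:
  assumes "m \<ge> 1"
  shows "integrable lborel (\<lambda>t. indicator {0<..<1} t * polar_weight m t)"
proof -
  have "integrable lborel (\<lambda>t. 2 * pi\<^sup>2 / root 3 (real m) * (indicator {0<..<1} t * (t ^ 0 * (1 - t) powr - (2 * (real m - 1) / (3 * real m)))))"
    using beta_bochner_integral[OF weight_exponent[OF assms], of 0]
    by (intro integrable_mult_right) (auto simp: has_bochner_integral_iff)
  then show ?thesis by (simp add: polar_weight_def mult_ac)
qed

lemma polar_in_frontier:
  assumes m: "m \<ge> 1" and t: "0 < t" "t < 1"
  shows "polar m (t, u, v) \<in> frontier (egg m)"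
proof -
  have "((1 - t) powr (1 / (2 * real m))) ^ (2 * m) = (1 - t) powr (1 / (2 * real m) * real (2 * m))"
    using t powr_realpow[of "(1 - t) powr (1 / (2 * real m))" "2 * m"] by (simp only: powr_powr) simp
  also have "1 / (2 * real m) * real (2 * m) = 1" using m by simp
  finally show ?thesis using t by (simp add: polar_def frontier_egg[OF m] norm_mult)
qed

lemma sets_fefferman_measure [measurable_cong]: "m \<ge> 1 \<Longrightarrow> sets (fefferman_measure m) = sets borel"
  by (simp add: fefferman_measure_eq)

lemma space_fefferman_measure: "m \<ge> 1 \<Longrightarrow> space (fefferman_measure m) = UNIV"
  by (simp add: fefferman_measure_eq)

text \<open>The exponent of \<open>1 - t\<close> in the weight exceeds -1, hence the finiteness.
  Bounded functions become integrable, and square integrability implies integrability.\<close>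

lemma finite_fefferman_measure:
  assumes m: "m \<ge> 1"
  shows "finite_measure (fefferman_measure m)"
proof
  let ?I = "{0<..<1::real}"
  have sq: "?I \<times> ?I = box (0, 0) (1, 1)" by (auto simp: box_def Basis_prod_def)
  have "emeasure (fefferman_measure m) (space (fefferman_measure m)) =
      (\<integral>\<^sup>+x. ennreal (polar_weight m (fst x) * indicator cube x) \<partial>lborel)"
    unfolding fefferman_measure_eq[OF m]
    by (subst emeasure_distr) (auto simp: emeasure_density intro!: nn_integral_cong split: split_indicator)
  also have "\<dots> = (\<integral>\<^sup>+x. ennreal (indicator ?I (fst x) * polar_weight m (fst x)) * indicator (?I \<times> ?I) (snd x) \<partial>(lborel \<Otimes>\<^sub>M lborel))"
    unfolding lborel_prod by (intro nn_integral_cong) (auto simp: cube_def split: split_indicator)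
  also have "\<dots> = (\<integral>\<^sup>+t. \<integral>\<^sup>+y. ennreal (indicator ?I t * polar_weight m t) * indicator (?I \<times> ?I) y \<partial>lborel \<partial>lborel)"
  proof (subst lborel.nn_integral_fst[symmetric])
    have [measurable]: "?I \<times> ?I \<in> sets (borel :: (real \<times> real) measure)" unfolding sq by simp
    show "(\<lambda>x. ennreal (indicator ?I (fst x) * polar_weight m (fst x)) * indicator (?I \<times> ?I) (snd x)) \<in> borel_measurable (lborel \<Otimes>\<^sub>M (lborel :: (real \<times> real) measure))"
      by measurable
  qed simp
  also have "\<dots> = (\<integral>\<^sup>+t. ennreal (indicator ?I t * polar_weight m t) * emeasure lborel (?I \<times> ?I) \<partial>lborel)"
    unfolding sq by (subst nn_integral_cmult_indicator) auto
  also have "emeasure lborel (?I \<times> ?I) = 1" unfolding sq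
    by (subst emeasure_lborel_box) (auto simp: Basis_prod_def prod.union_disjoint prod.reindex inj_on_def)
  also have "(\<integral>\<^sup>+t. ennreal (indicator ?I t * polar_weight m t) * 1 \<partial>lborel) < \<infinity>"
    using polar_weight_integrable[OF m] polar_weight_nonneg[OF m] unfolding integrable_iff_bounded by simp
  finally show "emeasure (fefferman_measure m) (space (fefferman_measure m)) \<noteq> \<infinity>" by simp
qed

lemma AE_fefferman_frontier:
  assumes m: "m \<ge> 1"
  shows "AE \<xi> in fefferman_measure m. \<xi> \<in> frontier (egg m)"
  unfolding fefferman_measure_eq[OF m]
proof (subst AE_distr_iff)
  show "{x \<in> space borel. x \<in> frontier (egg m)} \<in> sets borel" by (simp add: borel_closed)
  show "AE x in density lborel (\<lambda>x. ennreal (polar_weight m (fst x) * indicator cube x)). polar m x \<in> frontier (egg m)"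
  proof -
    have "polar m x \<in> frontier (egg m)" if "x \<in> cube" for x
      using that polar_in_frontier[OF m] by (cases x) (auto simp: cube_def)
    then show ?thesis by (subst AE_density) (auto split: split_indicator_asm intro!: AE_I2)
  qed
qed simp_all

lemma integrable_fefferman:
  fixes F :: "C2 \<Rightarrow> complex"
  assumes m: "m \<ge> 1" and F: "F \<in> borel_measurable borel" and B: "\<And>\<xi>. \<xi> \<in> frontier (egg m) \<Longrightarrow> cmod (F \<xi>) \<le> B"
  shows "integrable (fefferman_measure m) F"
proof (rule finite_measure.integrable_const_bound[OF finite_fefferman_measure[OF m]])
  show "AE \<xi> in fefferman_measure m. cmod (F \<xi>) \<le> B"
    using AE_fefferman_frontier[OF m] by eventually_elim (rule B)
  show "F \<in> borel_measurable (fefferman_measure m)"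
    using F sets_fefferman_measure[OF m] by (metis measurable_cong_sets)
qed

text \<open>Fubini in the order in which the kernel is expanded: the inner mean runs over the
  argument of \<open>w\<close>, the outer one over that of \<open>z\<close>.\<close>

lemma integral_fefferman:
  fixes F :: "C2 \<Rightarrow> complex"
  assumes m: "m \<ge> 1" and F [measurable]: "F \<in> borel_measurable borel" and B: "\<And>\<xi>. \<xi> \<in> frontier (egg m) \<Longrightarrow> cmod (F \<xi>) \<le> B"
  shows "(\<integral>\<xi>. F \<xi> \<partial>fefferman_measure m) =
    (\<integral>t. (indicator {0<..<1} t * polar_weight m t) *\<^sub>R circle_mean (\<lambda>u. circle_mean (\<lambda>v. F (polar m (t, u, v)))) \<partial>lborel)"
proof -
  let ?I = "{0<..<1::real}"
  let ?w = "\<lambda>x. polar_weight m (fst x) * indicator cube x"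
  let ?G = "\<lambda>x. ?w x *\<^sub>R F (polar m x)"
  have w0: "AE x in lborel. 0 \<le> ?w x" using polar_weight_nonneg[OF m] by (simp split: split_indicator)
  have int: "integrable lborel ?G"
  proof -
    have "integrable (fefferman_measure m) F" by (rule integrable_fefferman[OF m F B])
    then have "integrable (density lborel (\<lambda>x. ennreal (?w x))) (\<lambda>x. F (polar m x))"
      unfolding fefferman_measure_eq[OF m] by (subst (asm) integrable_distr_eq) simp_all
    then show ?thesis using w0 by (subst (asm) integrable_density) simp_all
  qed
  have "(\<integral>\<xi>. F \<xi> \<partial>fefferman_measure m) = (\<integral>x. ?G x \<partial>lborel)"
    unfolding fefferman_measure_eq[OF m] using w0
    by (subst integral_distr; (subst integral_density)?) auto
  also have "\<dots> = (\<integral>t. \<integral>y. ?G (t, y) \<partial>lborel \<partial>lborel)"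
  proof -
    have "integrable (lborel \<Otimes>\<^sub>M lborel) ?G" unfolding lborel_prod by (rule int)
    from lborel_pair.integral_fst'[OF this] show ?thesis unfolding lborel_prod by simp
  qed
  also have "\<dots> = (\<integral>t. (indicator ?I t * polar_weight m t) *\<^sub>R circle_mean (\<lambda>u. circle_mean (\<lambda>v. F (polar m (t, u, v)))) \<partial>lborel)"
  proof (rule Bochner_Integration.integral_cong[OF refl])
    fix t :: real
    show "(\<integral>y. ?G (t, y) \<partial>lborel) = (indicator ?I t * polar_weight m t) *\<^sub>R circle_mean (\<lambda>u. circle_mean (\<lambda>v. F (polar m (t, u, v))))"
    proof (cases "t \<in> ?I")
      case False
      then have "(t, y) \<notin> cube" for y by (cases y) (auto simp: cube_def)
      then show ?thesis using False by simp
    next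
      case True
      let ?H = "\<lambda>y. indicator (?I \<times> ?I) y *\<^sub>R F (polar m (t, y))"
      have sq: "?I \<times> ?I = box (0, 0) (1, 1)" by (auto simp: box_def Basis_prod_def)
      have [measurable]: "?I \<times> ?I \<in> sets (borel :: (real \<times> real) measure)" unfolding sq by simp
      have [measurable]: "(\<lambda>y::real \<times> real. (t, y)) \<in> borel_measurable borel"
        by (intro borel_measurable_continuous_onI continuous_intros)
      have iH: "integrable lborel ?H"
      proof (rule integrableI_bounded_set_indicator)
        show "?I \<times> ?I \<in> sets lborel" by simp
        show "(\<lambda>y. F (polar m (t, y))) \<in> borel_measurable lborel" by simp
        show "emeasure lborel (?I \<times> ?I) < \<infinity>" unfolding sq by (simp add: emeasure_lborel_box_eq)
        show "AE y in lborel. y \<in> ?I \<times> ?I \<longrightarrow> norm (F (polar m (t, y))) \<le> B"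
        proof -
          have "norm (F (polar m (t, y))) \<le> B" for y
            using B[OF polar_in_frontier[OF m, of t "fst y" "snd y"]] True by simp
          then show ?thesis by simp
        qed
      qed
      have "(\<integral>y. ?G (t, y) \<partial>lborel) = (\<integral>y. polar_weight m t *\<^sub>R ?H y \<partial>lborel)"
        using True by (intro Bochner_Integration.integral_cong) (auto simp: cube_def split: split_indicator)
      also have "\<dots> = polar_weight m t *\<^sub>R (\<integral>y. ?H y \<partial>lborel)"
        by (intro Bochner_Integration.integral_scaleR_right iH)
      also have "(\<integral>y. ?H y \<partial>lborel) = (\<integral>u. \<integral>v. ?H (u, v) \<partial>lborel \<partial>lborel)"
      proof -
        have "integrable (lborel \<Otimes>\<^sub>M lborel) ?H" unfolding lborel_prod by (rule iH)
        from lborel_pair.integral_fst'[OF this] show ?thesis unfolding lborel_prod by simp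
      qed
      also have "\<dots> = circle_mean (\<lambda>u. circle_mean (\<lambda>v. F (polar m (t, u, v))))"
        unfolding circle_mean_def
      proof (rule Bochner_Integration.integral_cong[OF refl])
        fix u
        show "(\<integral>v. ?H (u, v) \<partial>lborel) = indicator ?I u *\<^sub>R (\<integral>v. indicator ?I v *\<^sub>R F (polar m (t, u, v)) \<partial>lborel)"
          by (cases "u \<in> ?I") (auto intro!: Bochner_Integration.integral_cong simp: indicator_def)
      qed
      finally show ?thesis using True by simp
    qed
  qed
  finally show ?thesis .
qed

text \<open>The kernel with \<open>A = 1 - z1 cnj z2\<close> and \<open>x = w1 cnj w2\<close> as
  independent variables, so that it can be expanded in \<open>x\<close> for fixed
  \<open>A\<close>.\<close>

definition kernel_profile :: "nat \<Rightarrow> complex \<Rightarrow> complex \<Rightarrow> complex" where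
  "kernel_profile m A x = complex_of_real (root 3 (real m) / (2 * pi\<^sup>2)) *
        ((of_nat m + 2) * A powr (1 / of_nat m) + (1 - of_nat m) * x) /
        (3 * of_nat m * A powr ((4 * of_nat m - 1) / (3 * of_nat m)) * (A powr (1 / of_nat m) - x)\<^sup>2)"

lemma fs_kernel_profile: "fs_kernel m \<zeta> \<eta> = kernel_profile m (1 - fst \<zeta> * cnj (fst \<eta>)) (snd \<zeta> * cnj (snd \<eta>))"
  by (simp add: fs_kernel_def kernel_profile_def Let_def)

text \<open>Equals \<open>n/m + 1 - \<kappa>\<close>, the second argument of the Beta integral
  behind the squared norm of \<open>z^a w^n\<close>.\<close>

definition kernel_beta :: "nat \<Rightarrow> nat \<Rightarrow> real" where
  "kernel_beta m n = (3 * real n + real m + 2) / (3 * real m)"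

lemma linear_geometric_sums:
  fixes y :: complex
  assumes "cmod y < 1"
  shows "(\<lambda>n. of_nat n * y ^ n) sums (y / (1 - y)\<^sup>2)"
proof -
  have "(\<lambda>n. y * (of_nat (Suc n) * y ^ n)) sums (y * (1 / (1 - y)\<^sup>2))"
    by (intro sums_mult geometric_deriv_sums assms)
  then have "(\<lambda>n. of_nat (Suc n) * y ^ Suc n) sums (y / (1 - y)\<^sup>2)" by (simp add: mult_ac)
  then show ?thesis using sums_Suc_iff[of "\<lambda>n. of_nat n * y ^ n" "y / (1 - y)\<^sup>2"] by simp
qed

text \<open>Division by \<open>T = A^(1/m)\<close> reduces the claim to power series in
  \<open>y = x / T\<close>, which has modulus below 1. Since \<open>kernel_beta m n\<close> is
  affine in \<open>n\<close>, the series of \<open>(n + 1) y^n\<close> and \<open>n y^n\<close>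
  suffice.\<close>

lemma kernel_profile_series:
  assumes m: "m \<ge> 1" and A: "A \<noteq> 0" and x: "cmod x < cmod (A powr (1 / of_nat m))"
  defines "c \<equiv> \<lambda>n. complex_of_real (root 3 (real m) / (2 * pi\<^sup>2) * kernel_beta m n) * A powr (- of_real (kernel_beta m n + 1)) * x ^ n"
  shows "c sums kernel_profile m A x" "summable (\<lambda>n. cmod (c n))"
proof -
  define T where "T = A powr (1 / of_nat m)"
  define E where "E = A powr ((4 * of_nat m - 1) / (3 * of_nat m))"
  define C where "C = complex_of_real (root 3 (real m) / (2 * pi\<^sup>2))"
  define y where "y = x / T"
  have T: "T \<noteq> 0" and E: "E \<noteq> 0" using A by (auto simp: T_def E_def)
  have xy: "x = T * y" using T by (simp add: y_def)
  have y: "cmod y < 1" using x T by (simp add: y_def norm_divide T_def[symmetric])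
  then have y1: "1 - y \<noteq> 0" by auto
  have m0: "(of_nat m :: complex) \<noteq> 0" using m by simp
  have c: "c n = C / (3 * of_nat m * E * T) * (of_nat (3 * n + m + 2) * y ^ n)" for n
  proof -
    \<comment> \<open>The identity \<open>(4m - 1)/(3m) + (n + 1)/m = kernel_beta m n + 1\<close>
      explains the exponent \<open>(4m - 1)/(3m)\<close> of the kernel. As \<open>A\<close> is
      complex, all powers are written through the same \<open>Ln A\<close>.\<close>
    have "A powr (- of_real (kernel_beta m n + 1)) * (E * T ^ Suc n) = 1"
    proof -
      have "E * T ^ Suc n = exp ((4 * of_nat m - 1) / (3 * of_nat m) * Ln A) * exp (of_nat (Suc n) * (1 / of_nat m * Ln A))"
        using A unfolding E_def T_def exp_of_nat_mult by (simp add: powr_def)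
      also have "\<dots> = exp (((4 * of_nat m - 1) / (3 * of_nat m) + of_nat (Suc n) * (1 / of_nat m)) * Ln A)"
        by (simp only: exp_add[symmetric] distrib_right mult.assoc)
      also have "(4 * of_nat m - 1) / (3 * of_nat m) + of_nat (Suc n) * (1 / of_nat m) = complex_of_real (kernel_beta m n + 1)"
        using m0 by (simp add: kernel_beta_def field_simps)
      finally have ET: "E * T ^ Suc n = exp (complex_of_real (kernel_beta m n + 1) * Ln A)" .
      show ?thesis unfolding ET powr_def using A by (simp only: if_False exp_add[symmetric] mult_minus_left) simp
    qed
    then have "A powr (- of_real (kernel_beta m n + 1)) = 1 / (E * T ^ Suc n)"
      using E T by (simp add: field_simps)
    then have "c n = C * of_real (kernel_beta m n) * (1 / (E * T ^ Suc n)) * (T * y) ^ n"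
      unfolding c_def C_def xy by simp
    also have "\<dots> = C * of_real (kernel_beta m n) / (E * T) * y ^ n"
      using E T by (simp add: power_mult_distrib)
    finally show ?thesis using m0 by (simp add: kernel_beta_def add_ac mult.assoc)
  qed
  \<comment> \<open>The splitting \<open>3n + m + 2 = (m + 2)(n + 1) + (1 - m) n\<close> produces
    the two terms in the numerator of the kernel.\<close>
  have "(\<lambda>n. (of_nat m + 2) * (of_nat (Suc n) * y ^ n) + (1 - of_nat m) * (of_nat n * y ^ n)) sums
     ((of_nat m + 2) * (1 / (1 - y)\<^sup>2) + (1 - of_nat m) * (y / (1 - y)\<^sup>2))"
    by (intro sums_add sums_mult geometric_deriv_sums linear_geometric_sums y)
  also have "(\<lambda>n. (of_nat m + 2) * (of_nat (Suc n) * y ^ n) + (1 - of_nat m) * (of_nat n * y ^ n)) = (\<lambda>n. of_nat (3 * n + m + 2) * y ^ n)"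
    by (auto simp: fun_eq_iff algebra_simps)
  finally have "c sums (C / (3 * of_nat m * E * T) * ((of_nat m + 2) * (1 / (1 - y)\<^sup>2) + (1 - of_nat m) * (y / (1 - y)\<^sup>2)))"
    unfolding c[abs_def] by (rule sums_mult)
  also have "C / (3 * of_nat m * E * T) * ((of_nat m + 2) * (1 / (1 - y)\<^sup>2) + (1 - of_nat m) * (y / (1 - y)\<^sup>2)) = kernel_profile m A x"
  proof -
    have "(of_nat m + 2) * (1 / (1 - y)\<^sup>2) + (1 - of_nat m) * (y / (1 - y)\<^sup>2) = ((of_nat m + 2) + (1 - of_nat m) * y) / (1 - y)\<^sup>2"
      by (simp add: add_divide_distrib)
    moreover have "T - x = T * (1 - y)" "(of_nat m + 2) * T + (1 - of_nat m) * x = T * ((of_nat m + 2) + (1 - of_nat m) * y)"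
      by (simp_all add: xy algebra_simps)
    ultimately show ?thesis
      unfolding kernel_profile_def T_def[symmetric] E_def[symmetric] C_def[symmetric]
      using T E m0 y1 by (simp add: power_mult_distrib power2_eq_square)
  qed
  finally show "c sums kernel_profile m A x" .
  have "summable (\<lambda>n. 3 * (of_nat (Suc n) * cmod y ^ n) + (real m - 1) * cmod y ^ n)"
    using y by (intro summable_add summable_mult summable_geometric sums_summable[OF geometric_deriv_sums]) auto
  then have "summable (\<lambda>n. cmod (C / (3 * of_nat m * E * T)) * (real (3 * n + m + 2) * cmod y ^ n))"
    by (intro summable_mult) (simp add: algebra_simps)
  then show "summable (\<lambda>n. cmod (c n))"
    unfolding c norm_mult norm_power norm_of_nat .
qed

lemma binomial_series_pochhammer:
  fixes q p :: complex
  assumes q: "cmod q < 1"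
  shows "(\<lambda>n. pochhammer p n / fact n * q ^ n) sums (1 - q) powr (- p)"
    and "summable (\<lambda>n. cmod (pochhammer p n / fact n * q ^ n))"
proof -
  have s: "(\<lambda>n. pochhammer p n / fact n * q ^ n) sums (1 - q) powr (- p)" if q: "cmod q < 1" for q
  proof -
    have "(\<lambda>n. ((- p) gchoose n) * (- q) ^ n) sums (1 + (- q)) powr (- p)"
      using q by (intro gen_binomial_complex) simp
    moreover have "((- p) gchoose n) * (- q) ^ n = pochhammer p n / fact n * q ^ n" for n
    proof -
      have "((- p) gchoose n) * (- q) ^ n = ((- 1) ^ n * (- 1) ^ n) * (pochhammer p n / fact n * q ^ n)"
        unfolding gbinomial_pochhammer power_minus[of q] by simp
      also have "(- 1) ^ n * (- 1) ^ n = (1 :: complex)" by (simp flip: power_mult_distrib)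
      finally show ?thesis by simp
    qed
    ultimately show ?thesis by simp
  qed
  show "(\<lambda>n. pochhammer p n / fact n * q ^ n) sums (1 - q) powr (- p)" by (rule s[OF q])
  \<comment> \<open>The series also converges at the midpoint between \<open>cmod q\<close> and 1,
    and a power series converges absolutely at every point of smaller modulus.\<close>
  have "summable (\<lambda>n. pochhammer p n / fact n * of_real ((1 + cmod q) / 2) ^ n)"
  proof (rule sums_summable[OF s])
    show "cmod (of_real ((1 + cmod q) / 2)) < 1" using q by (simp only: norm_of_real) simp
  qed
  then show "summable (\<lambda>n. cmod (pochhammer p n / fact n * q ^ n))"
  proof (rule powser_insidea)
    show "cmod q < cmod (of_real ((1 + cmod q) / 2))" using q by (simp only: norm_of_real) simp
  qed
qed

lemma circle_mean_mult: "circle_mean (\<lambda>v. f v * k) = circle_mean f * k"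
  unfolding circle_mean_def by (simp flip: Bochner_Integration.integral_mult_left_zero)

text \<open>The value 0 off the closed egg makes the function bounded and Borel on the whole ambient
  space, for \<zeta> in the egg and \<open>m \<ge> 1\<close>.\<close>

definition kernel_boundary :: "nat \<Rightarrow> C2 \<Rightarrow> C2 \<Rightarrow> complex" where
  "kernel_boundary m \<zeta> \<xi> = (if \<xi> \<in> closed_egg m then fs_kernel m \<zeta> \<xi> else 0)"

lemma measurable_closed_egg_extension:
  fixes g :: "C2 \<Rightarrow> complex"
  assumes "continuous_on (closed_egg m) g"
  shows "(\<lambda>\<xi>. if \<xi> \<in> closed_egg m then g \<xi> else 0) \<in> borel_measurable borel"
proof -
  have "(\<lambda>\<xi>. indicator (closed_egg m) \<xi> *\<^sub>R g \<xi>) \<in> borel_measurable borel"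
    by (rule borel_measurable_continuous_on_indicator[OF _ assms]) (simp add: closed_closed_egg borel_closed)
  also have "(\<lambda>\<xi>. indicator (closed_egg m) \<xi> *\<^sub>R g \<xi>) = (\<lambda>\<xi>. if \<xi> \<in> closed_egg m then g \<xi> else 0)"
    by (auto simp: fun_eq_iff)
  finally show ?thesis .
qed

lemma continuous_closed_egg_bounded:
  fixes g :: "C2 \<Rightarrow> complex"
  assumes "m \<ge> 1" "continuous_on (closed_egg m) g"
  shows "\<exists>B. \<forall>\<xi>\<in>closed_egg m. cmod (g \<xi>) \<le> B"
  using compact_imp_bounded[OF compact_continuous_image[OF assms(2) compact_closed_egg[OF assms(1)]]]
  unfolding bounded_iff by blast

text \<open>On one torus of the boundary the inner mean picks the coefficient of index
  \<open>b\<close> from \<open>kernel_profile_series\<close>, which leaves a power of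
  \<open>A u\<close>; the outer mean picks the coefficient of index \<open>a\<close> from the
  binomial series of that power.\<close>

lemma kernel_moment_torus:
  assumes m: "m \<ge> 1" and \<zeta>: "(z1, w1) \<in> egg m" and t: "0 < t" "t < 1"
  shows "circle_mean (\<lambda>u. circle_mean (\<lambda>v. kernel_boundary m (z1, w1) (polar m (t, u, v)) *
      (fst (polar m (t, u, v)) ^ a * snd (polar m (t, u, v)) ^ b))) =
    complex_of_real (root 3 (real m) / (2 * pi\<^sup>2) * kernel_beta m b * (pochhammer (kernel_beta m b + 1) a / fact a) *
       (t ^ a * (1 - t) powr (real b / real m))) * (z1 ^ a * w1 ^ b)"
proof -
  define r where "r = complex_of_real (sqrt t)"
  define s where "s = complex_of_real ((1 - t) powr (1 / (2 * real m)))"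
  let ?e = "\<lambda>u. cis (2 * pi * u)"
  define D where "D = complex_of_real (root 3 (real m) / (2 * pi\<^sup>2) * kernel_beta m b)"
  define p where "p = complex_of_real (kernel_beta m b + 1)"
  define A where "A u = 1 - z1 * r * cnj (?e u)" for u
  have P: "polar m (t, u, v) = (r * ?e u, s * ?e v)" for u v by (simp add: polar_def r_def s_def)
  have cl: "polar m (t, u, v) \<in> closed_egg m" for u v
    using polar_in_frontier[OF m t] frontier_subset_closed_egg[OF m] by blast
  note den = egg_kernel_denominators[OF m \<zeta> cl]
  have rc: "cnj r = r" "cnj s = s" by (simp_all add: r_def s_def)
  have K: "kernel_boundary m (z1, w1) (polar m (t, u, v)) = kernel_profile m (A u) (w1 * s * cnj (?e v))" for u v
    unfolding kernel_boundary_def if_P[OF cl] fs_kernel_profile unfolding P A_def by (simp add: rc mult_ac)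
  have A0: "A u \<noteq> 0" for u using den(5)[of u u] by (simp add: P A_def rc mult_ac)
  have x: "cmod (w1 * s) < cmod (A u powr (1 / of_nat m))" for u
    using den(4)[of u 0] by (simp add: P A_def rc mult_ac)
  have inner: "circle_mean (\<lambda>v. kernel_boundary m (z1, w1) (polar m (t, u, v)) * (fst (polar m (t, u, v)) ^ a * snd (polar m (t, u, v)) ^ b))
     = A u powr (- p) * ?e u ^ a * (D * (w1 * s) ^ b * r ^ a * s ^ b)" for u
  proof -
    let ?c = "\<lambda>n. complex_of_real (root 3 (real m) / (2 * pi\<^sup>2) * kernel_beta m n) * A u powr (- of_real (kernel_beta m n + 1)) * (w1 * s) ^ n"
    have "circle_mean (\<lambda>v. kernel_profile m (A u) (w1 * s * cnj (?e v)) * ?e v ^ b) = ?c b"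
    proof (rule circle_mean_series)
      show "summable (\<lambda>n. cmod (?c n))" by (rule kernel_profile_series(2)[OF m A0 x])
      fix v
      have "cmod (w1 * s * cnj (?e v)) < cmod (A u powr (1 / of_nat m))" using x[of u] by (simp add: norm_mult)
      from kernel_profile_series(1)[OF m A0 this]
      show "(\<lambda>n. ?c n * cnj (?e v) ^ n) sums kernel_profile m (A u) (w1 * s * cnj (?e v))"
        by (simp only: power_mult_distrib mult.assoc)
    qed
    moreover have "kernel_boundary m (z1, w1) (polar m (t, u, v)) * (fst (polar m (t, u, v)) ^ a * snd (polar m (t, u, v)) ^ b)
      = kernel_profile m (A u) (w1 * s * cnj (?e v)) * ?e v ^ b * (r ^ a * ?e u ^ a * s ^ b)" for v
      unfolding K by (simp add: P power_mult_distrib)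
    ultimately have "circle_mean (\<lambda>v. kernel_boundary m (z1, w1) (polar m (t, u, v)) * (fst (polar m (t, u, v)) ^ a * snd (polar m (t, u, v)) ^ b))
      = ?c b * (r ^ a * ?e u ^ a * s ^ b)"
      by (simp only: circle_mean_mult)
    then show ?thesis by (simp only: D_def p_def mult_ac)
  qed
  have q: "cmod (z1 * r * cnj (?e u)) < 1" for u using den(2)[of u u] by (simp add: P rc mult_ac)
  have q0: "cmod (z1 * r) < 1" using q[of 0] by simp
  have outer: "circle_mean (\<lambda>u. A u powr (- p) * ?e u ^ a) = pochhammer p a / fact a * (z1 * r) ^ a"
  proof (rule circle_mean_series)
    show "summable (\<lambda>n. cmod (pochhammer p n / fact n * (z1 * r) ^ n))" by (rule binomial_series_pochhammer(2)[OF q0])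
    fix u
    from binomial_series_pochhammer(1)[OF q[of u], of p]
    show "(\<lambda>n. pochhammer p n / fact n * (z1 * r) ^ n * cnj (?e u) ^ n) sums (A u powr (- p))"
      unfolding A_def by (simp only: power_mult_distrib mult.assoc)
  qed
  have r2: "r ^ a * r ^ a = complex_of_real (t ^ a)"
    using t by (simp add: r_def power_mult_distrib[symmetric] of_real_mult[symmetric] del: of_real_mult)
  have s2: "s ^ b * s ^ b = complex_of_real ((1 - t) powr (real b / real m))"
  proof -
    have "(1 - t) powr (1 / (2 * real m)) * (1 - t) powr (1 / (2 * real m)) = (1 - t) powr (1 / real m)"
      unfolding powr_add[symmetric] by (simp add: field_simps)
    then have "s ^ b * s ^ b = complex_of_real (((1 - t) powr (1 / real m)) ^ b)"
      by (simp add: s_def power_mult_distrib[symmetric] of_real_mult[symmetric] del: of_real_mult)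
    also have "((1 - t) powr (1 / real m)) ^ b = (1 - t) powr (real b / real m)"
      using t powr_realpow[of "(1 - t) powr (1 / real m)" b] by (simp add: powr_powr)
    finally show ?thesis .
  qed
  have "pochhammer p a = complex_of_real (pochhammer (kernel_beta m b + 1) a)"
    unfolding p_def by (rule pochhammer_of_real)
  then have "circle_mean (\<lambda>u. A u powr (- p) * ?e u ^ a) * (D * (w1 * s) ^ b * r ^ a * s ^ b)
     = D * of_real (pochhammer (kernel_beta m b + 1) a / fact a) * (r ^ a * r ^ a) * (s ^ b * s ^ b) * (z1 ^ a * w1 ^ b)"
    unfolding outer by (simp add: power_mult_distrib mult_ac)
  then show ?thesis
    unfolding inner circle_mean_mult r2 s2 by (simp add: D_def mult_ac)
qed

text \<open>Because \<open>Gamma (a + 1 + \<beta>) = (\<beta> + 1)_a \<beta> Gamma \<beta>\<close>,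
  the Beta value is \<open>a! / (\<beta> (\<beta> + 1)_a)\<close>, the reciprocal of the series
  coefficient. The constants of the kernel and of the weight cancel as well.\<close>

lemma beta_constant:
  assumes m: "m \<ge> 1"
  shows "root 3 (real m) / (2 * pi\<^sup>2) * kernel_beta m b * (pochhammer (kernel_beta m b + 1) a / fact a) *
     (2 * pi\<^sup>2 / root 3 (real m) * Beta (real a + 1) (kernel_beta m b)) = 1"
proof -
  let ?\<beta> = "kernel_beta m b"
  have \<beta>: "?\<beta> > 0" using m by (simp add: kernel_beta_def)
  have G0: "Gamma ?\<beta> > 0" "Gamma (?\<beta> + 1) = ?\<beta> * Gamma ?\<beta>"
    using \<beta> by (auto intro!: Gamma_real_pos Gamma_plus1 elim!: nonpos_Ints_cases)
  have "Gamma (real a + 1 + ?\<beta>) = pochhammer (?\<beta> + 1) a * Gamma (?\<beta> + 1)"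
  proof -
    have "?\<beta> + 1 \<notin> \<int>\<^sub>\<le>\<^sub>0" using \<beta> by (auto simp: nonpos_Ints_def)
    then have "pochhammer (?\<beta> + 1) a = Gamma (?\<beta> + 1 + of_nat a) / Gamma (?\<beta> + 1)" by (rule pochhammer_Gamma)
    then have "pochhammer (?\<beta> + 1) a * Gamma (?\<beta> + 1) = Gamma (?\<beta> + 1 + of_nat a)"
    proof -
      have "Gamma (?\<beta> + 1) \<noteq> 0" using Gamma_real_pos[of "?\<beta> + 1"] \<beta> by linarith
      then show ?thesis using \<open>pochhammer (?\<beta> + 1) a = Gamma (?\<beta> + 1 + of_nat a) / Gamma (?\<beta> + 1)\<close> by simp
    qed
    moreover have "?\<beta> + 1 + of_nat a = real a + 1 + ?\<beta>" by simp
    ultimately show ?thesis by metis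
  qed
  moreover have "Gamma (real a + 1) = fact a" using Gamma_fact[of a, where 'a=real] by (simp add: add.commute)
  ultimately have "Beta (real a + 1) ?\<beta> = fact a * Gamma ?\<beta> / (pochhammer (?\<beta> + 1) a * (?\<beta> * Gamma ?\<beta>))"
    unfolding Beta_def by (simp add: G0)
  moreover have "pochhammer (?\<beta> + 1) a > 0" using \<beta> by (intro pochhammer_pos) simp
  ultimately show ?thesis using m \<beta> G0 by (simp add: field_simps)
qed

text \<open>The coefficient \<open>C\<close> of the kernel at index \<open>(a, b)\<close> is the
  reciprocal of the squared norm of \<open>z^a w^b\<close>, which is
  \<open>W * Beta (real a + 1) (q + 1)\<close>.\<close>

lemma kernel_moment:
  assumes m: "m \<ge> 1" and \<zeta>: "(z1, w1) \<in> egg m"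
  shows "(\<integral>\<xi>. kernel_boundary m (z1, w1) \<xi> * (fst \<xi> ^ a * snd \<xi> ^ b) \<partial>fefferman_measure m) = z1 ^ a * w1 ^ b"
proof -
  let ?F = "\<lambda>\<xi>. kernel_boundary m (z1, w1) \<xi> * (fst \<xi> ^ a * snd \<xi> ^ b)"
  have c: "continuous_on (closed_egg m) (\<lambda>\<xi>. fs_kernel m (z1, w1) \<xi> * (fst \<xi> ^ a * snd \<xi> ^ b))"
    by (intro continuous_intros continuous_on_fs_kernel[OF m \<zeta>])
  have Fe: "?F = (\<lambda>\<xi>. if \<xi> \<in> closed_egg m then fs_kernel m (z1, w1) \<xi> * (fst \<xi> ^ a * snd \<xi> ^ b) else 0)"
    by (auto simp: kernel_boundary_def)
  have meas: "?F \<in> borel_measurable borel" unfolding Fe by (rule measurable_closed_egg_extension[OF c])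
  obtain B where B: "\<And>\<xi>. \<xi> \<in> closed_egg m \<Longrightarrow> cmod (fs_kernel m (z1, w1) \<xi> * (fst \<xi> ^ a * snd \<xi> ^ b)) \<le> B"
    using continuous_closed_egg_bounded[OF m c] by blast
  have bd: "cmod (?F \<xi>) \<le> B" if "\<xi> \<in> frontier (egg m)" for \<xi>
  proof -
    have "\<xi> \<in> closed_egg m" using frontier_subset_closed_egg[OF m] that by blast
    then show ?thesis using B[of \<xi>] by (simp add: kernel_boundary_def)
  qed
  define C where "C = root 3 (real m) / (2 * pi\<^sup>2) * kernel_beta m b * (pochhammer (kernel_beta m b + 1) a / fact a)"
  define W where "W = 2 * pi\<^sup>2 / root 3 (real m)"
  \<comment> \<open>The exponent of \<open>1 - t\<close> in the radial integral: \<open>b/m\<close>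
    comes from \<open>|w|^(2b)\<close>, the rest from the weight.\<close>
  define q where "q = real b / real m - 2 * (real m - 1) / (3 * real m)"
  have q: "q + 1 = kernel_beta m b" using m by (simp add: q_def kernel_beta_def field_simps)
  moreover have "kernel_beta m b > 0" using m by (simp add: kernel_beta_def)
  ultimately have q1: "q > - 1" by simp
  have "(\<integral>\<xi>. ?F \<xi> \<partial>fefferman_measure m) =
     (\<integral>t. (indicator {0<..<1} t * polar_weight m t) *\<^sub>R circle_mean (\<lambda>u. circle_mean (\<lambda>v. ?F (polar m (t, u, v)))) \<partial>lborel)"
    by (rule integral_fefferman[OF m meas bd])
  also have "\<dots> = (\<integral>t. (C * W * (indicator {0<..<1} t * (t ^ a * (1 - t) powr q))) *\<^sub>R (z1 ^ a * w1 ^ b) \<partial>lborel)"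
  proof (rule Bochner_Integration.integral_cong[OF refl])
    fix t :: real
    show "(indicator {0<..<1} t * polar_weight m t) *\<^sub>R circle_mean (\<lambda>u. circle_mean (\<lambda>v. ?F (polar m (t, u, v)))) =
      (C * W * (indicator {0<..<1} t * (t ^ a * (1 - t) powr q))) *\<^sub>R (z1 ^ a * w1 ^ b)"
    proof (cases "t \<in> {0<..<1}")
      case True
      then have t: "0 < t" "t < 1" by auto
      have "q = real b / real m + - (2 * (real m - 1) / (3 * real m))" by (simp add: q_def)
      then have pq: "(1 - t) powr q = (1 - t) powr (real b / real m) * (1 - t) powr - (2 * (real m - 1) / (3 * real m))"
        by (simp only: powr_add)
      show ?thesis
        unfolding kernel_moment_torus[OF m \<zeta> t] pq using True
        by (simp add: polar_weight_def C_def W_def scaleR_conv_of_real mult_ac)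
    qed simp
  qed
  also have "\<dots> = (C * W * Beta (real a + 1) (q + 1)) *\<^sub>R (z1 ^ a * w1 ^ b)"
    using beta_bochner_integral[OF q1, of a] by (simp add: has_bochner_integral_iff)
  also have "C * W * Beta (real a + 1) (q + 1) = 1"
    using beta_constant[OF m, of b a] unfolding q C_def W_def by (simp only: mult.assoc)
  finally show ?thesis by simp
qed

section \<open>The reproducing property\<close>

lemma norm_integral_fefferman_le:
  fixes g :: "C2 \<Rightarrow> complex"
  assumes m: "m \<ge> 1" and g: "integrable (fefferman_measure m) g" and b: "\<And>\<xi>. \<xi> \<in> frontier (egg m) \<Longrightarrow> cmod (g \<xi>) \<le> b"
  shows "cmod (\<integral>\<xi>. g \<xi> \<partial>fefferman_measure m) \<le> b * measure (fefferman_measure m) UNIV"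
proof -
  interpret finite_measure "fefferman_measure m" by (rule finite_fefferman_measure[OF m])
  have "cmod (\<integral>\<xi>. g \<xi> \<partial>fefferman_measure m) \<le> (\<integral>\<xi>. cmod (g \<xi>) \<partial>fefferman_measure m)" by (rule integral_norm_bound)
  also have "\<dots> \<le> (\<integral>\<xi>. b \<partial>fefferman_measure m)"
  proof (rule integral_mono_AE)
    show "AE \<xi> in fefferman_measure m. cmod (g \<xi>) \<le> b"
      using AE_fefferman_frontier[OF m] by eventually_elim (rule b)
  qed (use g in auto)
  also have "\<dots> = b * measure (fefferman_measure m) UNIV" by (simp add: space_fefferman_measure[OF m])
  finally show ?thesis .
qed

lemma kernel_boundary_measurable:
  assumes "m \<ge> 1" "\<zeta> \<in> egg m"
  shows "kernel_boundary m \<zeta> \<in> borel_measurable borel"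
  unfolding kernel_boundary_def[abs_def]
  by (rule measurable_closed_egg_extension[OF continuous_on_fs_kernel[OF assms]])

lemma integrable_kernel_boundary_mult:
  assumes m: "m \<ge> 1" and \<zeta>: "\<zeta> \<in> egg m" and g: "continuous_on (closed_egg m) g"
  shows "integrable (fefferman_measure m) (\<lambda>\<xi>. kernel_boundary m \<zeta> \<xi> * g \<xi>)"
proof -
  have c: "continuous_on (closed_egg m) (\<lambda>\<xi>. fs_kernel m \<zeta> \<xi> * g \<xi>)"
    by (intro continuous_intros continuous_on_fs_kernel[OF m \<zeta>] g)
  have e: "(\<lambda>\<xi>. kernel_boundary m \<zeta> \<xi> * g \<xi>) = (\<lambda>\<xi>. if \<xi> \<in> closed_egg m then fs_kernel m \<zeta> \<xi> * g \<xi> else 0)"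
    by (auto simp: kernel_boundary_def)
  obtain B where B: "\<And>\<xi>. \<xi> \<in> closed_egg m \<Longrightarrow> cmod (fs_kernel m \<zeta> \<xi> * g \<xi>) \<le> B"
    using continuous_closed_egg_bounded[OF m c] by blast
  show ?thesis
  proof (rule integrable_fefferman[OF m])
    show "(\<lambda>\<xi>. kernel_boundary m \<zeta> \<xi> * g \<xi>) \<in> borel_measurable borel"
      unfolding e by (rule measurable_closed_egg_extension[OF c])
    fix \<xi> assume "\<xi> \<in> frontier (egg m)"
    then have "\<xi> \<in> closed_egg m" using frontier_subset_closed_egg[OF m] by blast
    then show "cmod (kernel_boundary m \<zeta> \<xi> * g \<xi>) \<le> B" using B[of \<xi>] by (simp add: kernel_boundary_def)
  qed
qed

text \<open>The polynomials approximate the dilated function uniformly on the closed egg, hence both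
  under the integral, where the kernel is bounded and the measure finite, and at \<zeta>
  itself.\<close>

lemma dilate_reproducing:
  assumes m: "m \<ge> 1" and f: "holomorphic2_on f (egg m)" and r: "0 < r" "r < 1" and \<zeta>: "\<zeta> \<in> egg m"
  shows "(\<integral>\<xi>. kernel_boundary m \<zeta> \<xi> * f (r *\<^sub>R \<xi>) \<partial>fefferman_measure m) = f (r *\<^sub>R \<zeta>)"
proof -
  let ?\<sigma> = "fefferman_measure m" and ?K = "kernel_boundary m \<zeta>"
  have cf: "continuous_on (closed_egg m) (\<lambda>\<xi>. f (r *\<^sub>R \<xi>))"
    using dilate_mem_egg[OF m _ r(2)] r
    by (intro continuous_on_compose2[OF holomorphic2_on_continuous[OF f]] continuous_intros) auto
  obtain B where B: "\<And>\<xi>. \<xi> \<in> closed_egg m \<Longrightarrow> cmod (fs_kernel m \<zeta> \<xi>) \<le> B"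
    using continuous_closed_egg_bounded[OF m continuous_on_fs_kernel[OF m \<zeta>]] by blast
  have \<zeta>c: "\<zeta> \<in> closed_egg m" using \<zeta> egg_subset_closed_egg by blast
  have B0: "0 \<le> B" using order_trans[OF norm_ge_zero B[OF \<zeta>c]] .
  \<comment> \<open>The product accounts for the error under the integral, the summand 1 for the
    error at \<zeta>.\<close>
  define L where "L = B * measure ?\<sigma> UNIV + 1"
  have L: "L > 0" using B0 by (simp add: L_def add_nonneg_pos)
  define X where "X = cmod ((\<integral>\<xi>. ?K \<xi> * f (r *\<^sub>R \<xi>) \<partial>?\<sigma>) - f (r *\<^sub>R \<zeta>))"
  have "X \<le> 0 + e" if e: "e > 0" for e
  proof -
    define d where "d = e / L"
    have d: "d > 0" using e L by (simp add: d_def)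
    obtain N c where Nc: "\<And>z w. (cmod z)\<^sup>2 + cmod w ^ (2 * m) \<le> 1 \<Longrightarrow>
       cmod (f (of_real r * z, of_real r * w) - (\<Sum>a<N. \<Sum>b<N. c a b * z ^ a * w ^ b)) < d"
      using egg_poly_approx[OF m f r d] by blast
    define h where "h = (\<lambda>\<xi>::C2. \<Sum>a<N. \<Sum>b<N. c a b * (fst \<xi> ^ a * snd \<xi> ^ b))"
    have ap: "cmod (f (r *\<^sub>R \<xi>) - h \<xi>) \<le> d" if "\<xi> \<in> closed_egg m" for \<xi>
      using Nc[of "fst \<xi>" "snd \<xi>"] that
      by (simp add: closed_egg_def h_def scaleR_prod_def scaleR_conv_of_real mult.assoc)
    have ch: "continuous_on (closed_egg m) h" unfolding h_def by (intro continuous_intros)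
    have im: "integrable ?\<sigma> (\<lambda>\<xi>. c a b * (?K \<xi> * (fst \<xi> ^ a * snd \<xi> ^ b)))" for a b
      by (intro integrable_mult_right integrable_kernel_boundary_mult[OF m \<zeta>] continuous_intros)
    have "(\<integral>\<xi>. ?K \<xi> * h \<xi> \<partial>?\<sigma>) = (\<integral>\<xi>. (\<Sum>a<N. \<Sum>b<N. c a b * (?K \<xi> * (fst \<xi> ^ a * snd \<xi> ^ b))) \<partial>?\<sigma>)"
      unfolding h_def sum_distrib_left by (simp add: mult_ac)
    also have "\<dots> = (\<Sum>a<N. \<Sum>b<N. \<integral>\<xi>. c a b * (?K \<xi> * (fst \<xi> ^ a * snd \<xi> ^ b)) \<partial>?\<sigma>)"
      using im by (simp only: Bochner_Integration.integral_sum Bochner_Integration.integrable_sum)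
    also have "\<dots> = h \<zeta>"
      using kernel_moment[OF m, of "fst \<zeta>" "snd \<zeta>"] \<zeta> unfolding h_def by simp
    finally have hr: "(\<integral>\<xi>. ?K \<xi> * h \<xi> \<partial>?\<sigma>) = h \<zeta>" .
    have i1: "integrable ?\<sigma> (\<lambda>\<xi>. ?K \<xi> * f (r *\<^sub>R \<xi>))" "integrable ?\<sigma> (\<lambda>\<xi>. ?K \<xi> * h \<xi>)"
      by (rule integrable_kernel_boundary_mult[OF m \<zeta>], fact)+
    have "(\<integral>\<xi>. ?K \<xi> * f (r *\<^sub>R \<xi>) \<partial>?\<sigma>) - h \<zeta> = (\<integral>\<xi>. ?K \<xi> * f (r *\<^sub>R \<xi>) - ?K \<xi> * h \<xi> \<partial>?\<sigma>)"
      unfolding hr[symmetric] by (rule Bochner_Integration.integral_diff[OF i1, symmetric])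
    also have "cmod \<dots> \<le> B * d * measure ?\<sigma> UNIV"
    proof (rule norm_integral_fefferman_le[OF m Bochner_Integration.integrable_diff[OF i1]])
      fix \<xi> assume "\<xi> \<in> frontier (egg m)"
      then have \<xi>: "\<xi> \<in> closed_egg m" using frontier_subset_closed_egg[OF m] by blast
      have "?K \<xi> * f (r *\<^sub>R \<xi>) - ?K \<xi> * h \<xi> = fs_kernel m \<zeta> \<xi> * (f (r *\<^sub>R \<xi>) - h \<xi>)"
        using \<xi> by (simp add: kernel_boundary_def right_diff_distrib)
      also have "cmod \<dots> \<le> B * d"
        unfolding norm_mult using B[OF \<xi>] ap[OF \<xi>] B0 by (intro mult_mono) auto
      finally show "cmod (?K \<xi> * f (r *\<^sub>R \<xi>) - ?K \<xi> * h \<xi>) \<le> B * d" .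
    qed
    finally have 1: "cmod ((\<integral>\<xi>. ?K \<xi> * f (r *\<^sub>R \<xi>) \<partial>?\<sigma>) - h \<zeta>) \<le> B * d * measure ?\<sigma> UNIV" .
    have 2: "cmod (h \<zeta> - f (r *\<^sub>R \<zeta>)) \<le> d" using ap[OF \<zeta>c] by (simp add: norm_minus_commute)
    have "X \<le> cmod ((\<integral>\<xi>. ?K \<xi> * f (r *\<^sub>R \<xi>) \<partial>?\<sigma>) - h \<zeta>) + cmod (h \<zeta> - f (r *\<^sub>R \<zeta>))"
      unfolding X_def by (rule order_trans[OF _ norm_triangle_ineq]) simp
    also have "\<dots> \<le> B * d * measure ?\<sigma> UNIV + d" using 1 2 by (rule add_mono)
    also have "\<dots> = d * L" by (simp add: L_def algebra_simps)
    also have "\<dots> = e" using L by (simp add: d_def)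
    finally show ?thesis by simp
  qed
  then have "X \<le> 0" by (rule field_le_epsilon)
  then show ?thesis by (simp add: X_def)
qed

lemma approach_region_subset_egg: "approach_region m \<alpha> \<xi> \<subseteq> egg m"
  by (auto simp: approach_region_def)

lemma hardy_reproducing:
  assumes m: "m \<ge> 1" and \<alpha>: "\<alpha> > 0" and f: "f \<in> fefferman_hardy m \<alpha>"
    and fs: "nt_boundary_value m f fs" and \<zeta>: "\<zeta> \<in> egg m"
  shows "integrable (fefferman_measure m) (\<lambda>\<xi>. kernel_boundary m \<zeta> \<xi> * fs \<xi>)"
    and "f \<zeta> = (\<integral>\<xi>. kernel_boundary m \<zeta> \<xi> * fs \<xi> \<partial>fefferman_measure m)"
proof -
  let ?\<sigma> = "fefferman_measure m" and ?K = "kernel_boundary m \<zeta>" and ?M = "frontier (egg m)"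
  interpret finite_measure ?\<sigma> by (rule finite_fefferman_measure[OF m])
  note sf [measurable_cong] = sets_fefferman_measure[OF m]
  have hol: "holomorphic2_on f (egg m)" using f by (simp add: fefferman_hardy_def)
  define N where "N \<xi> = nt_maximal m \<alpha> f \<xi> * indicator ?M \<xi>" for \<xi>
  have Nm [measurable]: "N \<in> borel_measurable ?\<sigma>" using f by (simp add: fefferman_hardy_def N_def[abs_def])
  have "(\<integral>\<^sup>+\<xi>. (N \<xi>)\<^sup>2 \<partial>?\<sigma>) = (\<integral>\<^sup>+\<xi>\<in>?M. (nt_maximal m \<alpha> f \<xi>)\<^sup>2 \<partial>?\<sigma>)"
    by (intro nn_integral_cong) (simp add: N_def split: split_indicator)
  then have Nfin: "(\<integral>\<^sup>+\<xi>. (N \<xi>)\<^sup>2 \<partial>?\<sigma>) < \<infinity>" using f by (simp add: fefferman_hardy_def)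
  have "AE \<xi> in ?\<sigma>. (N \<xi>)\<^sup>2 \<noteq> \<infinity>" using Nfin by (intro nn_integral_PInf_AE) auto
  then have Nf: "AE \<xi> in ?\<sigma>. N \<xi> \<noteq> \<infinity>" by eventually_elim auto
  have iN: "integrable ?\<sigma> (\<lambda>\<xi>. enn2real ((N \<xi>)\<^sup>2))"
  proof (rule integrableI_bounded)
    have "(\<integral>\<^sup>+\<xi>. ennreal (norm (enn2real ((N \<xi>)\<^sup>2))) \<partial>?\<sigma>) \<le> (\<integral>\<^sup>+\<xi>. (N \<xi>)\<^sup>2 \<partial>?\<sigma>)"
      by (intro nn_integral_mono) (simp add: ennreal_enn2real_if)
    then show "(\<integral>\<^sup>+\<xi>. ennreal (norm (enn2real ((N \<xi>)\<^sup>2))) \<partial>?\<sigma>) < \<infinity>" using Nfin by (rule le_less_trans)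
  qed measurable
  obtain B where B: "\<And>\<xi>. \<xi> \<in> closed_egg m \<Longrightarrow> cmod (fs_kernel m \<zeta> \<xi>) \<le> B"
    using continuous_closed_egg_bounded[OF m continuous_on_fs_kernel[OF m \<zeta>]] by blast
  have B0: "0 \<le> B" using order_trans[OF norm_ge_zero B[of \<zeta>]] \<zeta> egg_subset_closed_egg by blast
  have KB: "cmod (?K \<xi>) \<le> B" for \<xi> using B[of \<xi>] B0 by (simp add: kernel_boundary_def)
  obtain r0 where r0: "0 < r0" "r0 < 1" "\<And>r \<xi>. r0 < r \<Longrightarrow> r < 1 \<Longrightarrow> \<xi> \<in> ?M \<Longrightarrow> r *\<^sub>R \<xi> \<in> approach_region m \<alpha> \<xi>"
    using radius_in_approach_region[OF m \<alpha>] by blast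
  \<comment> \<open>\<open>n + 2\<close> instead of \<open>n + 1\<close> keeps the first term
    strictly above \<open>r0\<close>.\<close>
  define r where "r n = 1 - (1 - r0) / real (n + 2)" for n
  have r: "r0 < r n" "r n < 1" for n
  proof -
    have "(1 - r0) / real (n + 2) < (1 - r0) / 1" using r0 by (intro divide_strict_left_mono) auto
    then show "r0 < r n" by (simp add: r_def)
    show "r n < 1" using r0 by (simp add: r_def)
  qed
  have rpos: "0 < r n" for n using r(1)[of n] r0 by linarith
  have "(\<lambda>n. (1 - r0) * (1 / real (n + 2))) \<longlonglongrightarrow> (1 - r0) * 0"
    by (intro tendsto_mult tendsto_const LIMSEQ_ignore_initial_segment lim_1_over_n)
  then have rlim: "r \<longlonglongrightarrow> 1" unfolding r_def[abs_def] using tendsto_diff[OF tendsto_const[of 1]] by fastforce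
  let ?g = "\<lambda>n \<xi>. ?K \<xi> * f (r n *\<^sub>R \<xi>)"
  \<comment> \<open>By \<open>x \<le> 1 + x^2\<close> the square-integrable maximal function yields
    an integrable majorant, the measure being finite.\<close>
  let ?w = "\<lambda>\<xi>. B * (1 + enn2real ((N \<xi>)\<^sup>2))"
  have gi: "integrable ?\<sigma> (?g n)" for n
    using dilate_mem_egg[OF m _ r(2)] rpos[of n]
    by (intro integrable_kernel_boundary_mult[OF m \<zeta>] continuous_on_compose2[OF holomorphic2_on_continuous[OF hol]] continuous_intros) auto
  have lm: "(\<lambda>\<xi>. ?K \<xi> * fs \<xi>) \<in> borel_measurable ?\<sigma>"
  proof (rule borel_measurable_times)
    show "?K \<in> borel_measurable ?\<sigma>" using kernel_boundary_measurable[OF m \<zeta>] by measurable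
    show "fs \<in> borel_measurable ?\<sigma>" using fs by (simp add: nt_boundary_value_def)
  qed
  have wi: "integrable ?\<sigma> ?w" using iN by simp
  have lim: "AE \<xi> in ?\<sigma>. (\<lambda>n. ?g n \<xi>) \<longlonglongrightarrow> ?K \<xi> * fs \<xi>"
  proof -
    have "AE \<xi> in ?\<sigma>. \<forall>\<beta>>0. (f \<longlongrightarrow> fs \<xi>) (at \<xi> within approach_region m \<beta> \<xi>)"
      using fs by (simp add: nt_boundary_value_def)
    then show ?thesis using AE_fefferman_frontier[OF m]
    proof eventually_elim
      case (elim \<xi>)
      have t: "(f \<longlongrightarrow> fs \<xi>) (at \<xi> within approach_region m \<alpha> \<xi>)" using elim \<alpha> by blast
      \<comment> \<open>The limit within the approach region excludes \<xi> itself, so the dilated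
        points must differ from \<xi>.\<close>
      have \<xi>0: "\<xi> \<noteq> 0" using frontier_bounds(1)[OF m elim(2)] m by (auto simp: power_0_left)
      have "(\<lambda>n. r n *\<^sub>R \<xi>) \<longlonglongrightarrow> 1 *\<^sub>R \<xi>" by (intro tendsto_intros rlim)
      then have "filterlim (\<lambda>n. r n *\<^sub>R \<xi>) (at \<xi> within approach_region m \<alpha> \<xi>) sequentially"
      proof -
        have "r n *\<^sub>R \<xi> \<noteq> \<xi>" for n
          using r(2)[of n] \<xi>0 by (metis less_irrefl scaleR_cancel_right scaleR_one)
        then show ?thesis
          unfolding filterlim_at using r0(3)[OF r elim(2)] \<open>(\<lambda>n. r n *\<^sub>R \<xi>) \<longlonglongrightarrow> 1 *\<^sub>R \<xi>\<close> by simp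
      qed
      from filterlim_compose[OF t this] have "(\<lambda>n. f (r n *\<^sub>R \<xi>)) \<longlonglongrightarrow> fs \<xi>" .
      then show ?case by (intro tendsto_mult tendsto_const)
    qed
  qed
  have bound: "AE \<xi> in ?\<sigma>. norm (?g n \<xi>) \<le> ?w \<xi>" for n
    using Nf AE_fefferman_frontier[OF m]
  proof eventually_elim
    case (elim \<xi>)
    obtain x where x: "x \<ge> 0" "N \<xi> = ennreal x" using elim(1) by (cases "N \<xi>") auto
    have "ennreal (cmod (f (r n *\<^sub>R \<xi>))) \<le> nt_maximal m \<alpha> f \<xi>"
      unfolding nt_maximal_def by (rule SUP_upper[OF r0(3)[OF r elim(2)]])
    also have "\<dots> = ennreal x" using x elim(2) by (simp add: N_def)
    finally have fx: "cmod (f (r n *\<^sub>R \<xi>)) \<le> x" using x by simp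
    have "x \<le> 1 + x\<^sup>2" using zero_le_power2[of "x - 1"] x(1) by (simp add: power2_eq_square algebra_simps)
    moreover have "enn2real ((N \<xi>)\<^sup>2) = x\<^sup>2" using x by (simp add: ennreal_power)
    ultimately have "cmod (f (r n *\<^sub>R \<xi>)) \<le> 1 + enn2real ((N \<xi>)\<^sup>2)" using fx by simp
    then show ?case unfolding norm_mult using KB B0 by (intro mult_mono) auto
  qed
  show "integrable ?\<sigma> (\<lambda>\<xi>. ?K \<xi> * fs \<xi>)"
    by (rule integrable_dominated_convergence[OF lm borel_measurable_integrable[OF gi] wi lim bound])
  have "(\<lambda>n. \<integral>\<xi>. ?g n \<xi> \<partial>?\<sigma>) \<longlonglongrightarrow> (\<integral>\<xi>. ?K \<xi> * fs \<xi> \<partial>?\<sigma>)"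
    by (rule integral_dominated_convergence[OF lm borel_measurable_integrable[OF gi] wi lim bound])
  then have "(\<lambda>n. f (r n *\<^sub>R \<zeta>)) \<longlonglongrightarrow> (\<integral>\<xi>. ?K \<xi> * fs \<xi> \<partial>?\<sigma>)"
    using dilate_reproducing[OF m hol rpos r(2) \<zeta>] by simp
  moreover have "(\<lambda>n. f (r n *\<^sub>R \<zeta>)) \<longlonglongrightarrow> f \<zeta>"
  proof -
    have "isCont f \<zeta>" using holomorphic2_on_continuous[OF hol] open_egg \<zeta> continuous_on_eq_continuous_at by blast
    moreover have "(\<lambda>n. r n *\<^sub>R \<zeta>) \<longlonglongrightarrow> 1 *\<^sub>R \<zeta>" by (intro tendsto_intros rlim)
    ultimately show ?thesis using isCont_tendsto_compose by fastforce
  qed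
  ultimately show "f \<zeta> = (\<integral>\<xi>. ?K \<xi> * fs \<xi> \<partial>?\<sigma>)" by (rule LIMSEQ_unique[symmetric])
qed

text \<open>Boundedness of the kernel on the closed egg bounds the maximal function whatever the
  aperture, and the measure is finite.\<close>

lemma kernel_mem_hardy:
  assumes m: "m \<ge> 1" and \<zeta>: "\<zeta> \<in> egg m"
  shows "(\<lambda>\<eta>. cnj (fs_kernel m \<zeta> \<eta>)) \<in> fefferman_hardy m \<alpha>"
proof -
  let ?\<sigma> = "fefferman_measure m" and ?M = "frontier (egg m)" and ?k = "\<lambda>\<eta>. cnj (fs_kernel m \<zeta> \<eta>)"
  interpret finite_measure ?\<sigma> by (rule finite_fefferman_measure[OF m])
  obtain B where B: "\<And>\<xi>. \<xi> \<in> closed_egg m \<Longrightarrow> cmod (fs_kernel m \<zeta> \<xi>) \<le> B"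
    using continuous_closed_egg_bounded[OF m continuous_on_fs_kernel[OF m \<zeta>]] by blast
  have N: "nt_maximal m \<alpha> ?k \<xi> \<le> ennreal B" for \<xi>
    unfolding nt_maximal_def
  proof (rule SUP_least)
    fix p assume "p \<in> approach_region m \<alpha> \<xi>"
    then have "p \<in> closed_egg m" using approach_region_subset_egg egg_subset_closed_egg by blast
    then show "ennreal (cmod (?k p)) \<le> ennreal B" using B by (simp add: ennreal_leI)
  qed
  have "(\<integral>\<^sup>+\<xi>\<in>?M. (nt_maximal m \<alpha> ?k \<xi>)\<^sup>2 \<partial>?\<sigma>) \<le> (\<integral>\<^sup>+\<xi>. (ennreal B)\<^sup>2 \<partial>?\<sigma>)"
    using N by (intro nn_integral_mono) (auto split: split_indicator intro: power_mono)
  also have "\<dots> < \<infinity>" 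
  proof -
    have "emeasure ?\<sigma> (space ?\<sigma>) < top"
      using emeasure_finite[of "space ?\<sigma>"] by (metis infinity_ennreal_def less_top)
    then show ?thesis by (simp add: ennreal_mult_less_top power2_eq_square)
  qed
  finally show ?thesis
    using holomorphic2_fs_kernel[OF m \<zeta>] nt_maximal_measurable[OF m] sets_fefferman_measure[OF m]
    by (simp add: fefferman_hardy_def cong: measurable_cong_sets)
qed

lemma kernel_nt_boundary_value:
  assumes m: "m \<ge> 1" and \<zeta>: "\<zeta> \<in> egg m"
  shows "nt_boundary_value m (fs_kernel m \<zeta>) (kernel_boundary m \<zeta>)"
  unfolding nt_boundary_value_def
proof (intro conjI)
  show "kernel_boundary m \<zeta> \<in> borel_measurable (fefferman_measure m)"
    using kernel_boundary_measurable[OF m \<zeta>] sets_fefferman_measure[OF m] by (simp cong: measurable_cong_sets)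
  show "AE \<xi> in fefferman_measure m. \<forall>\<beta>>0. (fs_kernel m \<zeta> \<longlongrightarrow> kernel_boundary m \<zeta> \<xi>) (at \<xi> within approach_region m \<beta> \<xi>)"
    using AE_fefferman_frontier[OF m]
  proof eventually_elim
    case (elim \<xi>)
    then have \<xi>: "\<xi> \<in> closed_egg m" using frontier_subset_closed_egg[OF m] by blast
    then have "(fs_kernel m \<zeta> \<longlongrightarrow> fs_kernel m \<zeta> \<xi>) (at \<xi> within closed_egg m)"
      using continuous_on_fs_kernel[OF m \<zeta>] by (simp add: continuous_on_def)
    then have "(fs_kernel m \<zeta> \<longlongrightarrow> fs_kernel m \<zeta> \<xi>) (at \<xi> within approach_region m \<beta> \<xi>)" for \<beta>
      by (rule tendsto_within_subset) (use approach_region_subset_egg egg_subset_closed_egg in blast)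
    then show ?case using \<xi> by (simp add: kernel_boundary_def)
  qed
qed

lemma nt_boundary_value_cnj:
  assumes "nt_boundary_value m f g"
  shows "nt_boundary_value m (\<lambda>p. cnj (f p)) (\<lambda>p. cnj (g p))"
  unfolding nt_boundary_value_def
proof (intro conjI)
  have "cnj \<in> borel_measurable borel" by (intro borel_measurable_continuous_onI continuous_intros)
  moreover have "g \<in> borel_measurable (fefferman_measure m)" using assms by (simp add: nt_boundary_value_def)
  ultimately show "(\<lambda>p. cnj (g p)) \<in> borel_measurable (fefferman_measure m)" by measurable
  have "AE \<xi> in fefferman_measure m. \<forall>\<beta>>0. (f \<longlongrightarrow> g \<xi>) (at \<xi> within approach_region m \<beta> \<xi>)"
    using assms by (simp add: nt_boundary_value_def)
  then show "AE \<xi> in fefferman_measure m. \<forall>\<beta>>0. ((\<lambda>p. cnj (f p)) \<longlongrightarrow> cnj (g \<xi>)) (at \<xi> within approach_region m \<beta> \<xi>)"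
    by eventually_elim (auto intro: tendsto_cnj)
qed

text \<open>Functions are total but only their values in the egg are meaningful. Since the approach
  regions lie in the egg, the other values never enter a boundary value.\<close>

lemma nt_boundary_value_cong:
  assumes "\<And>p. p \<in> egg m \<Longrightarrow> f p = g p" and f: "nt_boundary_value m f h"
  shows "nt_boundary_value m g h"
proof -
  have "(f \<longlongrightarrow> l) (at \<xi> within approach_region m \<beta> \<xi>) \<longleftrightarrow> (g \<longlongrightarrow> l) (at \<xi> within approach_region m \<beta> \<xi>)" for \<xi> l \<beta>
    by (intro Lim_cong_within refl assms(1) subsetD[OF approach_region_subset_egg])
  then show ?thesis using f by (simp add: nt_boundary_value_def)
qed

lemma fefferman_hardy_cong:
  assumes eq: "\<And>p. p \<in> egg m \<Longrightarrow> f p = g p" and f: "f \<in> fefferman_hardy m \<alpha>"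
  shows "g \<in> fefferman_hardy m \<alpha>"
proof -
  have "nt_maximal m \<alpha> f = nt_maximal m \<alpha> g"
  proof
    fix \<xi>
    have "ennreal (cmod (f p)) = ennreal (cmod (g p))" if "p \<in> approach_region m \<alpha> \<xi>" for p
      using eq[OF subsetD[OF approach_region_subset_egg that]] by simp
    then show "nt_maximal m \<alpha> f \<xi> = nt_maximal m \<alpha> g \<xi>"
      unfolding nt_maximal_def by (intro SUP_cong refl)
  qed
  moreover have "holomorphic2_on g (egg m)"
    unfolding holomorphic2_on_def
  proof
    fix p assume p: "p \<in> egg m"
    then obtain a b where "(f has_derivative (\<lambda>h. a * fst h + b * snd h)) (at p)"
      using f by (auto simp: fefferman_hardy_def holomorphic2_on_def)
    then have "(g has_derivative (\<lambda>h. a * fst h + b * snd h)) (at p)"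
      by (rule has_derivative_transform_within_open[OF _ open_egg p]) (rule eq)
    then show "\<exists>a b. (g has_derivative (\<lambda>h. a * fst h + b * snd h)) (at p)" by blast
  qed
  ultimately show ?thesis using f by (simp add: fefferman_hardy_def)
qed

text \<open>An equivalence contains existence and uniqueness at once. The kernel is constrained only
  on the egg, so uniqueness can claim no more than agreement there.\<close>

theorem is_fefferman_szego_kernel_iff:
  assumes m: "m \<ge> 1" and \<alpha>: "\<alpha> > 0"
  shows "is_fefferman_szego_kernel m \<alpha> S \<longleftrightarrow> (\<forall>\<zeta>\<in>egg m. \<forall>\<eta>\<in>egg m. S \<zeta> \<eta> = fs_kernel m \<zeta> \<eta>)"
proof
  assume S: "\<forall>\<zeta>\<in>egg m. \<forall>\<eta>\<in>egg m. S \<zeta> \<eta> = fs_kernel m \<zeta> \<eta>"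
  show "is_fefferman_szego_kernel m \<alpha> S"
    unfolding is_fefferman_szego_kernel_def
  proof (intro ballI conjI exI[of _ "kernel_boundary m _"] allI impI)
    fix \<zeta> assume \<zeta>: "\<zeta> \<in> egg m"
    show "(\<lambda>\<eta>. cnj (S \<zeta> \<eta>)) \<in> fefferman_hardy m \<alpha>"
      using S \<zeta> by (intro fefferman_hardy_cong[OF _ kernel_mem_hardy[OF m \<zeta>]]) simp
    show "nt_boundary_value m (S \<zeta>) (kernel_boundary m \<zeta>)"
      using S \<zeta> by (intro nt_boundary_value_cong[OF _ kernel_nt_boundary_value[OF m \<zeta>]]) simp
    fix f fs assume "f \<in> fefferman_hardy m \<alpha>" "nt_boundary_value m f fs"
    note hardy_reproducing[OF m \<alpha> this \<zeta>]
    then show "integrable (fefferman_measure m) (\<lambda>\<xi>. kernel_boundary m \<zeta> \<xi> * fs \<xi>)"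
      "f \<zeta> = (\<integral>\<xi>. kernel_boundary m \<zeta> \<xi> * fs \<xi> \<partial>fefferman_measure m)" .
  qed
next
  assume S: "is_fefferman_szego_kernel m \<alpha> S"
  show "\<forall>\<zeta>\<in>egg m. \<forall>\<eta>\<in>egg m. S \<zeta> \<eta> = fs_kernel m \<zeta> \<eta>"
  proof (intro ballI)
    fix \<zeta> \<eta> assume \<zeta>: "\<zeta> \<in> egg m" and \<eta>: "\<eta> \<in> egg m"
    have \<zeta>c: "\<zeta> \<in> closed_egg m" using \<zeta> egg_subset_closed_egg by blast
    obtain s where h: "(\<lambda>\<eta>. cnj (S \<zeta> \<eta>)) \<in> fefferman_hardy m \<alpha>" and s: "nt_boundary_value m (S \<zeta>) s"
      and rep: "\<And>f fs. f \<in> fefferman_hardy m \<alpha> \<Longrightarrow> nt_boundary_value m f fs \<Longrightarrow> f \<zeta> = (\<integral>\<xi>. s \<xi> * fs \<xi> \<partial>fefferman_measure m)"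
      using S \<zeta> unfolding is_fefferman_szego_kernel_def by blast
    \<comment> \<open>\<open>fs_kernel\<close> at \<eta> reproduces the conjugate of
      \<open>S \<zeta>\<close>, and \<open>S\<close> at \<zeta> reproduces the conjugate of the
      kernel at \<eta>; up to conjugation both evaluate the same integral.\<close>
    have "cnj (S \<zeta> \<eta>) = (\<integral>\<xi>. kernel_boundary m \<eta> \<xi> * cnj (s \<xi>) \<partial>fefferman_measure m)"
      by (rule hardy_reproducing(2)[OF m \<alpha> h nt_boundary_value_cnj[OF s] \<eta>])
    also have "\<dots> = (\<integral>\<xi>. cnj (s \<xi> * cnj (kernel_boundary m \<eta> \<xi>)) \<partial>fefferman_measure m)"
      by (simp add: mult.commute)
    also have "\<dots> = cnj (\<integral>\<xi>. s \<xi> * cnj (kernel_boundary m \<eta> \<xi>) \<partial>fefferman_measure m)"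
      by (rule Bochner_Integration.integral_cnj)
    also have "(\<integral>\<xi>. s \<xi> * cnj (kernel_boundary m \<eta> \<xi>) \<partial>fefferman_measure m) = cnj (fs_kernel m \<eta> \<zeta>)"
      by (rule rep[OF kernel_mem_hardy[OF m \<eta>] nt_boundary_value_cnj[OF kernel_nt_boundary_value[OF m \<eta>]], symmetric])
    finally have "S \<zeta> \<eta> = cnj (fs_kernel m \<eta> \<zeta>)" by (simp only: complex_cnj_cancel_iff)
    then show "S \<zeta> \<eta> = fs_kernel m \<zeta> \<eta>" using cnj_fs_kernel[OF m \<eta> \<zeta>c] by simp
  qed
qed

theorem theorem1p2:
  fixes m :: nat and \<alpha> :: real and S :: "complex \<times> complex \<Rightarrow> complex \<times> complex \<Rightarrow> complex"
  assumes "m \<ge> 1" and "\<alpha> > 0"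
  shows "is_fefferman_szego_kernel m \<alpha> S \<longleftrightarrow>
    (\<forall>z1 w1 z2 w2. (z1, w1) \<in> egg m \<longrightarrow> (z2, w2) \<in> egg m \<longrightarrow>
      S (z1, w1) (z2, w2) =
        complex_of_real (root 3 (real m) / (2 * pi\<^sup>2)) *
        ((of_nat m + 2) * (1 - z1 * cnj z2) powr (1 / of_nat m) + (1 - of_nat m) * (w1 * cnj w2)) /
        (3 * of_nat m * (1 - z1 * cnj z2) powr ((4 * of_nat m - 1) / (3 * of_nat m)) *
          ((1 - z1 * cnj z2) powr (1 / of_nat m) - w1 * cnj w2)\<^sup>2))"
  unfolding is_fefferman_szego_kernel_iff[OF assms] fs_kernel_def Let_def by auto

end
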